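(* Let $(\mathscr{C},\mathbb{E},\mathfrak{s})$ be an extriangulated category and let $\tilde{\mathscr{C}}$ be the idempotent completion of the additive category $\mathscr{C}$. Then $\tilde{\mathscr{C}}$ is extriangulated, i.e. there are a biadditive functor $\mathbb{F}\colon\tilde{\mathscr{C}}^{\mathrm{op}}\times\tilde{\mathscr{C}}\to Ab$ and a correspondence $\mathfrak{r}$ such that $(\tilde{\mathscr{C}},\mathbb{F},\mathfrak{r})$ is an extriangulated category. Moreover, in this case the embedding $i_{\mathscr{C}}\colon\mathscr{C}\to\tilde{\mathscr{C}}$, $A\mapsto(A,1_A)$, $f\mapsto f$, is an extriangulated functor $(\mathscr{C},\mathbb{E},\mathfrak{s})\to(\tilde{\mathscr{C}},\mathbb{F},\mathfrak{r})$.
   Context: **Idempotent completion.** For an additive category $\mathscr{C}$, the category $\tilde{\mathscr{C}}$ has as objects the pairs $(A,p)$ with $A\in\mathscr{C}$ and $p\colon A\to A$, $p^2=p$. A morphism $(A,p)\to(B,q)$ is a morphism $\sigma\colon A\to B$ in $\mathscr{C}$ with $\sigma p=q\sigma=\sigma$; composition is that of $\mathscr{C}$, $1_{(A,p)}=p$, and $(A,p)\oplus(B,q)=(A\oplus B,p\oplus q)$. **Extriangulated categories (Nakaoka–Palu).** Let $\mathscr{C}$ be additive and $\mathbb{E}\colon\mathscr{C}^{\mathrm{op}}\times\mathscr{C}\to Ab$ a biadditive functor ($Ab$ = abelian groups). An $\mathbb{E}$-extension is an element $\delta\in\mathbb{E}(C,A)$. For $a\colon A\to A'$ and $c\colon C'\to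 C$ write $a_*\delta=\mathbb{E}(C,a)(\delta)$, $c^*\delta=\mathbb{E}(c,A)(\delta)$. A morphism of extensions $(a,c)\colon\delta\to\delta'$, with $\delta\in\mathbb{E}(C,A)$, $\delta'\in\mathbb{E}(C',A')$, is a pair $a\colon A\to A'$, $c\colon C\to C'$ with $a_*\delta=c^*\delta'$. The extension $\delta\oplus\delta'\in\mathbb{E}(C\oplus C',A\oplus A')$ corresponds to $(\delta,0,0,\delta')$ under biadditivity. Sequences $A\xrightarrow{x}B\xrightarrow{y}C$ and $A\xrightarrow{x'}B'\xrightarrow{y'}C$ are equivalent if there is an isomorphism $b\colon B\to B'$ with $bx=x'$, $y'b=y$; the class is written $[A\xrightarrow{x}B\xrightarrow{y}C]$. A realisation $\mathfrak{s}$ assigns to each $\delta\in\mathbb{E}(C,A)$ a class $\mathfrak{s}(\delta)=[A\xrightarrow{x}B\xrightarrow{y}C]$ (the sequence is then said to realise $\delta$) such that whenever $\mathfrak{s}(\delta)=[A\xrightarrow{x}B\xrightarrow{y}C]$, $\mathfrak{s}(\delta')=[A'\xrightarrow{x'}B'\xrightarrow{y'}C']$ and $(a,c)\colon\delta\to\delta'$ is a morphism of extensions, there is $b\colon B\to B'$ with $bx=x'a$ and $y'b=cy$; one says $(a,b,c)$ realises $(a,c)$. It is additive if $\mathfrak{s}(0)=[A\to A\oplus C\to C]$ (canonical inclusion and projection) and $\mathfrak{s}(\delta\oplus\delta')=\mathfrak{s}(\delta)\oplus\mathfrak{s}(\delta')$ (termwise direct sum). The triple $(\mathscr{C},\mathbb{E},\mathfrak{s})$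 is extriangulated if: (ET1) $\mathbb{E}$ is a biadditive functor. (ET2) $\mathfrak{s}$ is an additive realisation of $\mathbb{E}$. (ET3) If $\delta,\delta'$ are realised by $A\xrightarrow{x}B\xrightarrow{y}C$ and $A'\xrightarrow{x'}B'\xrightarrow{y'}C'$, and $a\colon A\to A'$, $b\colon B\to B'$ satisfy $bx=x'a$, then there is $c\colon C\to C'$ such that $(a,c)\colon\delta\to\delta'$ is a morphism of extensions realised by $(a,b,c)$. (ET3)$^{\mathrm{op}}$ Dually: given $b,c$ with $cy=y'b$ there is $a$ such that $(a,c)\colon\delta\to\delta'$ is a morphism of extensions realised by $(a,b,c)$. (ET4) If $\delta\in\mathbb{E}(D,A)$ and $\delta'\in\mathbb{E}(F,B)$ are realised by $A\xrightarrow{f}B\xrightarrow{f'}D$ and $B\xrightarrow{g}C\xrightarrow{g'}F$, then there are an object $E$, morphisms $h\colon A\to C$, $h'\colon C\to E$, $d\colon D\to E$, $e\colon E\to F$ with $h=gf$, $h'g=df'$, $eh'=g'$, and $\delta''\in\mathbb{E}(E,A)$ realised by $A\xrightarrow{h}C\xrightarrow{h'}E$, such that $\mathfrak{s}(f'_*\delta')=[D\xrightarrow{d}E\xrightarrow{e}F]$, $d^*\delta''=\delta$, $f_*\delta''=e^*\delta'$. (ET4)$^{\mathrm{op}}$ If $\delta\in\mathbb{E}(B,D)$ and $\delta'\in\mathbb{E}(C,F)$ are realised by $D\xrightarrow{f'}A\xrightarrow{f}B$ and $F\xrightarrow{g'}B\xrightarrow{g}C$, then there are an object $E$, morphisms $d\colon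 D\to E$, $e\colon E\to F$, $h'\colon E\to A$, $h\colon A\to C$ with $h=gf$, $h'd=f'$, $fh'=g'e$, and $\delta''\in\mathbb{E}(C,E)$ realised by $E\xrightarrow{h'}A\xrightarrow{h}C$, such that $\mathfrak{s}(g'^*\delta)=[D\xrightarrow{d}E\xrightarrow{e}F]$, $e_*\delta''=\delta'$, $d_*\delta=g^*\delta''$. **Extriangulated functor.** A covariant additive functor $F\colon\mathscr{C}\to\mathscr{C}'$ between extriangulated categories $(\mathscr{C},\mathbb{E},\mathfrak{s})$, $(\mathscr{C}',\mathbb{E}',\mathfrak{s}')$ is extriangulated if there is a natural transformation $\Gamma\colon\mathbb{E}\Rightarrow\mathbb{E}'(F^{\mathrm{op}}-,F-)$ of functors $\mathscr{C}^{\mathrm{op}}\times\mathscr{C}\to Ab$ such that $\mathfrak{s}(\delta)=[X\xrightarrow{x}Y\xrightarrow{y}Z]$ implies $\mathfrak{s}'(\Gamma_{(Z,X)}(\delta))=[F(X)\xrightarrow{F(x)}F(Y)\xrightarrow{F(y)}F(Z)]$. *)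

theory Defs
  imports "HOL-Algebra.Group"
begin

section \<open>Additive categories\<close>

text \<open>
  Abelian groups are \<^locale>\<open>comm_group\<close>s of HOL-Algebra; their operation \<open>\<otimes>\<close> is the addition and
  their unit \<open>\<one>\<close> is the zero element.

  Hom-sets are indexed by pairs of objects and need not be disjoint: a morphism of the idempotent
  completion is a morphism of the original category, which does not determine its source and target
  there. Hence composition carries its objects: \<open>Comp C X Y Z g f\<close> is \<open>g f\<close> for \<open>f : X \<rightarrow> Y\<close> and
  \<open>g : Y \<rightarrow> Z\<close>. Binary direct sums are part of the data: \<open>DSum C A B\<close> has the inclusions
  \<open>In1 C A B : A \<rightarrow> A \<oplus> B\<close>, \<open>In2 C A B : B \<rightarrow> A \<oplus> B\<close> and the projections \<open>Pr1 C A B\<close>, \<open>Pr2 C A B\<close>.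
\<close>

record ('o, 'm) category_data =
  Ob :: "'o set"
  Hom :: "'o \<Rightarrow> 'o \<Rightarrow> 'm monoid"
  Ident :: "'o \<Rightarrow> 'm"
  Comp :: "'o \<Rightarrow> 'o \<Rightarrow> 'o \<Rightarrow> 'm \<Rightarrow> 'm \<Rightarrow> 'm"
  DSum :: "'o \<Rightarrow> 'o \<Rightarrow> 'o"
  In1 :: "'o \<Rightarrow> 'o \<Rightarrow> 'm"
  In2 :: "'o \<Rightarrow> 'o \<Rightarrow> 'm"
  Pr1 :: "'o \<Rightarrow> 'o \<Rightarrow> 'm"
  Pr2 :: "'o \<Rightarrow> 'o \<Rightarrow> 'm"

abbreviation Mor :: "('o, 'm) category_data \<Rightarrow> 'o \<Rightarrow> 'o \<Rightarrow> 'm set" where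
  "Mor C A B \<equiv> carrier (Hom C A B)"

locale category =
  fixes C :: "('o, 'm) category_data"
  assumes Ident_mor: "A \<in> Ob C \<Longrightarrow> Ident C A \<in> Mor C A A"
    and Comp_mor: "\<lbrakk>X \<in> Ob C; Y \<in> Ob C; Z \<in> Ob C; f \<in> Mor C X Y; g \<in> Mor C Y Z\<rbrakk>
      \<Longrightarrow> Comp C X Y Z g f \<in> Mor C X Z"
    and Comp_Ident_right: "\<lbrakk>X \<in> Ob C; Y \<in> Ob C; f \<in> Mor C X Y\<rbrakk>
      \<Longrightarrow> Comp C X X Y f (Ident C X) = f"
    and Comp_Ident_left: "\<lbrakk>X \<in> Ob C; Y \<in> Ob C; f \<in> Mor C X Y\<rbrakk>
      \<Longrightarrow> Comp C X Y Y (Ident C Y) f = f"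
    and Comp_assoc: "\<lbrakk>W \<in> Ob C; X \<in> Ob C; Y \<in> Ob C; Z \<in> Ob C;
        f \<in> Mor C W X; g \<in> Mor C X Y; h \<in> Mor C Y Z\<rbrakk>
      \<Longrightarrow> Comp C W X Z (Comp C X Y Z h g) f = Comp C W Y Z h (Comp C W X Y g f)"

definition zero_object :: "('o, 'm) category_data \<Rightarrow> 'o \<Rightarrow> bool" where
  "zero_object C Z \<longleftrightarrow> Z \<in> Ob C \<and>
     (\<forall>A\<in>Ob C. (\<exists>!f. f \<in> Mor C Z A) \<and> (\<exists>!f. f \<in> Mor C A Z))"

locale additive_category = category C
  for C :: "('o, 'm) category_data" +
  assumes Hom_group: "\<lbrakk>A \<in> Ob C; B \<in> Ob C\<rbrakk> \<Longrightarrow> comm_group (Hom C A B)"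
    and Comp_add_left: "\<lbrakk>X \<in> Ob C; Y \<in> Ob C; Z \<in> Ob C;
        f \<in> Mor C X Y; g \<in> Mor C Y Z; g' \<in> Mor C Y Z\<rbrakk>
      \<Longrightarrow> Comp C X Y Z (g \<otimes>\<^bsub>Hom C Y Z\<^esub> g') f
        = Comp C X Y Z g f \<otimes>\<^bsub>Hom C X Z\<^esub> Comp C X Y Z g' f"
    and Comp_add_right: "\<lbrakk>X \<in> Ob C; Y \<in> Ob C; Z \<in> Ob C;
        f \<in> Mor C X Y; f' \<in> Mor C X Y; g \<in> Mor C Y Z\<rbrakk>
      \<Longrightarrow> Comp C X Y Z g (f \<otimes>\<^bsub>Hom C X Y\<^esub> f')
        = Comp C X Y Z g f \<otimes>\<^bsub>Hom C X Z\<^esub> Comp C X Y Z g f'"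
    and zero_object_exists: "\<exists>Z. zero_object C Z"
    and DSum_ob: "\<lbrakk>A \<in> Ob C; B \<in> Ob C\<rbrakk> \<Longrightarrow> DSum C A B \<in> Ob C"
    and In1_mor: "\<lbrakk>A \<in> Ob C; B \<in> Ob C\<rbrakk> \<Longrightarrow> In1 C A B \<in> Mor C A (DSum C A B)"
    and In2_mor: "\<lbrakk>A \<in> Ob C; B \<in> Ob C\<rbrakk> \<Longrightarrow> In2 C A B \<in> Mor C B (DSum C A B)"
    and Pr1_mor: "\<lbrakk>A \<in> Ob C; B \<in> Ob C\<rbrakk> \<Longrightarrow> Pr1 C A B \<in> Mor C (DSum C A B) A"
    and Pr2_mor: "\<lbrakk>A \<in> Ob C; B \<in> Ob C\<rbrakk> \<Longrightarrow> Pr2 C A B \<in> Mor C (DSum C A B) B"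
    and Pr1_In1: "\<lbrakk>A \<in> Ob C; B \<in> Ob C\<rbrakk>
      \<Longrightarrow> Comp C A (DSum C A B) A (Pr1 C A B) (In1 C A B) = Ident C A"
    and Pr2_In2: "\<lbrakk>A \<in> Ob C; B \<in> Ob C\<rbrakk>
      \<Longrightarrow> Comp C B (DSum C A B) B (Pr2 C A B) (In2 C A B) = Ident C B"
    and Pr1_In2: "\<lbrakk>A \<in> Ob C; B \<in> Ob C\<rbrakk>
      \<Longrightarrow> Comp C B (DSum C A B) A (Pr1 C A B) (In2 C A B) = \<one>\<^bsub>Hom C B A\<^esub>"
    and Pr2_In1: "\<lbrakk>A \<in> Ob C; B \<in> Ob C\<rbrakk>
      \<Longrightarrow> Comp C A (DSum C A B) B (Pr2 C A B) (In1 C A B) = \<one>\<^bsub>Hom C A B\<^esub>"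
    and In_Pr_add: "\<lbrakk>A \<in> Ob C; B \<in> Ob C\<rbrakk>
      \<Longrightarrow> Comp C (DSum C A B) A (DSum C A B) (In1 C A B) (Pr1 C A B)
          \<otimes>\<^bsub>Hom C (DSum C A B) (DSum C A B)\<^esub>
          Comp C (DSum C A B) B (DSum C A B) (In2 C A B) (Pr2 C A B)
        = Ident C (DSum C A B)"

text \<open>\<open>f \<oplus> g : A \<oplus> B \<rightarrow> A' \<oplus> B'\<close> for \<open>f : A \<rightarrow> A'\<close> and \<open>g : B \<rightarrow> B'\<close>.\<close>

definition mor_sum ::
    "('o, 'm) category_data \<Rightarrow> 'o \<Rightarrow> 'o \<Rightarrow> 'o \<Rightarrow> 'o \<Rightarrow> 'm \<Rightarrow> 'm \<Rightarrow> 'm" where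
  "mor_sum C A B A' B' f g =
     (let S = DSum C A B; S' = DSum C A' B' in
        Comp C S A' S' (In1 C A' B') (Comp C S A A' f (Pr1 C A B))
        \<otimes>\<^bsub>Hom C S S'\<^esub>
        Comp C S B' S' (In2 C A' B') (Comp C S B B' g (Pr2 C A B)))"

definition isomorphism :: "('o, 'm) category_data \<Rightarrow> 'o \<Rightarrow> 'o \<Rightarrow> 'm \<Rightarrow> bool" where
  "isomorphism C A B f \<longleftrightarrow> f \<in> Mor C A B \<and>
     (\<exists>g\<in>Mor C B A. Comp C A B A g f = Ident C A \<and> Comp C B A B f g = Ident C B)"


section \<open>Idempotent completion\<close>

text \<open>
  The direct sum of \<open>(A, p)\<close> and \<open>(B, q)\<close> is \<open>(A \<oplus> B, p \<oplus> q)\<close>. Its inclusions and projections are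
  those of \<open>A \<oplus> B\<close> cut down by the idempotents \<open>p\<close> and \<open>q\<close>.
\<close>

definition idempotent_completion ::
    "('o, 'm) category_data \<Rightarrow> ('o \<times> 'm, 'm) category_data" where
  "idempotent_completion C =
    \<lparr> Ob = {(A, p). A \<in> Ob C \<and> p \<in> Mor C A A \<and> Comp C A A A p p = p},
      Hom = (\<lambda>(A, p) (B, q). (Hom C A B)
        \<lparr>carrier := {\<sigma> \<in> Mor C A B. Comp C A A B \<sigma> p = \<sigma> \<and> Comp C A B B q \<sigma> = \<sigma>}\<rparr>),
      Ident = (\<lambda>(A, p). p),
      Comp = (\<lambda>(X, p) (Y, q) (Z, r). Comp C X Y Z),
      DSum = (\<lambda>(A, p) (B, q). (DSum C A B, mor_sum C A B A B p q)),
      In1 = (\<lambda>(A, p) (B, q). Comp C A A (DSum C A B) (In1 C A B) p),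
      In2 = (\<lambda>(A, p) (B, q). Comp C B B (DSum C A B) (In2 C A B) q),
      Pr1 = (\<lambda>(A, p) (B, q). Comp C (DSum C A B) A A p (Pr1 C A B)),
      Pr2 = (\<lambda>(A, p) (B, q). Comp C (DSum C A B) B B q (Pr2 C A B)) \<rparr>"


section \<open>Biadditive functors and extensions\<close>

text \<open>
  For \<open>c : Z' \<rightarrow> Z\<close> and \<open>a : A \<rightarrow> A'\<close>, \<open>EMap E Z A Z' A' c a\<close> is the homomorphism
  \<open>E(c, a) : E(Z, A) \<rightarrow> E(Z', A')\<close>.
\<close>

record ('o, 'm, 'e) bifunctor_data =
  EGrp :: "'o \<Rightarrow> 'o \<Rightarrow> 'e monoid"
  EMap :: "'o \<Rightarrow> 'o \<Rightarrow> 'o \<Rightarrow> 'o \<Rightarrow> 'm \<Rightarrow> 'm \<Rightarrow> 'e \<Rightarrow> 'e"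

abbreviation Ext :: "('o, 'm, 'e) bifunctor_data \<Rightarrow> 'o \<Rightarrow> 'o \<Rightarrow> 'e set" where
  "Ext E Z A \<equiv> carrier (EGrp E Z A)"

text \<open>\<open>push C E Z A A' a \<delta>\<close> is \<open>a\<^sub>* \<delta>\<close> for \<open>\<delta> \<in> E(Z, A)\<close> and \<open>a : A \<rightarrow> A'\<close>.\<close>

definition push :: "('o, 'm) category_data \<Rightarrow> ('o, 'm, 'e) bifunctor_data
    \<Rightarrow> 'o \<Rightarrow> 'o \<Rightarrow> 'o \<Rightarrow> 'm \<Rightarrow> 'e \<Rightarrow> 'e" where
  "push C E Z A A' a = EMap E Z A Z A' (Ident C Z) a"

text \<open>\<open>pull C E Z Z' A c \<delta>\<close> is \<open>c\<^sup>* \<delta>\<close> for \<open>\<delta> \<in> E(Z, A)\<close> and \<open>c : Z' \<rightarrow> Z\<close>.\<close>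

definition pull :: "('o, 'm) category_data \<Rightarrow> ('o, 'm, 'e) bifunctor_data
    \<Rightarrow> 'o \<Rightarrow> 'o \<Rightarrow> 'o \<Rightarrow> 'm \<Rightarrow> 'e \<Rightarrow> 'e" where
  "pull C E Z Z' A c = EMap E Z A Z' A c (Ident C A)"

locale biadditive_functor = additive_category C
  for C :: "('o, 'm) category_data" +
  fixes E :: "('o, 'm, 'e) bifunctor_data"
  assumes EGrp_group: "\<lbrakk>Z \<in> Ob C; A \<in> Ob C\<rbrakk> \<Longrightarrow> comm_group (EGrp E Z A)"
    and EMap_hom: "\<lbrakk>Z \<in> Ob C; Z' \<in> Ob C; A \<in> Ob C; A' \<in> Ob C; c \<in> Mor C Z' Z; a \<in> Mor C A A'\<rbrakk>
      \<Longrightarrow> EMap E Z A Z' A' c a \<in> hom (EGrp E Z A) (EGrp E Z' A')"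
    and EMap_Ident: "\<lbrakk>Z \<in> Ob C; A \<in> Ob C; \<delta> \<in> Ext E Z A\<rbrakk>
      \<Longrightarrow> EMap E Z A Z A (Ident C Z) (Ident C A) \<delta> = \<delta>"
    and EMap_Comp: "\<lbrakk>Z \<in> Ob C; Z' \<in> Ob C; Z'' \<in> Ob C; A \<in> Ob C; A' \<in> Ob C; A'' \<in> Ob C;
        c \<in> Mor C Z' Z; c' \<in> Mor C Z'' Z'; a \<in> Mor C A A'; a' \<in> Mor C A' A''; \<delta> \<in> Ext E Z A\<rbrakk>
      \<Longrightarrow> EMap E Z A Z'' A'' (Comp C Z'' Z' Z c c') (Comp C A A' A'' a' a) \<delta>
        = EMap E Z' A' Z'' A'' c' a' (EMap E Z A Z' A' c a \<delta>)"
    and push_add: "\<lbrakk>Z \<in> Ob C; A \<in> Ob C; A' \<in> Ob C; a \<in> Mor C A A'; b \<in> Mor C A A';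
        \<delta> \<in> Ext E Z A\<rbrakk>
      \<Longrightarrow> push C E Z A A' (a \<otimes>\<^bsub>Hom C A A'\<^esub> b) \<delta>
        = push C E Z A A' a \<delta> \<otimes>\<^bsub>EGrp E Z A'\<^esub> push C E Z A A' b \<delta>"
    and pull_add: "\<lbrakk>Z \<in> Ob C; Z' \<in> Ob C; A \<in> Ob C; c \<in> Mor C Z' Z; d \<in> Mor C Z' Z;
        \<delta> \<in> Ext E Z A\<rbrakk>
      \<Longrightarrow> pull C E Z Z' A (c \<otimes>\<^bsub>Hom C Z' Z\<^esub> d) \<delta>
        = pull C E Z Z' A c \<delta> \<otimes>\<^bsub>EGrp E Z' A\<^esub> pull C E Z Z' A d \<delta>"

text \<open>Here \<open>\<delta> \<in> E(Z, A)\<close> and \<open>\<delta>' \<in> E(Z', A')\<close>.\<close>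

definition ext_morphism :: "('o, 'm) category_data \<Rightarrow> ('o, 'm, 'e) bifunctor_data
    \<Rightarrow> 'o \<Rightarrow> 'o \<Rightarrow> 'e \<Rightarrow> 'o \<Rightarrow> 'o \<Rightarrow> 'e \<Rightarrow> 'm \<Rightarrow> 'm \<Rightarrow> bool" where
  "ext_morphism C E Z A \<delta> Z' A' \<delta>' a c \<longleftrightarrow>
     a \<in> Mor C A A' \<and> c \<in> Mor C Z Z' \<and> push C E Z A A' a \<delta> = pull C E Z' Z A' c \<delta>'"

text \<open>
  The element \<open>\<delta> \<oplus> \<delta>'\<close> of \<open>E(Z \<oplus> Z', A \<oplus> A')\<close>. It corresponds to \<open>(\<delta>, 0, 0, \<delta>')\<close> under the isomorphism
  \<open>E(Z \<oplus> Z', A \<oplus> A') \<cong> E(Z, A) \<oplus> E(Z, A') \<oplus> E(Z', A) \<oplus> E(Z', A')\<close> whose components are induced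
  by the inclusions of \<open>Z \<oplus> Z'\<close> and the projections of \<open>A \<oplus> A'\<close>.
\<close>

definition ext_sum :: "('o, 'm) category_data \<Rightarrow> ('o, 'm, 'e) bifunctor_data
    \<Rightarrow> 'o \<Rightarrow> 'o \<Rightarrow> 'e \<Rightarrow> 'o \<Rightarrow> 'o \<Rightarrow> 'e \<Rightarrow> 'e" where
  "ext_sum C E Z A \<delta> Z' A' \<delta>' =
     (let S = DSum C Z Z'; T = DSum C A A' in
       (THE \<eta>. \<eta> \<in> Ext E S T \<and>
          EMap E S T Z A (In1 C Z Z') (Pr1 C A A') \<eta> = \<delta> \<and>
          EMap E S T Z A' (In1 C Z Z') (Pr2 C A A') \<eta> = \<one>\<^bsub>EGrp E Z A'\<^esub> \<and>
          EMap E S T Z' A (In2 C Z Z') (Pr1 C A A') \<eta> = \<one>\<^bsub>EGrp E Z' A\<^esub> \<and>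
          EMap E S T Z' A' (In2 C Z Z') (Pr2 C A A') \<eta> = \<delta>'))"


section \<open>Realisations\<close>

text \<open>A triple \<open>(x, B, y)\<close> stands for the sequence \<open>A \<rightarrow> B \<rightarrow> Z\<close> with morphisms \<open>x\<close> and \<open>y\<close>.\<close>

type_synonym ('o, 'm) seq = "'m \<times> 'o \<times> 'm"

definition seqs :: "('o, 'm) category_data \<Rightarrow> 'o \<Rightarrow> 'o \<Rightarrow> ('o, 'm) seq set" where
  "seqs C A Z = {(x, B, y). B \<in> Ob C \<and> x \<in> Mor C A B \<and> y \<in> Mor C B Z}"

definition seq_equiv :: "('o, 'm) category_data \<Rightarrow> 'o \<Rightarrow> 'o \<Rightarrow> ('o, 'm) seq rel" where
  "seq_equiv C A Z =
     {((x, B, y), (x', B', y')). (x, B, y) \<in> seqs C A Z \<and> (x', B', y') \<in> seqs C A Z \<and>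
        (\<exists>b. isomorphism C B B' b \<and> Comp C A B B' b x = x' \<and> Comp C B B' Z y' b = y)}"

definition seq_class ::
    "('o, 'm) category_data \<Rightarrow> 'o \<Rightarrow> 'o \<Rightarrow> 'm \<Rightarrow> 'o \<Rightarrow> 'm \<Rightarrow> ('o, 'm) seq set" where
  "seq_class C A Z x B y = seq_equiv C A Z `` {(x, B, y)}"

text \<open>\<open>\<ss> Z A \<delta>\<close> is the class of sequences assigned to \<open>\<delta> \<in> E(Z, A)\<close>.\<close>

type_synonym ('o, 'm, 'e) correspondence = "'o \<Rightarrow> 'o \<Rightarrow> 'e \<Rightarrow> ('o, 'm) seq set"

definition realises :: "('o, 'm) category_data \<Rightarrow> ('o, 'm, 'e) correspondence
    \<Rightarrow> 'o \<Rightarrow> 'o \<Rightarrow> 'e \<Rightarrow> 'm \<Rightarrow> 'o \<Rightarrow> 'm \<Rightarrow> bool" where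
  "realises C \<ss> Z A \<delta> x B y \<longleftrightarrow> (x, B, y) \<in> seqs C A Z \<and> \<ss> Z A \<delta> = seq_class C A Z x B y"

text \<open>
  The triple \<open>(a, b, c)\<close> is a morphism from the sequence \<open>A \<rightarrow> B \<rightarrow> Z\<close> to the sequence
  \<open>A' \<rightarrow> B' \<rightarrow> Z'\<close>; the membership of \<open>a\<close> and \<open>c\<close> is part of \<^const>\<open>ext_morphism\<close>.
\<close>

definition realises_morphism :: "('o, 'm) category_data
    \<Rightarrow> 'o \<Rightarrow> 'o \<Rightarrow> 'm \<Rightarrow> 'o \<Rightarrow> 'm \<Rightarrow> 'o \<Rightarrow> 'o \<Rightarrow> 'm \<Rightarrow> 'o \<Rightarrow> 'm \<Rightarrow> 'm \<Rightarrow> 'm \<Rightarrow> 'm \<Rightarrow> bool" where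
  "realises_morphism C Z A x B y Z' A' x' B' y' a b c \<longleftrightarrow>
     b \<in> Mor C B B' \<and>
     Comp C A B B' b x = Comp C A A' B' x' a \<and>
     Comp C B B' Z' y' b = Comp C B Z Z' c y"

locale additive_realisation = biadditive_functor C E
  for C :: "('o, 'm) category_data" and E :: "('o, 'm, 'e) bifunctor_data" +
  fixes \<ss> :: "('o, 'm, 'e) correspondence"
  assumes realisation_class: "\<lbrakk>Z \<in> Ob C; A \<in> Ob C; \<delta> \<in> Ext E Z A\<rbrakk>
      \<Longrightarrow> \<ss> Z A \<delta> \<in> seqs C A Z // seq_equiv C A Z"
    and realisation_morphism: "\<lbrakk>Z \<in> Ob C; A \<in> Ob C; Z' \<in> Ob C; A' \<in> Ob C;
        \<delta> \<in> Ext E Z A; \<delta>' \<in> Ext E Z' A';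
        realises C \<ss> Z A \<delta> x B y; realises C \<ss> Z' A' \<delta>' x' B' y';
        ext_morphism C E Z A \<delta> Z' A' \<delta>' a c\<rbrakk>
      \<Longrightarrow> \<exists>b. realises_morphism C Z A x B y Z' A' x' B' y' a b c"
    and realisation_zero: "\<lbrakk>Z \<in> Ob C; A \<in> Ob C\<rbrakk>
      \<Longrightarrow> \<ss> Z A \<one>\<^bsub>EGrp E Z A\<^esub> = seq_class C A Z (In1 C A Z) (DSum C A Z) (Pr2 C A Z)"
    and realisation_sum: "\<lbrakk>Z \<in> Ob C; A \<in> Ob C; Z' \<in> Ob C; A' \<in> Ob C;
        \<delta> \<in> Ext E Z A; \<delta>' \<in> Ext E Z' A';
        realises C \<ss> Z A \<delta> x B y; realises C \<ss> Z' A' \<delta>' x' B' y'\<rbrakk>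
      \<Longrightarrow> \<ss> (DSum C Z Z') (DSum C A A') (ext_sum C E Z A \<delta> Z' A' \<delta>')
        = seq_class C (DSum C A A') (DSum C Z Z')
            (mor_sum C A A' B B' x x') (DSum C B B') (mor_sum C B B' Z Z' y y')"


section \<open>Extriangulated categories and functors\<close>

locale extriangulated_category = additive_realisation C E \<ss>
  for C :: "('o, 'm) category_data" and E :: "('o, 'm, 'e) bifunctor_data"
    and \<ss> :: "('o, 'm, 'e) correspondence" +
  assumes ET3: "\<lbrakk>Z \<in> Ob C; A \<in> Ob C; Z' \<in> Ob C; A' \<in> Ob C;
        \<delta> \<in> Ext E Z A; \<delta>' \<in> Ext E Z' A';
        realises C \<ss> Z A \<delta> x B y; realises C \<ss> Z' A' \<delta>' x' B' y';
        a \<in> Mor C A A'; b \<in> Mor C B B'; Comp C A B B' b x = Comp C A A' B' x' a\<rbrakk>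
      \<Longrightarrow> \<exists>c. ext_morphism C E Z A \<delta> Z' A' \<delta>' a c \<and>
            realises_morphism C Z A x B y Z' A' x' B' y' a b c"
    and ET3_op: "\<lbrakk>Z \<in> Ob C; A \<in> Ob C; Z' \<in> Ob C; A' \<in> Ob C;
        \<delta> \<in> Ext E Z A; \<delta>' \<in> Ext E Z' A';
        realises C \<ss> Z A \<delta> x B y; realises C \<ss> Z' A' \<delta>' x' B' y';
        b \<in> Mor C B B'; c \<in> Mor C Z Z'; Comp C B Z Z' c y = Comp C B B' Z' y' b\<rbrakk>
      \<Longrightarrow> \<exists>a. ext_morphism C E Z A \<delta> Z' A' \<delta>' a c \<and>
            realises_morphism C Z A x B y Z' A' x' B' y' a b c"
    and ET4: "\<lbrakk>A \<in> Ob C; B \<in> Ob C; D \<in> Ob C; F \<in> Ob C;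
        \<delta> \<in> Ext E D A; \<delta>' \<in> Ext E F B;
        realises C \<ss> D A \<delta> f B f'; realises C \<ss> F B \<delta>' g X g'\<rbrakk>
      \<Longrightarrow> \<exists>Y h h' d e \<delta>''.
            Y \<in> Ob C \<and> h \<in> Mor C A X \<and> h' \<in> Mor C X Y \<and> d \<in> Mor C D Y \<and> e \<in> Mor C Y F \<and>
            h = Comp C A B X g f \<and>
            Comp C B X Y h' g = Comp C B D Y d f' \<and>
            Comp C X Y F e h' = g' \<and>
            \<delta>'' \<in> Ext E Y A \<and> realises C \<ss> Y A \<delta>'' h X h' \<and>
            realises C \<ss> F D (push C E F B D f' \<delta>') d Y e \<and>
            pull C E Y D A d \<delta>'' = \<delta> \<and>
            push C E Y A B f \<delta>'' = pull C E F Y B e \<delta>'"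
    and ET4_op: "\<lbrakk>B \<in> Ob C; D \<in> Ob C; F \<in> Ob C; X \<in> Ob C;
        \<delta> \<in> Ext E B D; \<delta>' \<in> Ext E X F;
        realises C \<ss> B D \<delta> f' A f; realises C \<ss> X F \<delta>' g' B g\<rbrakk>
      \<Longrightarrow> \<exists>Y d e h' h \<delta>''.
            Y \<in> Ob C \<and> d \<in> Mor C D Y \<and> e \<in> Mor C Y F \<and> h' \<in> Mor C Y A \<and> h \<in> Mor C A X \<and>
            h = Comp C A B X g f \<and>
            Comp C D Y A h' d = f' \<and>
            Comp C Y A B f h' = Comp C Y F B g' e \<and>
            \<delta>'' \<in> Ext E X Y \<and> realises C \<ss> X Y \<delta>'' h' A h \<and>
            realises C \<ss> F D (pull C E B F D g' \<delta>) d Y e \<and>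
            push C E X Y F e \<delta>'' = \<delta>' \<and>
            push C E B D Y d \<delta> = pull C E X B Y g \<delta>''"

text \<open>\<open>FM A B f\<close> is the image of \<open>f : A \<rightarrow> B\<close>; the index is needed since hom-sets may overlap.\<close>

locale additive_functor = source: additive_category C + target: additive_category C'
  for C :: "('o, 'm) category_data" and C' :: "('p, 'n) category_data" +
  fixes FO :: "'o \<Rightarrow> 'p" and FM :: "'o \<Rightarrow> 'o \<Rightarrow> 'm \<Rightarrow> 'n"
  assumes FO_ob: "A \<in> Ob C \<Longrightarrow> FO A \<in> Ob C'"
    and FM_hom: "\<lbrakk>A \<in> Ob C; B \<in> Ob C\<rbrakk> \<Longrightarrow> FM A B \<in> hom (Hom C A B) (Hom C' (FO A) (FO B))"
    and FM_Ident: "A \<in> Ob C \<Longrightarrow> FM A A (Ident C A) = Ident C' (FO A)"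
    and FM_Comp: "\<lbrakk>X \<in> Ob C; Y \<in> Ob C; Z \<in> Ob C; f \<in> Mor C X Y; g \<in> Mor C Y Z\<rbrakk>
      \<Longrightarrow> FM X Z (Comp C X Y Z g f) = Comp C' (FO X) (FO Y) (FO Z) (FM Y Z g) (FM X Y f)"

definition ext_natural_transformation ::
    "('o, 'm) category_data \<Rightarrow> ('o, 'm, 'e) bifunctor_data \<Rightarrow> ('p, 'n, 'f) bifunctor_data
      \<Rightarrow> ('o \<Rightarrow> 'p) \<Rightarrow> ('o \<Rightarrow> 'o \<Rightarrow> 'm \<Rightarrow> 'n) \<Rightarrow> ('o \<Rightarrow> 'o \<Rightarrow> 'e \<Rightarrow> 'f) \<Rightarrow> bool" where
  "ext_natural_transformation C E E' FO FM \<Gamma> \<longleftrightarrow>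
     (\<forall>Z\<in>Ob C. \<forall>A\<in>Ob C. \<Gamma> Z A \<in> hom (EGrp E Z A) (EGrp E' (FO Z) (FO A))) \<and>
     (\<forall>Z\<in>Ob C. \<forall>A\<in>Ob C. \<forall>Z'\<in>Ob C. \<forall>A'\<in>Ob C.
        \<forall>c\<in>Mor C Z' Z. \<forall>a\<in>Mor C A A'. \<forall>\<delta>\<in>Ext E Z A.
          \<Gamma> Z' A' (EMap E Z A Z' A' c a \<delta>)
          = EMap E' (FO Z) (FO A) (FO Z') (FO A') (FM Z' Z c) (FM A A' a) (\<Gamma> Z A \<delta>))"

locale extriangulated_functor =
  source: extriangulated_category C E \<ss> + target: extriangulated_category C' E' \<ss>' +
  additive_functor C C' FO FM
  for C :: "('o, 'm) category_data" and E :: "('o, 'm, 'e) bifunctor_data"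
    and \<ss> :: "('o, 'm, 'e) correspondence"
    and C' :: "('p, 'n) category_data" and E' :: "('p, 'n, 'f) bifunctor_data"
    and \<ss>' :: "('p, 'n, 'f) correspondence"
    and FO :: "'o \<Rightarrow> 'p" and FM :: "'o \<Rightarrow> 'o \<Rightarrow> 'm \<Rightarrow> 'n" +
  assumes exact: "\<exists>\<Gamma>. ext_natural_transformation C E E' FO FM \<Gamma> \<and>
    (\<forall>Z\<in>Ob C. \<forall>X\<in>Ob C. \<forall>\<delta>\<in>Ext E Z X. \<forall>x Y y.
       realises C \<ss> Z X \<delta> x Y y \<longrightarrow>
       realises C' \<ss>' (FO Z) (FO X) (\<Gamma> Z X \<delta>) (FM X Y x) (FO Y) (FM Y Z y))"

end

theory Submission
  imports Defs
begin

text \<open>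
  An extension of \<open>(Z, r)\<close> by \<open>(A, p)\<close> is an extension \<open>\<delta> \<in> E(Z, A)\<close> with \<open>p\<^sub>* \<delta> = \<delta> = r\<^sup>* \<delta>\<close>, and
  its realisations are the retracts of a realisation \<open>A \<rightarrow> B \<rightarrow> Z\<close> of \<open>\<delta>\<close>. Since \<open>1 - p\<close> and \<open>1 - r\<close>
  annihilate \<open>\<delta>\<close>, they factor through \<open>A \<rightarrow> B\<close> and \<open>B \<rightarrow> Z\<close>; the resulting split summand has as its
  complement an idempotent of \<open>B\<close> that restricts to \<open>p\<close> and induces \<open>r\<close>. Two retracts of
  realisations of \<open>\<delta>\<close> are isomorphic because an endomorphism \<open>1 + w\<close> of \<open>B\<close> over the identities of the
  ends satisfies \<open>w\<^sup>2 = 0\<close>.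

  The delicate axiom is (ET4). In an octahedron of \<open>C\<close> over compatible idempotents, the new vertex
  carries one idempotent compatible with the extension \<open>\<delta>''\<close> and another one compatible with the pushout
  of \<open>\<delta>'\<close>. They can be chosen with the same image up to isomorphism, so that the retracts cut out by them
  fit into one octahedron. All axioms but (ET4) and its dual are transferred along retracts, and the
  dual statements follow by passing to the opposite category.
\<close>

section \<open>Additive categories\<close>

text \<open>The obstacle is the middle term. The realisation axiom lifts \<open>(p, r)\<close> to an
  endomorphism of \<open>B\<close>, but this lift need not be idempotent. The complement is
  therefore built directly as \<open>x l + \<kappa> y\<close> with \<open>l x = 1 - p\<close>,
  \<open>y \<kappa> = 1 - r\<close> and \<open>l \<kappa> = 0\<close>; idempotency is then forced by
  \<open>y x = 0\<close>. In (ET4) the demands on the new vertex pull apart. A retraction of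
  \<open>u\<close> that fits \<open>h'\<close> is induced from the middle term \<open>X\<close> and
  satisfies \<open>\<rho> u = 1\<close> only on the image of \<open>1 - d\<close>. A retraction
  whose composite with \<open>u\<close> is \<open>1 - d\<close> comes from the pushout of
  \<open>\<delta>'\<close>, and nothing relates it to \<open>h'\<close>. The resulting idempotents
  satisfy \<open>c t = c\<close> and \<open>t c = t\<close>, which makes \<open>c\<close> and
  \<open>t\<close> mutually inverse between \<open>(Y, t)\<close> and \<open>(Y, c)\<close>. The
  completed octahedron has the vertex \<open>(Y, c)\<close>, and \<open>t\<close> enters as the
  inclusion that exhibits the pushout sequence as a retract.\<close>

context category
begin

text \<open>Composites are normalised to right-associated form, where the left-hand side
  \<open>g f\<close> of an equation no longer occurs once something is precomposed.
  \<open>[THEN Comp_extend]\<close> supplies the form that the simplifier can still match.\<close>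

lemma Comp_extend:
  assumes "Comp C X Y Z g f = k"
    and "W \<in> Ob C" "X \<in> Ob C" "Y \<in> Ob C" "Z \<in> Ob C"
    and "w \<in> Mor C W X" "f \<in> Mor C X Y" "g \<in> Mor C Y Z"
  shows "Comp C W Y Z g (Comp C W X Y f w) = Comp C W X Z k w"
  using assms Comp_assoc by metis

lemmas cat_simps = Ident_mor Comp_mor Comp_Ident_right Comp_Ident_left Comp_assoc

end

section \<open>Hom groups, bilinear composition and complementary idempotents\<close>

context additive_category
begin

lemma add_closed:
  "\<lbrakk>A \<in> Ob C; B \<in> Ob C; f \<in> Mor C A B; g \<in> Mor C A B\<rbrakk> \<Longrightarrow> f \<otimes>\<^bsub>Hom C A B\<^esub> g \<in> Mor C A B"
  by (meson Hom_group comm_group.axioms(2) group.is_monoid monoid.m_closed)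

lemma add_assoc:
  "\<lbrakk>A \<in> Ob C; B \<in> Ob C; f \<in> Mor C A B; g \<in> Mor C A B; h \<in> Mor C A B\<rbrakk>
    \<Longrightarrow> (f \<otimes>\<^bsub>Hom C A B\<^esub> g) \<otimes>\<^bsub>Hom C A B\<^esub> h = f \<otimes>\<^bsub>Hom C A B\<^esub> (g \<otimes>\<^bsub>Hom C A B\<^esub> h)"
  by (meson Hom_group comm_group.axioms(2) group.is_monoid monoid.m_assoc)

lemma add_comm:
  "\<lbrakk>A \<in> Ob C; B \<in> Ob C; f \<in> Mor C A B; g \<in> Mor C A B\<rbrakk>
    \<Longrightarrow> f \<otimes>\<^bsub>Hom C A B\<^esub> g = g \<otimes>\<^bsub>Hom C A B\<^esub> f"
  by (meson Hom_group comm_group.axioms(1) comm_monoid.m_comm)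

lemma add_lcomm:
  "\<lbrakk>A \<in> Ob C; B \<in> Ob C; f \<in> Mor C A B; g \<in> Mor C A B; h \<in> Mor C A B\<rbrakk>
    \<Longrightarrow> f \<otimes>\<^bsub>Hom C A B\<^esub> (g \<otimes>\<^bsub>Hom C A B\<^esub> h) = g \<otimes>\<^bsub>Hom C A B\<^esub> (f \<otimes>\<^bsub>Hom C A B\<^esub> h)"
  by (meson Hom_group comm_group.axioms(1) comm_monoid.m_lcomm)

lemma zero_closed: "\<lbrakk>A \<in> Ob C; B \<in> Ob C\<rbrakk> \<Longrightarrow> \<one>\<^bsub>Hom C A B\<^esub> \<in> Mor C A B"
  by (meson Hom_group comm_group.axioms(2) group.is_monoid monoid.one_closed)

lemma zero_left: "\<lbrakk>A \<in> Ob C; B \<in> Ob C; f \<in> Mor C A B\<rbrakk> \<Longrightarrow> \<one>\<^bsub>Hom C A B\<^esub> \<otimes>\<^bsub>Hom C A B\<^esub> f = f"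
  by (meson Hom_group comm_group.axioms(2) group.is_monoid monoid.l_one)

lemma zero_right: "\<lbrakk>A \<in> Ob C; B \<in> Ob C; f \<in> Mor C A B\<rbrakk> \<Longrightarrow> f \<otimes>\<^bsub>Hom C A B\<^esub> \<one>\<^bsub>Hom C A B\<^esub> = f"
  by (meson Hom_group comm_group.axioms(2) group.is_monoid monoid.r_one)

lemma neg_closed: "\<lbrakk>A \<in> Ob C; B \<in> Ob C; f \<in> Mor C A B\<rbrakk> \<Longrightarrow> inv\<^bsub>Hom C A B\<^esub> f \<in> Mor C A B"
  by (meson Hom_group comm_group.axioms(2) group.inv_closed)

lemma add_neg: "\<lbrakk>A \<in> Ob C; B \<in> Ob C; f \<in> Mor C A B\<rbrakk>
    \<Longrightarrow> f \<otimes>\<^bsub>Hom C A B\<^esub> inv\<^bsub>Hom C A B\<^esub> f = \<one>\<^bsub>Hom C A B\<^esub>"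
  by (meson Hom_group comm_group.axioms(2) group.r_inv)

lemma neg_zero: "\<lbrakk>A \<in> Ob C; B \<in> Ob C\<rbrakk> \<Longrightarrow> inv\<^bsub>Hom C A B\<^esub> \<one>\<^bsub>Hom C A B\<^esub> = \<one>\<^bsub>Hom C A B\<^esub>"
  by (meson Hom_group comm_group.axioms(2) group.is_monoid monoid.inv_one)

lemma add_cancel_left: "\<lbrakk>f \<otimes>\<^bsub>Hom C A B\<^esub> g = f \<otimes>\<^bsub>Hom C A B\<^esub> h;
    A \<in> Ob C; B \<in> Ob C; f \<in> Mor C A B; g \<in> Mor C A B; h \<in> Mor C A B\<rbrakk> \<Longrightarrow> g = h"
  by (metis Hom_group comm_group.axioms(2) group.right_cancel add_comm)

lemma add_eq_self: "\<lbrakk>f \<otimes>\<^bsub>Hom C A B\<^esub> g = f;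
    A \<in> Ob C; B \<in> Ob C; f \<in> Mor C A B; g \<in> Mor C A B\<rbrakk> \<Longrightarrow> g = \<one>\<^bsub>Hom C A B\<^esub>"
  by (rule add_cancel_left[where f = f]) (auto simp: zero_right zero_closed)

lemma Comp_zero_left:
  assumes "X \<in> Ob C" "Y \<in> Ob C" "Z \<in> Ob C" "f \<in> Mor C X Y"
  shows "Comp C X Y Z \<one>\<^bsub>Hom C Y Z\<^esub> f = \<one>\<^bsub>Hom C X Z\<^esub>"
  using assms Comp_add_left[of X Y Z f "\<one>\<^bsub>Hom C Y Z\<^esub>" "\<one>\<^bsub>Hom C Y Z\<^esub>"]
  by (intro add_eq_self[where f = "Comp C X Y Z \<one>\<^bsub>Hom C Y Z\<^esub> f"])
    (auto simp: zero_left zero_closed Comp_mor)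

lemma Comp_zero_right:
  assumes "X \<in> Ob C" "Y \<in> Ob C" "Z \<in> Ob C" "g \<in> Mor C Y Z"
  shows "Comp C X Y Z g \<one>\<^bsub>Hom C X Y\<^esub> = \<one>\<^bsub>Hom C X Z\<^esub>"
  using assms Comp_add_right[of X Y Z "\<one>\<^bsub>Hom C X Y\<^esub>" "\<one>\<^bsub>Hom C X Y\<^esub>" g]
  by (intro add_eq_self[where f = "Comp C X Y Z g \<one>\<^bsub>Hom C X Y\<^esub>"])
    (auto simp: zero_left zero_closed Comp_mor)

lemmas additive_simps = cat_simps add_closed zero_closed zero_left zero_right neg_closed
  Comp_add_left Comp_add_right Comp_zero_left Comp_zero_right

lemmas dsum_simps = DSum_ob In1_mor In2_mor Pr1_mor Pr2_mor Pr1_In1 Pr2_In2 Pr1_In2 Pr2_In1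
  Pr1_In1[THEN Comp_extend] Pr2_In2[THEN Comp_extend] Pr1_In2[THEN Comp_extend]
  Pr2_In1[THEN Comp_extend]

lemma Comp_neg_left:
  assumes [simp]: "X \<in> Ob C" "Y \<in> Ob C" "Z \<in> Ob C" "f \<in> Mor C X Y" "g \<in> Mor C Y Z"
  shows "Comp C X Y Z (inv\<^bsub>Hom C Y Z\<^esub> g) f = inv\<^bsub>Hom C X Z\<^esub> (Comp C X Y Z g f)"
proof (rule add_cancel_left[where f = "Comp C X Y Z g f"])
  have "Comp C X Y Z g f \<otimes>\<^bsub>Hom C X Z\<^esub> Comp C X Y Z (inv\<^bsub>Hom C Y Z\<^esub> g) f
      = Comp C X Y Z (g \<otimes>\<^bsub>Hom C Y Z\<^esub> inv\<^bsub>Hom C Y Z\<^esub> g) f"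
    by (simp add: additive_simps)
  then show "Comp C X Y Z g f \<otimes>\<^bsub>Hom C X Z\<^esub> Comp C X Y Z (inv\<^bsub>Hom C Y Z\<^esub> g) f
      = Comp C X Y Z g f \<otimes>\<^bsub>Hom C X Z\<^esub> inv\<^bsub>Hom C X Z\<^esub> (Comp C X Y Z g f)"
    by (simp add: additive_simps add_neg)
qed (simp_all add: additive_simps)

lemma Comp_neg_right:
  assumes [simp]: "X \<in> Ob C" "Y \<in> Ob C" "Z \<in> Ob C" "f \<in> Mor C X Y" "g \<in> Mor C Y Z"
  shows "Comp C X Y Z g (inv\<^bsub>Hom C X Y\<^esub> f) = inv\<^bsub>Hom C X Z\<^esub> (Comp C X Y Z g f)"
proof (rule add_cancel_left[where f = "Comp C X Y Z g f"])
  have "Comp C X Y Z g f \<otimes>\<^bsub>Hom C X Z\<^esub> Comp C X Y Z g (inv\<^bsub>Hom C X Y\<^esub> f)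
      = Comp C X Y Z g (f \<otimes>\<^bsub>Hom C X Y\<^esub> inv\<^bsub>Hom C X Y\<^esub> f)"
    by (simp add: additive_simps)
  then show "Comp C X Y Z g f \<otimes>\<^bsub>Hom C X Z\<^esub> Comp C X Y Z g (inv\<^bsub>Hom C X Y\<^esub> f)
      = Comp C X Y Z g f \<otimes>\<^bsub>Hom C X Z\<^esub> inv\<^bsub>Hom C X Z\<^esub> (Comp C X Y Z g f)"
    by (simp add: additive_simps add_neg)
qed (simp_all add: additive_simps)

lemma zero_object_mor:
  assumes "zero_object C N" "A \<in> Ob C"
  shows "f \<in> Mor C N A \<Longrightarrow> f = \<one>\<^bsub>Hom C N A\<^esub>" "f \<in> Mor C A N \<Longrightarrow> f = \<one>\<^bsub>Hom C A N\<^esub>"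
proof -
  have N: "N \<in> Ob C" using assms(1) by (simp add: zero_object_def)
  show "f \<in> Mor C N A \<Longrightarrow> f = \<one>\<^bsub>Hom C N A\<^esub>"
    using assms N zero_closed[of N A] unfolding zero_object_def by blast
  show "f \<in> Mor C A N \<Longrightarrow> f = \<one>\<^bsub>Hom C A N\<^esub>"
    using assms N zero_closed[of A N] unfolding zero_object_def by blast
qed

text \<open>The complement \<open>1 - e\<close> of an idempotent \<open>e\<close>, described without subtraction.\<close>

definition complement where
  "complement A e f \<longleftrightarrow> e \<in> Mor C A A \<and> f \<in> Mor C A A \<and>
     Comp C A A A e e = e \<and> Comp C A A A f f = f \<and>
     Comp C A A A e f = \<one>\<^bsub>Hom C A A\<^esub> \<and> Comp C A A A f e = \<one>\<^bsub>Hom C A A\<^esub> \<and>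
     e \<otimes>\<^bsub>Hom C A A\<^esub> f = Ident C A"

lemma complementD:
  assumes "complement A e f"
  shows "e \<in> Mor C A A" "f \<in> Mor C A A" "Comp C A A A e e = e" "Comp C A A A f f = f"
    "Comp C A A A e f = \<one>\<^bsub>Hom C A A\<^esub>" "Comp C A A A f e = \<one>\<^bsub>Hom C A A\<^esub>"
    "e \<otimes>\<^bsub>Hom C A A\<^esub> f = Ident C A"
  using assms by (auto simp: complement_def)

lemma complement_exists:
  assumes [simp]: "A \<in> Ob C" "e \<in> Mor C A A" and idem: "Comp C A A A e e = e"
  obtains f where "complement A e f"
proof -
  define f where "f = Ident C A \<otimes>\<^bsub>Hom C A A\<^esub> inv\<^bsub>Hom C A A\<^esub> e"
  have f [simp]: "f \<in> Mor C A A" by (simp add: f_def additive_simps)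
  have ef: "Comp C A A A e f = \<one>\<^bsub>Hom C A A\<^esub>" "Comp C A A A f e = \<one>\<^bsub>Hom C A A\<^esub>"
    by (simp_all add: f_def additive_simps Comp_neg_left Comp_neg_right add_neg idem)
  have sum: "e \<otimes>\<^bsub>Hom C A A\<^esub> f = Ident C A"
    by (simp add: f_def additive_simps add_lcomm[of A A e "Ident C A"] add_neg)
  have "Comp C A A A f f = Comp C A A A (e \<otimes>\<^bsub>Hom C A A\<^esub> f) f"
    by (simp add: additive_simps ef)
  also have "\<dots> = f" by (simp add: sum additive_simps)
  finally show ?thesis using that[of f] ef sum idem by (auto simp: complement_def)
qed

lemma complement_swap: "\<lbrakk>A \<in> Ob C; complement A e f\<rbrakk> \<Longrightarrow> complement A f e"
  by (auto simp: complement_def add_comm)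

text \<open>Since \<open>e + e'\<close> and \<open>q + q'\<close> are identities, both sides
  complete the same summand \<open>q x = x e\<close> to \<open>x\<close>.\<close>

lemma complement_commute:
  assumes e: "complement A e e'" and q: "complement B q q'" and [simp]: "A \<in> Ob C" "B \<in> Ob C" "x \<in> Mor C A B"
    and eq: "Comp C A B B q x = Comp C A A B x e"
  shows "Comp C A B B q' x = Comp C A A B x e'"
proof (rule add_cancel_left[where f = "Comp C A B B q x"])
  note [simp] = complementD(1,2)[OF e] complementD(1,2)[OF q]
  have "Comp C A B B q x \<otimes>\<^bsub>Hom C A B\<^esub> Comp C A B B q' x = Comp C A B B (q \<otimes>\<^bsub>Hom C B B\<^esub> q') x"
    by (simp add: additive_simps)
  also have "\<dots> = Comp C A A B x (e \<otimes>\<^bsub>Hom C A A\<^esub> e')"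
    by (simp add: complementD(7)[OF e] complementD(7)[OF q] additive_simps)
  finally show "Comp C A B B q x \<otimes>\<^bsub>Hom C A B\<^esub> Comp C A B B q' x
      = Comp C A B B q x \<otimes>\<^bsub>Hom C A B\<^esub> Comp C A A B x e'"
    by (simp add: additive_simps eq)
qed (use complementD[OF e] complementD[OF q] in \<open>simp_all add: additive_simps\<close>)

text \<open>Together with \<open>complement_fix_right\<close> this passes from a relation
  \<open>c' t' = t'\<close> between complements to \<open>c t = c\<close>: first
  \<open>c t' = 0\<close> because \<open>c c' = 0\<close>, then
  \<open>c = c (t + t') = c t\<close>.\<close>

lemma complement_absorb_left:
  assumes e: "complement A e e'" and [simp]: "A \<in> Ob C" "X \<in> Ob C" "x \<in> Mor C X A"
    and eq: "Comp C X A A e' x = x"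
  shows "Comp C X A A e x = \<one>\<^bsub>Hom C X A\<^esub>"
proof -
  note [simp] = complementD[OF e]
  have "Comp C X A A e (Comp C X A A e' x) = \<one>\<^bsub>Hom C X A\<^esub>"
    by (simp add: additive_simps complementD(5)[OF e, THEN Comp_extend])
  then show ?thesis by (simp add: eq)
qed

lemma complement_fix_right:
  assumes e: "complement A e e'" and [simp]: "A \<in> Ob C" "X \<in> Ob C" "x \<in> Mor C A X"
    and eq: "Comp C A A X x e' = \<one>\<^bsub>Hom C A X\<^esub>"
  shows "Comp C A A X x e = x"
proof -
  note [simp] = complementD(1,2)[OF e]
  have "Comp C A A X x (e \<otimes>\<^bsub>Hom C A A\<^esub> e') = Comp C A A X x e"
    by (simp add: additive_simps eq)
  then show ?thesis by (simp add: additive_simps complementD(7)[OF e])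
qed

end

section \<open>Biadditive functors\<close>

context biadditive_functor
begin

lemma ext_zero_closed: "\<lbrakk>Z \<in> Ob C; A \<in> Ob C\<rbrakk> \<Longrightarrow> \<one>\<^bsub>EGrp E Z A\<^esub> \<in> Ext E Z A"
  by (meson EGrp_group comm_group.axioms(2) group.is_monoid monoid.one_closed)

lemma ext_add_closed: "\<lbrakk>Z \<in> Ob C; A \<in> Ob C; \<delta> \<in> Ext E Z A; \<eta> \<in> Ext E Z A\<rbrakk>
    \<Longrightarrow> \<delta> \<otimes>\<^bsub>EGrp E Z A\<^esub> \<eta> \<in> Ext E Z A"
  by (meson EGrp_group comm_group.axioms(2) group.is_monoid monoid.m_closed)

lemma ext_zero_left: "\<lbrakk>Z \<in> Ob C; A \<in> Ob C; \<delta> \<in> Ext E Z A\<rbrakk>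
    \<Longrightarrow> \<one>\<^bsub>EGrp E Z A\<^esub> \<otimes>\<^bsub>EGrp E Z A\<^esub> \<delta> = \<delta>"
  by (meson EGrp_group comm_group.axioms(2) group.is_monoid monoid.l_one)

lemma ext_zero_right: "\<lbrakk>Z \<in> Ob C; A \<in> Ob C; \<delta> \<in> Ext E Z A\<rbrakk>
    \<Longrightarrow> \<delta> \<otimes>\<^bsub>EGrp E Z A\<^esub> \<one>\<^bsub>EGrp E Z A\<^esub> = \<delta>"
  by (meson EGrp_group comm_group.axioms(2) group.is_monoid monoid.r_one)

lemma ext_add_eq_self: "\<lbrakk>\<delta> \<otimes>\<^bsub>EGrp E Z A\<^esub> \<eta> = \<delta>; Z \<in> Ob C; A \<in> Ob C; \<delta> \<in> Ext E Z A;
    \<eta> \<in> Ext E Z A\<rbrakk> \<Longrightarrow> \<eta> = \<one>\<^bsub>EGrp E Z A\<^esub>"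
  by (metis EGrp_group comm_group.axioms(2) group.l_cancel_one)

context
  fixes Z Z' A A'
  assumes ob: "Z \<in> Ob C" "Z' \<in> Ob C" "A \<in> Ob C" "A' \<in> Ob C"
begin

lemma EMap_group_hom:
  "\<lbrakk>c \<in> Mor C Z' Z; a \<in> Mor C A A'\<rbrakk>
    \<Longrightarrow> group_hom (EGrp E Z A) (EGrp E Z' A') (EMap E Z A Z' A' c a)"
  using EMap_hom[OF ob] EGrp_group ob
  by (simp add: group_hom_def group_hom_axioms_def comm_group.axioms(2))

lemma EMap_closed: "\<lbrakk>c \<in> Mor C Z' Z; a \<in> Mor C A A'; \<delta> \<in> Ext E Z A\<rbrakk>
    \<Longrightarrow> EMap E Z A Z' A' c a \<delta> \<in> Ext E Z' A'"
  using EMap_hom[OF ob] by (auto simp: hom_def)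

lemma EMap_add: "\<lbrakk>c \<in> Mor C Z' Z; a \<in> Mor C A A'; \<delta> \<in> Ext E Z A; \<eta> \<in> Ext E Z A\<rbrakk>
    \<Longrightarrow> EMap E Z A Z' A' c a (\<delta> \<otimes>\<^bsub>EGrp E Z A\<^esub> \<eta>)
      = EMap E Z A Z' A' c a \<delta> \<otimes>\<^bsub>EGrp E Z' A'\<^esub> EMap E Z A Z' A' c a \<eta>"
  using EMap_hom[OF ob] by (auto simp: hom_def)

lemma EMap_zero: "\<lbrakk>c \<in> Mor C Z' Z; a \<in> Mor C A A'\<rbrakk>
    \<Longrightarrow> EMap E Z A Z' A' c a \<one>\<^bsub>EGrp E Z A\<^esub> = \<one>\<^bsub>EGrp E Z' A'\<^esub>"
  using EMap_group_hom group_hom.hom_one by blast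

text \<open>Additivity in the morphism arguments is postulated only for \<open>push\<close> and
  \<open>pull\<close>; this factorisation carries it over to \<open>EMap\<close>.\<close>

lemma EMap_push_pull: "\<lbrakk>c \<in> Mor C Z' Z; a \<in> Mor C A A'; \<delta> \<in> Ext E Z A\<rbrakk>
    \<Longrightarrow> EMap E Z A Z' A' c a \<delta> = push C E Z' A A' a (pull C E Z Z' A c \<delta>)"
  using EMap_Comp[of Z Z' Z' A A A' c "Ident C Z'" "Ident C A" a] ob
  by (simp add: push_def pull_def cat_simps)

lemma pull_push: "\<lbrakk>c \<in> Mor C Z' Z; a \<in> Mor C A A'; \<delta> \<in> Ext E Z A\<rbrakk>
    \<Longrightarrow> pull C E Z Z' A' c (push C E Z A A' a \<delta>) = push C E Z' A A' a (pull C E Z Z' A c \<delta>)"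
  using EMap_Comp[of Z Z Z' A A' A' "Ident C Z" c a "Ident C A'"] ob EMap_push_pull
  by (simp add: push_def pull_def cat_simps)

end

context
  fixes Z A
  assumes ob: "Z \<in> Ob C" "A \<in> Ob C"
begin

lemma push_closed: "\<lbrakk>A' \<in> Ob C; a \<in> Mor C A A'; \<delta> \<in> Ext E Z A\<rbrakk> \<Longrightarrow> push C E Z A A' a \<delta> \<in> Ext E Z A'"
  using ob by (simp add: push_def EMap_closed Ident_mor)

lemma pull_closed: "\<lbrakk>Z' \<in> Ob C; c \<in> Mor C Z' Z; \<delta> \<in> Ext E Z A\<rbrakk> \<Longrightarrow> pull C E Z Z' A c \<delta> \<in> Ext E Z' A"
  using ob by (simp add: pull_def EMap_closed Ident_mor)

lemma push_Ident: "\<delta> \<in> Ext E Z A \<Longrightarrow> push C E Z A A (Ident C A) \<delta> = \<delta>"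
  using ob by (simp add: push_def EMap_Ident)

lemma pull_Ident: "\<delta> \<in> Ext E Z A \<Longrightarrow> pull C E Z Z A (Ident C Z) \<delta> = \<delta>"
  using ob by (simp add: pull_def EMap_Ident)

lemma push_Comp:
  "\<lbrakk>A' \<in> Ob C; A'' \<in> Ob C; a \<in> Mor C A A'; a' \<in> Mor C A' A''; \<delta> \<in> Ext E Z A\<rbrakk>
    \<Longrightarrow> push C E Z A A'' (Comp C A A' A'' a' a) \<delta> = push C E Z A' A'' a' (push C E Z A A' a \<delta>)"
  using EMap_Comp[of Z Z Z A A' A'' "Ident C Z" "Ident C Z" a a'] ob
  by (simp add: push_def cat_simps)

lemma pull_Comp:
  "\<lbrakk>Z' \<in> Ob C; Z'' \<in> Ob C; c \<in> Mor C Z' Z; c' \<in> Mor C Z'' Z'; \<delta> \<in> Ext E Z A\<rbrakk>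
    \<Longrightarrow> pull C E Z Z'' A (Comp C Z'' Z' Z c c') \<delta> = pull C E Z' Z'' A c' (pull C E Z Z' A c \<delta>)"
  using EMap_Comp[of Z Z' Z'' A A A c c' "Ident C A" "Ident C A"] ob
  by (simp add: pull_def cat_simps)

lemma push_zero_ext: "\<lbrakk>A' \<in> Ob C; a \<in> Mor C A A'\<rbrakk>
    \<Longrightarrow> push C E Z A A' a \<one>\<^bsub>EGrp E Z A\<^esub> = \<one>\<^bsub>EGrp E Z A'\<^esub>"
  using ob by (simp add: push_def EMap_zero Ident_mor)

lemma pull_zero_ext: "\<lbrakk>Z' \<in> Ob C; c \<in> Mor C Z' Z\<rbrakk>
    \<Longrightarrow> pull C E Z Z' A c \<one>\<^bsub>EGrp E Z A\<^esub> = \<one>\<^bsub>EGrp E Z' A\<^esub>"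
  using ob by (simp add: pull_def EMap_zero Ident_mor)

lemma push_zero_mor: "\<lbrakk>A' \<in> Ob C; \<delta> \<in> Ext E Z A\<rbrakk>
    \<Longrightarrow> push C E Z A A' \<one>\<^bsub>Hom C A A'\<^esub> \<delta> = \<one>\<^bsub>EGrp E Z A'\<^esub>"
  using ob push_add[of Z A A' "\<one>\<^bsub>Hom C A A'\<^esub>" "\<one>\<^bsub>Hom C A A'\<^esub>" \<delta>]
  by (intro ext_add_eq_self[where \<delta> = "push C E Z A A' \<one>\<^bsub>Hom C A A'\<^esub> \<delta>"])
    (simp_all add: zero_closed zero_left push_closed)

lemma pull_zero_mor: "\<lbrakk>Z' \<in> Ob C; \<delta> \<in> Ext E Z A\<rbrakk>
    \<Longrightarrow> pull C E Z Z' A \<one>\<^bsub>Hom C Z' Z\<^esub> \<delta> = \<one>\<^bsub>EGrp E Z' A\<^esub>"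
  using ob pull_add[of Z Z' A "\<one>\<^bsub>Hom C Z' Z\<^esub>" "\<one>\<^bsub>Hom C Z' Z\<^esub>" \<delta>]
  by (intro ext_add_eq_self[where \<delta> = "pull C E Z Z' A \<one>\<^bsub>Hom C Z' Z\<^esub> \<delta>"])
    (simp_all add: zero_closed zero_left pull_closed)

text \<open>Invariance under \<open>p\<close> is traded for vanishing under \<open>p'\<close>,
  because the exactness properties factor those morphisms that annihilate an extension.\<close>

lemma push_complement:
  assumes "complement A p p'" "\<delta> \<in> Ext E Z A"
  shows "push C E Z A A p \<delta> = \<delta> \<longleftrightarrow> push C E Z A A p' \<delta> = \<one>\<^bsub>EGrp E Z A\<^esub>"
proof -
  note [simp] = complementD(1,2)[OF assms(1)]
  have "push C E Z A A p \<delta> \<otimes>\<^bsub>EGrp E Z A\<^esub> push C E Z A A p' \<delta>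
      = push C E Z A A (p \<otimes>\<^bsub>Hom C A A\<^esub> p') \<delta>"
    using ob assms by (simp add: push_add)
  also have "\<dots> = \<delta>" using ob assms by (simp add: complementD(7)[OF assms(1)] push_Ident)
  finally have *: "push C E Z A A p \<delta> \<otimes>\<^bsub>EGrp E Z A\<^esub> push C E Z A A p' \<delta> = \<delta>" .
  show ?thesis
  proof
    assume "push C E Z A A p \<delta> = \<delta>"
    with * have "\<delta> \<otimes>\<^bsub>EGrp E Z A\<^esub> push C E Z A A p' \<delta> = \<delta>" by simp
    then show "push C E Z A A p' \<delta> = \<one>\<^bsub>EGrp E Z A\<^esub>"
      by (rule ext_add_eq_self) (use ob assms in \<open>simp_all add: push_closed\<close>)
  next
    assume "push C E Z A A p' \<delta> = \<one>\<^bsub>EGrp E Z A\<^esub>"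
    with * show "push C E Z A A p \<delta> = \<delta>"
      using ob assms by (simp add: ext_zero_right push_closed)
  qed
qed

lemma pull_complement:
  assumes "complement Z p p'" "\<delta> \<in> Ext E Z A"
  shows "pull C E Z Z A p \<delta> = \<delta> \<longleftrightarrow> pull C E Z Z A p' \<delta> = \<one>\<^bsub>EGrp E Z A\<^esub>"
proof -
  note [simp] = complementD(1,2)[OF assms(1)]
  have "pull C E Z Z A p \<delta> \<otimes>\<^bsub>EGrp E Z A\<^esub> pull C E Z Z A p' \<delta>
      = pull C E Z Z A (p \<otimes>\<^bsub>Hom C Z Z\<^esub> p') \<delta>"
    using ob assms by (simp add: pull_add)
  also have "\<dots> = \<delta>" using ob assms by (simp add: complementD(7)[OF assms(1)] pull_Ident)
  finally have *: "pull C E Z Z A p \<delta> \<otimes>\<^bsub>EGrp E Z A\<^esub> pull C E Z Z A p' \<delta> = \<delta>" .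
  show ?thesis
  proof
    assume "pull C E Z Z A p \<delta> = \<delta>"
    with * have "\<delta> \<otimes>\<^bsub>EGrp E Z A\<^esub> pull C E Z Z A p' \<delta> = \<delta>" by simp
    then show "pull C E Z Z A p' \<delta> = \<one>\<^bsub>EGrp E Z A\<^esub>"
      by (rule ext_add_eq_self) (use ob assms in \<open>simp_all add: pull_closed\<close>)
  next
    assume "pull C E Z Z A p' \<delta> = \<one>\<^bsub>EGrp E Z A\<^esub>"
    with * show "pull C E Z Z A p \<delta> = \<delta>"
      using ob assms by (simp add: ext_zero_right pull_closed)
  qed
qed

end

lemmas ext_simps = additive_simps push_closed pull_closed push_Ident pull_Ident push_Comp pull_Comp
  push_zero_ext pull_zero_ext push_zero_mor pull_zero_mor ext_zero_closed ext_zero_left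
  ext_zero_right ext_add_closed push_add pull_add pull_push

end

section \<open>Octahedra with idempotents\<close>

text \<open>
  Only one of the two dual octahedral axioms is assumed, so that the locale applies to an extriangulated
  category and to its opposite, with \<open>R\<close> in place of the classes \<open>\<ss> Z A \<delta>\<close>.
\<close>

locale octahedral_category = biadditive_functor C E
  for C :: "('o, 'm) category_data" and E :: "('o, 'm, 'e) bifunctor_data" +
  fixes R :: "'o \<Rightarrow> 'o \<Rightarrow> 'e \<Rightarrow> 'm \<Rightarrow> 'o \<Rightarrow> 'm \<Rightarrow> bool"
  assumes R_closed: "R Z A \<delta> x B y \<Longrightarrow>
      Z \<in> Ob C \<and> A \<in> Ob C \<and> \<delta> \<in> Ext E Z A \<and> B \<in> Ob C \<and> x \<in> Mor C A B \<and> y \<in> Mor C B Z"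
    and R_exists: "\<lbrakk>Z \<in> Ob C; A \<in> Ob C; \<delta> \<in> Ext E Z A\<rbrakk> \<Longrightarrow> \<exists>x B y. R Z A \<delta> x B y"
    and R_Comp: "R Z A \<delta> x B y \<Longrightarrow> Comp C A B Z y x = \<one>\<^bsub>Hom C A Z\<^esub>"
    and R_push: "R Z A \<delta> x B y \<Longrightarrow> push C E Z A B x \<delta> = \<one>\<^bsub>EGrp E Z B\<^esub>"
    and R_pull: "R Z A \<delta> x B y \<Longrightarrow> pull C E Z B A y \<delta> = \<one>\<^bsub>EGrp E B A\<^esub>"
    and R_weak_cokernel: "\<lbrakk>R Z A \<delta> x B y; W \<in> Ob C; w \<in> Mor C B W;
        Comp C A B W w x = \<one>\<^bsub>Hom C A W\<^esub>\<rbrakk> \<Longrightarrow> \<exists>z\<in>Mor C Z W. w = Comp C B Z W z y"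
    and R_weak_kernel: "\<lbrakk>R Z A \<delta> x B y; W \<in> Ob C; w \<in> Mor C W B;
        Comp C W B Z y w = \<one>\<^bsub>Hom C W Z\<^esub>\<rbrakk> \<Longrightarrow> \<exists>z\<in>Mor C W A. w = Comp C W A B x z"
    and R_push_zero: "\<lbrakk>R Z A \<delta> x B y; W \<in> Ob C; a \<in> Mor C A W;
        push C E Z A W a \<delta> = \<one>\<^bsub>EGrp E Z W\<^esub>\<rbrakk> \<Longrightarrow> \<exists>z\<in>Mor C B W. a = Comp C A B W z x"
    and R_pull_zero: "\<lbrakk>R Z A \<delta> x B y; W \<in> Ob C; c \<in> Mor C W Z;
        pull C E Z W A c \<delta> = \<one>\<^bsub>EGrp E W A\<^esub>\<rbrakk> \<Longrightarrow> \<exists>z\<in>Mor C W B. c = Comp C W B Z y z"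
    and R_morphism: "\<lbrakk>R Z A \<delta> x B y; R Z' A' \<delta>' x' B' y'; a \<in> Mor C A A'; c \<in> Mor C Z Z';
        push C E Z A A' a \<delta> = pull C E Z' Z A' c \<delta>'\<rbrakk>
      \<Longrightarrow> \<exists>b\<in>Mor C B B'. Comp C A B B' b x = Comp C A A' B' x' a \<and>
            Comp C B B' Z' y' b = Comp C B Z Z' c y"
    and R_ET3: "\<lbrakk>R Z A \<delta> x B y; R Z' A' \<delta>' x' B' y'; a \<in> Mor C A A'; b \<in> Mor C B B';
        Comp C A B B' b x = Comp C A A' B' x' a\<rbrakk>
      \<Longrightarrow> \<exists>c\<in>Mor C Z Z'. push C E Z A A' a \<delta> = pull C E Z' Z A' c \<delta>' \<and>
            Comp C B B' Z' y' b = Comp C B Z Z' c y"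
    and R_ET4: "\<lbrakk>R D A \<delta> f B f'; R F B \<delta>' g X g'\<rbrakk>
      \<Longrightarrow> \<exists>Y h' u v \<delta>''. Y \<in> Ob C \<and> h' \<in> Mor C X Y \<and> u \<in> Mor C D Y \<and> v \<in> Mor C Y F \<and>
            \<delta>'' \<in> Ext E Y A \<and>
            Comp C B X Y h' g = Comp C B D Y u f' \<and> Comp C X Y F v h' = g' \<and>
            R Y A \<delta>'' (Comp C A B X g f) X h' \<and> R F D (push C E F B D f' \<delta>') u Y v \<and>
            pull C E Y D A u \<delta>'' = \<delta> \<and> push C E Y A B f \<delta>'' = pull C E F Y B v \<delta>'"
begin

text \<open>
  If \<open>\<delta>\<close> is fixed by the idempotents \<open>1 - p'\<close> and \<open>1 - r'\<close> of its ends, then \<open>p'\<close> and \<open>r'\<close> split off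
  a trivial summand of the sequence, through a retraction \<open>l\<close> and a section \<open>\<kappa>\<close>.
\<close>

lemma retraction_exists:
  assumes R: "R Z A \<delta> x B y" and p: "p' \<in> Mor C A A" "Comp C A A A p' p' = p'"
    and zero: "push C E Z A A p' \<delta> = \<one>\<^bsub>EGrp E Z A\<^esub>"
    and \<kappa>: "\<kappa> \<in> Mor C Z B" "Comp C Z B Z y \<kappa> = r'" "Comp C Z Z B \<kappa> r' = \<kappa>" "r' \<in> Mor C Z Z"
  obtains l where "l \<in> Mor C B A" "Comp C A B A l x = p'" "Comp C B A A p' l = l"
    "Comp C Z B A l \<kappa> = \<one>\<^bsub>Hom C Z A\<^esub>"
proof -
  have [simp]: "Z \<in> Ob C" "A \<in> Ob C" "B \<in> Ob C" "x \<in> Mor C A B" "y \<in> Mor C B Z" "\<delta> \<in> Ext E Z A"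
    using R_closed[OF R] by auto
  note [simp] = p \<kappa>
  obtain m where m [simp]: "m \<in> Mor C B A" and mx: "p' = Comp C A B A m x"
    using R_push_zero[OF R _ _ zero] by auto
  \<comment> \<open>The factor \<open>m\<close> of \<open>p'\<close> through \<open>x\<close> is
    corrected by \<open>m \<kappa> y\<close>. This kills the composite with \<open>\<kappa>\<close>,
    as \<open>y \<kappa> = r'\<close> and \<open>\<kappa> r' = \<kappa>\<close>, and leaves the
    composite with \<open>x\<close> alone, as \<open>y x = 0\<close>. The outer \<open>p'\<close>
    gives \<open>p' l = l\<close>.\<close>
  define l where "l = Comp C B A A p' (m \<otimes>\<^bsub>Hom C B A\<^esub>
    inv\<^bsub>Hom C B A\<^esub> (Comp C B Z A (Comp C Z B A m \<kappa>) y))"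
  have mx': "Comp C A B A m x = p'" using mx by simp
  note eqs = additive_simps Comp_neg_left Comp_neg_right neg_zero add_neg mx' R_Comp[OF R] p \<kappa>
    p(2)[THEN Comp_extend] \<kappa>(2)[THEN Comp_extend]
  show ?thesis
  proof
    show "l \<in> Mor C B A" by (simp add: l_def eqs)
    show "Comp C A B A l x = p'" by (simp add: l_def eqs)
    show "Comp C B A A p' l = l" by (simp add: l_def eqs)
    show "Comp C Z B A l \<kappa> = \<one>\<^bsub>Hom C Z A\<^esub>" by (simp add: l_def eqs)
  qed
qed

lemma section_exists:
  assumes R: "R Z A \<delta> x B y" and r: "r' \<in> Mor C Z Z" "Comp C Z Z Z r' r' = r'"
    and zero: "pull C E Z Z A r' \<delta> = \<one>\<^bsub>EGrp E Z A\<^esub>"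
  obtains \<kappa> where "\<kappa> \<in> Mor C Z B" "Comp C Z B Z y \<kappa> = r'" "Comp C Z Z B \<kappa> r' = \<kappa>"
proof -
  have [simp]: "Z \<in> Ob C" "A \<in> Ob C" "B \<in> Ob C" "x \<in> Mor C A B" "y \<in> Mor C B Z" "\<delta> \<in> Ext E Z A"
    using R_closed[OF R] by auto
  obtain k where k: "k \<in> Mor C Z B" and yk: "Comp C Z B Z y k = r'"
    using R_pull_zero[OF R _ _ zero] r by auto
  show ?thesis
    by (rule that[of "Comp C Z Z B k r'"])
      (simp_all add: additive_simps k r yk yk[THEN Comp_extend])
qed

text \<open>By \<open>y x = 0\<close> and \<open>l \<kappa> = 0\<close> the summands
  \<open>x l\<close> and \<open>\<kappa> y\<close> are orthogonal, and \<open>l x l = l\<close>,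
  \<open>\<kappa> y \<kappa> = \<kappa>\<close> make each of them idempotent. The hypothesis is
  \<open>l x p' = p'\<close> rather than \<open>l x = p'\<close>, because for one of the retractions
  on the new vertex of the octahedron only the former is available.\<close>

lemma splitting_idempotent:
  assumes R: "R Z A \<delta> x B y" and p: "p' \<in> Mor C A A"
    and l: "l \<in> Mor C B A" "Comp C A A A (Comp C A B A l x) p' = p'" "Comp C B A A p' l = l"
    and \<kappa>: "\<kappa> \<in> Mor C Z B" "Comp C Z B Z y \<kappa> = r'" "Comp C Z Z B \<kappa> r' = \<kappa>" "r' \<in> Mor C Z Z"
    and l\<kappa>: "Comp C Z B A l \<kappa> = \<one>\<^bsub>Hom C Z A\<^esub>"
    and e': "e' = Comp C B A B x l \<otimes>\<^bsub>Hom C B B\<^esub> Comp C B Z B \<kappa> y"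
  shows "e' \<in> Mor C B B" "Comp C B B B e' e' = e'" "Comp C B B Z y e' = Comp C B Z Z r' y"
    and "Comp C A B A l x = p' \<Longrightarrow> Comp C A B B e' x = Comp C A A B x p'"
proof -
  have [simp]: "Z \<in> Ob C" "A \<in> Ob C" "B \<in> Ob C" "x \<in> Mor C A B" "y \<in> Mor C B Z" "\<delta> \<in> Ext E Z A"
    using R_closed[OF R] by auto
  note [simp] = p l(1) \<kappa>(1,4)
  have "Comp C B A A (Comp C A A A (Comp C A B A l x) p') l = l"
    using l by simp
  then have lxl: "Comp C B A A (Comp C A B A l x) l = l"
    using l(3) by (simp add: additive_simps)
  have \<kappa>y\<kappa>: "Comp C Z B B (Comp C B Z B \<kappa> y) \<kappa> = \<kappa>"
    using \<kappa> by (simp add: additive_simps)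
  note eqs = additive_simps R_Comp[OF R] R_Comp[OF R, THEN Comp_extend] \<kappa>(2) \<kappa>(2)[THEN Comp_extend] \<kappa>(3)
    \<kappa>(3)[THEN Comp_extend] l\<kappa> l\<kappa>[THEN Comp_extend] e'
  show "e' \<in> Mor C B B" by (simp add: eqs)
  show "Comp C B B B e' e' = e'"
    using lxl \<kappa>y\<kappa> by (simp add: eqs)
  show "Comp C B B Z y e' = Comp C B Z Z r' y" by (simp add: eqs)
  show "Comp C A B A l x = p' \<Longrightarrow> Comp C A B B e' x = Comp C A A B x p'" by (simp add: eqs)
qed

text \<open>The idempotent \<open>e'\<close> restricts to \<open>p'\<close> and induces
  \<open>r'\<close>, so its complement \<open>e\<close> restricts to \<open>p\<close> and induces
  \<open>r\<close>. The splitting data \<open>l\<close> and \<open>\<kappa>\<close> are returned as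
  well, since the octahedral argument transports them to the new vertex.\<close>

lemma idempotent_realisation:
  assumes ob: "Z \<in> Ob C" "A \<in> Ob C" and \<delta>: "\<delta> \<in> Ext E Z A"
    and p: "complement A p p'" "push C E Z A A p \<delta> = \<delta>"
    and r: "complement Z r r'" "pull C E Z Z A r \<delta> = \<delta>"
    and R: "R Z A \<delta> x B y"
  obtains e e' l \<kappa> where "complement B e e'"
    "l \<in> Mor C B A" "Comp C A B A l x = p'" "Comp C B A A p' l = l"
    "\<kappa> \<in> Mor C Z B" "Comp C Z B Z y \<kappa> = r'" "Comp C Z Z B \<kappa> r' = \<kappa>"
    "Comp C Z B A l \<kappa> = \<one>\<^bsub>Hom C Z A\<^esub>"
    "e' = Comp C B A B x l \<otimes>\<^bsub>Hom C B B\<^esub> Comp C B Z B \<kappa> y"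
    "Comp C A B B e x = Comp C A A B x p" "Comp C B B Z y e = Comp C B Z Z r y"
proof -
  note cl = R_closed[OF R]
  note P = complementD[OF p(1)] and Q = complementD[OF r(1)]
  have "push C E Z A A p' \<delta> = \<one>\<^bsub>EGrp E Z A\<^esub>" "pull C E Z Z A r' \<delta> = \<one>\<^bsub>EGrp E Z A\<^esub>"
    using push_complement pull_complement ob \<delta> p r by auto
  then obtain \<kappa> l where \<kappa>: "\<kappa> \<in> Mor C Z B" "Comp C Z B Z y \<kappa> = r'" "Comp C Z Z B \<kappa> r' = \<kappa>"
    and l: "l \<in> Mor C B A" "Comp C A B A l x = p'" "Comp C B A A p' l = l"
    and l\<kappa>: "Comp C Z B A l \<kappa> = \<one>\<^bsub>Hom C Z A\<^esub>"
    using section_exists[OF R Q(2,4)] retraction_exists[OF R P(2,4)] Q(2) by metis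
  define e' where "e' = Comp C B A B x l \<otimes>\<^bsub>Hom C B B\<^esub> Comp C B Z B \<kappa> y"
  have "Comp C A A A (Comp C A B A l x) p' = p'" using l P by simp
  note e' = splitting_idempotent[OF R P(2) l(1) this l(3) \<kappa> Q(2) l\<kappa> e'_def]
  obtain e where "complement B e' e" using complement_exists[of B e'] cl e' by auto
  then have e: "complement B e e'" using complement_swap cl by auto
  show ?thesis
  proof (rule that[OF e l \<kappa> l\<kappa> e'_def])
    show "Comp C A B B e x = Comp C A A B x p"
      by (rule complement_commute[OF complement_swap[OF _ p(1)] complement_swap[OF _ e]])
        (use cl e'(4)[OF l(2)] in auto)
    show "Comp C B B Z y e = Comp C B Z Z r y"
      by (rule complement_commute[OF complement_swap[OF _ e] complement_swap[OF _ r(1)], symmetric])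
        (use cl e'(3) in auto)
  qed
qed

text \<open>
  The octahedron of \<open>\<delta>\<close> and \<open>\<delta>'\<close> carries two idempotents of its new vertex: \<open>c\<close> is compatible with
  \<open>\<delta>''\<close>, and \<open>t\<close> with the pushout of \<open>\<delta>'\<close>. They have the same image up to isomorphism, because both
  complements are split by the same section \<open>\<kappa>\<close> and by retractions that agree on the image of \<open>u (1 - d)\<close>.
\<close>

lemma octahedron_idempotents:
  assumes R: "R D A \<delta> x B y" and F: "F \<in> Ob C" and \<delta>': "\<delta>' \<in> Ext E F B"
    and p: "p \<in> Mor C A A" "Comp C A A A p p = p" "push C E D A A p \<delta> = \<delta>"
    and d: "d \<in> Mor C D D" "Comp C D D D d d = d" "pull C E D D A d \<delta> = \<delta>"
    and e: "e \<in> Mor C B B" "Comp C B B B e e = e" "push C E F B B e \<delta>' = \<delta>'"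
    and s: "s \<in> Mor C F F" "Comp C F F F s s = s" "pull C E F F B s \<delta>' = \<delta>'"
    and ex: "Comp C A B B e x = Comp C A A B x p" and ye: "Comp C B B D y e = Comp C B D D d y"
  obtains X g g' r Y h' u v c t \<delta>'' where
    "R F B \<delta>' g X g'" "R Y A \<delta>'' (Comp C A B X g x) X h'" "R F D (push C E F B D y \<delta>') u Y v"
    "r \<in> Mor C X X" "Comp C X X X r r = r" "c \<in> Mor C Y Y" "Comp C Y Y Y c c = c"
    "t \<in> Mor C Y Y" "Comp C Y Y Y t t = t"
    "Comp C B X X r g = Comp C B B X g e" "Comp C X X F g' r = Comp C X F F s g'"
    "Comp C X Y Y c h' = Comp C X X Y h' r"
    "push C E Y A A p \<delta>'' = \<delta>''" "pull C E Y Y A c \<delta>'' = \<delta>''"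
    "Comp C B X Y h' g = Comp C B D Y u y" "Comp C X Y F v h' = g'"
    "pull C E Y D A u \<delta>'' = \<delta>" "push C E Y A B x \<delta>'' = pull C E F Y B v \<delta>'"
    "Comp C D Y Y t u = Comp C D D Y u d" "Comp C Y Y F v t = Comp C Y F F s v"
    "Comp C Y Y F v c = Comp C Y F F s v"
    "Comp C Y Y Y c t = c" "Comp C Y Y Y t c = t"
proof -
  have [simp]: "D \<in> Ob C" "A \<in> Ob C" "B \<in> Ob C" "x \<in> Mor C A B" "y \<in> Mor C B D" "\<delta> \<in> Ext E D A"
    using R_closed[OF R] by auto
  note [simp] = F \<delta>' p(1) d(1) e(1) s(1)
  obtain p' d' e' s' where p': "complement A p p'" and d': "complement D d d'"
    and e': "complement B e e'" and s': "complement F s s'"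
    using complement_exists p d e s F by (metis R R_closed)
  note P = complementD[OF p'] and Dc = complementD[OF d'] and Ec = complementD[OF e']
    and Sc = complementD[OF s']
  note [simp] = P(2) Dc(2) Ec(2) Sc(2)
  have e'x: "Comp C A B B e' x = Comp C A A B x p'"
    by (rule complement_commute[OF p' e']) (simp_all add: ex)
  have d'y: "Comp C B D D d' y = Comp C B B D y e'"
    by (rule complement_commute[OF e' d']) (simp_all add: ye)
  have yx: "Comp C A B D y x = \<one>\<^bsub>Hom C A D\<^esub>" using R_Comp[OF R] .
  have p'\<delta>: "push C E D A A p' \<delta> = \<one>\<^bsub>EGrp E D A\<^esub>" using push_complement[OF _ _ p'] p by simp
  have d'\<delta>: "pull C E D D A d' \<delta> = \<one>\<^bsub>EGrp E D A\<^esub>" using pull_complement[OF _ _ d'] d by simp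
  have e'\<delta>': "push C E F B B e' \<delta>' = \<one>\<^bsub>EGrp E F B\<^esub>" using push_complement[OF _ _ e'] e by simp

  obtain X g g' where R': "R F B \<delta>' g X g'" using R_exists[of F B \<delta>'] by auto
  have [simp]: "X \<in> Ob C" "g \<in> Mor C B X" "g' \<in> Mor C X F" using R_closed[OF R'] by auto
  have g'g: "Comp C B X F g' g = \<one>\<^bsub>Hom C B F\<^esub>" using R_Comp[OF R'] .
  obtain r r' l \<kappa>\<^sub>0 where r: "complement X r r'"
    and l: "l \<in> Mor C X B" "Comp C B X B l g = e'" "Comp C X B B e' l = l"
    and \<kappa>\<^sub>0: "\<kappa>\<^sub>0 \<in> Mor C F X" "Comp C F X F g' \<kappa>\<^sub>0 = s'" "Comp C F F X \<kappa>\<^sub>0 s' = \<kappa>\<^sub>0"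
    and l\<kappa>\<^sub>0: "Comp C F X B l \<kappa>\<^sub>0 = \<one>\<^bsub>Hom C F B\<^esub>"
    and r'_def: "r' = Comp C X B X g l \<otimes>\<^bsub>Hom C X X\<^esub> Comp C X F X \<kappa>\<^sub>0 g'"
    and rg: "Comp C B X X r g = Comp C B B X g e" and g'r: "Comp C X X F g' r = Comp C X F F s g'"
    by (rule idempotent_realisation[OF F \<open>B \<in> Ob C\<close> \<delta>' e' e(3) s' s(3) R'])
  note [simp] = l(1) \<kappa>\<^sub>0(1) complementD(1,2)[OF r]

  obtain Y h' u v \<delta>'' where [simp]: "Y \<in> Ob C" "h' \<in> Mor C X Y" "u \<in> Mor C D Y" "v \<in> Mor C Y F"
      "\<delta>'' \<in> Ext E Y A"
    and h'g: "Comp C B X Y h' g = Comp C B D Y u y" and vh': "Comp C X Y F v h' = g'"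
    and R'': "R Y A \<delta>'' (Comp C A B X g x) X h'" and R3: "R F D (push C E F B D y \<delta>') u Y v"
    and u\<delta>'': "pull C E Y D A u \<delta>'' = \<delta>" and x\<delta>'': "push C E Y A B x \<delta>'' = pull C E F Y B v \<delta>'"
    using R_ET4[OF R R'] by blast
  have vu: "Comp C D Y F v u = \<one>\<^bsub>Hom C D F\<^esub>" using R_Comp[OF R3] .

  \<comment> \<open>On \<open>A\<close>, \<open>p'\<close> also factors through \<open>g x\<close>,
    as \<open>m l g x = m e' x = m x p' = p'\<close>. The pushout of \<open>\<delta>''\<close> along
    \<open>g x\<close> is zero, hence so is the one along \<open>p'\<close>.\<close>
  obtain m where [simp]: "m \<in> Mor C B A" and mx: "Comp C A B A m x = p'"
    using R_push_zero[OF R _ _ p'\<delta>] by auto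
  have "Comp C A X A (Comp C X B A m l) (Comp C A B X g x) = p'"
    using P(4) by (simp add: additive_simps mx[THEN Comp_extend] mx l(2)[THEN Comp_extend] e'x)
  then have "push C E Y A A p' \<delta>''
      = push C E Y X A (Comp C X B A m l) (push C E Y A X (Comp C A B X g x) \<delta>'')"
    by (metis push_Comp \<open>Y \<in> Ob C\<close> \<open>X \<in> Ob C\<close> \<open>A \<in> Ob C\<close> \<open>B \<in> Ob C\<close> \<open>\<delta>'' \<in> Ext E Y A\<close> \<open>m \<in> Mor C B A\<close>
        l(1) Comp_mor \<open>g \<in> Mor C B X\<close> \<open>x \<in> Mor C A B\<close>)
  also have "\<dots> = \<one>\<^bsub>EGrp E Y A\<^esub>" by (simp add: R_push[OF R''] ext_simps)
  finally have p\<delta>'': "push C E Y A A p \<delta>'' = \<delta>''" using push_complement[OF _ _ p'] by simp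

  obtain n where [simp]: "n \<in> Mor C D B" and yn: "Comp C D B D y n = d'"
    using R_pull_zero[OF R _ _ d'\<delta>] by auto
  \<comment> \<open>The morphism \<open>y l\<close> vanishes on \<open>g x\<close>, because
    \<open>l g x = e' x = x p'\<close> and \<open>y x = 0\<close>, so it descends along
    \<open>h'\<close> to the new vertex. Composing with \<open>d'\<close> afterwards keeps
    \<open>\<rho> h' = y l\<close>, since \<open>d' y l = y e' l = y l\<close>.\<close>
  have "Comp C A X D (Comp C X B D y l) (Comp C A B X g x) = \<one>\<^bsub>Hom C A D\<^esub>"
    by (simp add: additive_simps l(2)[THEN Comp_extend] e'x yx[THEN Comp_extend])
  then obtain \<rho>\<^sub>0 where [simp]: "\<rho>\<^sub>0 \<in> Mor C Y D" and \<rho>\<^sub>0: "Comp C X Y D \<rho>\<^sub>0 h' = Comp C X B D y l"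
    using R_weak_cokernel[OF R'', of D "Comp C X B D y l"] by (auto simp: additive_simps)
  define \<rho> where "\<rho> = Comp C Y D D d' \<rho>\<^sub>0"
  define \<kappa> where "\<kappa> = Comp C F X Y h' \<kappa>\<^sub>0"
  have [simp]: "\<rho> \<in> Mor C Y D" "\<kappa> \<in> Mor C F Y" by (simp_all add: \<rho>_def \<kappa>_def additive_simps)
  have d'\<rho>: "Comp C Y D D d' \<rho> = \<rho>" by (simp add: \<rho>_def additive_simps Dc(4)[THEN Comp_extend])
  have \<rho>h': "Comp C X Y D \<rho> h' = Comp C X B D y l"
    by (simp add: \<rho>_def additive_simps \<rho>\<^sub>0 d'y[THEN Comp_extend] l(3))
  \<comment> \<open>On \<open>u y = h' g\<close> the retraction is known:
    \<open>\<rho> u y = y l g = y e' = d' y\<close>. As \<open>y\<close> need not be epic, this does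
    not give \<open>\<rho> u = d'\<close>; but \<open>d' = y e' n\<close> factors through
    \<open>y\<close>, which yields \<open>\<rho> u d' = d'\<close>.\<close>
  have d'_eq: "Comp C D B D y (Comp C D B B e' n) = d'"
    using Dc(4) by (simp add: additive_simps yn d'y[symmetric, THEN Comp_extend])
  have "Comp C D Y D \<rho> (Comp C D D Y u (Comp C D B D y (Comp C D B B e' n)))
      = Comp C D B D y (Comp C D B B e' n)"
    by (simp add: additive_simps h'g[symmetric, THEN Comp_extend] \<rho>h'[THEN Comp_extend]
        l(2)[THEN Comp_extend] Ec(4)[THEN Comp_extend])
  then have \<rho>ud': "Comp C D Y D \<rho> (Comp C D D Y u d') = d'" by (simp add: d'_eq)
  have \<kappa>: "Comp C F Y F v \<kappa> = s'" "Comp C F F Y \<kappa> s' = \<kappa>"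
    by (simp_all add: \<kappa>_def additive_simps vh'[THEN Comp_extend] \<kappa>\<^sub>0)
  have \<rho>\<kappa>: "Comp C F Y D \<rho> \<kappa> = \<one>\<^bsub>Hom C F D\<^esub>"
    by (simp add: \<kappa>_def additive_simps \<rho>h'[THEN Comp_extend] l\<kappa>\<^sub>0)

  define c' where "c' = Comp C Y D Y u \<rho> \<otimes>\<^bsub>Hom C Y Y\<^esub> Comp C Y F Y \<kappa> v"
  have "Comp C D D D (Comp C D Y D \<rho> u) d' = d'" using \<rho>ud' by (simp add: additive_simps)
  note c' = splitting_idempotent[OF R3 Dc(2) \<open>\<rho> \<in> Mor C Y D\<close> this d'\<rho> \<open>\<kappa> \<in> Mor C F Y\<close> \<kappa> Sc(2) \<rho>\<kappa> c'_def]
  obtain c where c: "complement Y c c'"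
    using complement_exists[of Y c'] complement_swap c'(1,2) \<open>Y \<in> Ob C\<close> by metis
  note [simp] = complementD(1,2)[OF c]
  \<comment> \<open>\<open>c'\<close> is built from the same \<open>l\<close> and
    \<open>\<kappa>\<^sub>0\<close> as \<open>r'\<close>; the relations \<open>h' g = u y\<close>
    and \<open>v h' = g'\<close> move \<open>h'\<close> across both summands.\<close>
  have "Comp C X Y Y c' h' = Comp C X X Y h' r'"
    by (simp add: c'_def r'_def additive_simps \<rho>h' vh' h'g[THEN Comp_extend] \<kappa>_def)
  then have ch': "Comp C X Y Y c h' = Comp C X X Y h' r"
    by (intro complement_commute[OF complement_swap[OF _ r] complement_swap[OF _ c]]) simp_all
  have vc: "Comp C Y Y F v c = Comp C Y F F s v"
    by (rule complement_commute[OF complement_swap[OF _ c] complement_swap[OF _ s'], symmetric])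
      (simp_all add: c'(3))
  \<comment> \<open>Pulling \<open>\<delta>''\<close> back along \<open>c'\<close> gives two terms.
    The first is the pullback of \<open>\<delta>\<close> along \<open>\<rho> = d' \<rho>\<close>,
    zero because \<open>d'\<close> annihilates \<open>\<delta>\<close>; the second factors through
    \<open>h'\<close>, which annihilates \<open>\<delta>''\<close>.\<close>
  have "pull C E D Y A \<rho> \<delta> = pull C E D Y A (Comp C Y D D d' \<rho>) \<delta>" by (simp add: d'\<rho>)
  also have "\<dots> = \<one>\<^bsub>EGrp E Y A\<^esub>" by (subst pull_Comp) (simp_all add: d'\<delta> ext_simps)
  finally have "pull C E Y Y A c' \<delta>'' = \<one>\<^bsub>EGrp E Y A\<^esub>"
    by (simp add: c'_def \<kappa>_def ext_simps u\<delta>'' R_pull[OF R''])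
  then have c\<delta>'': "pull C E Y Y A c \<delta>'' = \<delta>''" using pull_complement[OF _ _ c] by simp

  \<comment> \<open>For the second idempotent the retraction comes from the pushout extension
    itself, which \<open>d'\<close> annihilates since \<open>d' y = y e'\<close>. The section
    \<open>\<kappa>\<close> is kept, so that \<open>c'\<close> and \<open>t'\<close> share the
    summand \<open>\<kappa> v\<close>.\<close>
  have "push C E F D D d' (push C E F B D y \<delta>') = push C E F B D (Comp C B D D d' y) \<delta>'"
    by (simp add: push_Comp)
  also have "\<dots> = \<one>\<^bsub>EGrp E F D\<^esub>" by (simp add: d'y push_Comp e'\<delta>' push_zero_ext)
  finally obtain \<rho>\<^sub>1 where \<rho>\<^sub>1: "\<rho>\<^sub>1 \<in> Mor C Y D" "Comp C D Y D \<rho>\<^sub>1 u = d'" "Comp C Y D D d' \<rho>\<^sub>1 = \<rho>\<^sub>1"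
      "Comp C F Y D \<rho>\<^sub>1 \<kappa> = \<one>\<^bsub>Hom C F D\<^esub>"
    using retraction_exists[OF R3 Dc(2,4) _ \<open>\<kappa> \<in> Mor C F Y\<close> \<kappa> Sc(2)] by blast
  define t' where "t' = Comp C Y D Y u \<rho>\<^sub>1 \<otimes>\<^bsub>Hom C Y Y\<^esub> Comp C Y F Y \<kappa> v"
  have "Comp C D D D (Comp C D Y D \<rho>\<^sub>1 u) d' = d'" using \<rho>\<^sub>1 Dc(4) by simp
  note t' = splitting_idempotent[OF R3 Dc(2) \<rho>\<^sub>1(1) this \<rho>\<^sub>1(3) \<open>\<kappa> \<in> Mor C F Y\<close> \<kappa> Sc(2) \<rho>\<^sub>1(4) t'_def]
  obtain t where t: "complement Y t t'"
    using complement_exists[of Y t'] complement_swap t'(1,2) \<open>Y \<in> Ob C\<close> by metis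
  note [simp] = complementD(1,2)[OF t] \<rho>\<^sub>1(1)
  have tu: "Comp C D Y Y t u = Comp C D D Y u d"
    by (rule complement_commute[OF complement_swap[OF _ d'] complement_swap[OF _ t]])
      (simp_all add: t'(4) \<rho>\<^sub>1)
  have vt: "Comp C Y Y F v t = Comp C Y F F s v"
    by (rule complement_commute[OF complement_swap[OF _ t] complement_swap[OF _ s'], symmetric])
      (simp_all add: t'(3))

  \<comment> \<open>The comparison of \<open>c'\<close> with \<open>t'\<close> rests on
    \<open>\<rho> u \<rho>\<^sub>1 = \<rho>\<^sub>1\<close>. The weak relation
    \<open>\<rho> u d' = d'\<close> suffices for it, because
    \<open>\<rho>\<^sub>1 = d' \<rho>\<^sub>1\<close>.\<close>
  have "Comp C Y D D (Comp C D Y D \<rho> (Comp C D D Y u d')) \<rho>\<^sub>1 = \<rho>\<^sub>1" by (simp add: \<rho>ud' \<rho>\<^sub>1(3))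
  then have \<rho>u\<rho>\<^sub>1: "Comp C Y Y D \<rho> (Comp C Y D Y u \<rho>\<^sub>1) = \<rho>\<^sub>1" by (simp add: additive_simps \<rho>\<^sub>1(3))
  note eqs = additive_simps vu[THEN Comp_extend] \<kappa>(1)[THEN Comp_extend] \<kappa>(2)[THEN Comp_extend]
    \<rho>\<kappa>[THEN Comp_extend] \<rho>\<^sub>1(4)[THEN Comp_extend] \<rho>\<^sub>1(2)[THEN Comp_extend] \<rho>u\<rho>\<^sub>1 d'\<rho>
  have "Comp C Y Y Y c' t' = t'" by (simp add: c'_def t'_def eqs)
  then have "Comp C Y Y Y c t' = \<one>\<^bsub>Hom C Y Y\<^esub>"
    by (intro complement_absorb_left[OF c]) simp_all
  then have ct: "Comp C Y Y Y c t = c" by (intro complement_fix_right[OF t]) simp_all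
  have "Comp C Y Y Y t' c' = c'" by (simp add: c'_def t'_def eqs)
  then have "Comp C Y Y Y t c' = \<one>\<^bsub>Hom C Y Y\<^esub>"
    by (intro complement_absorb_left[OF t]) simp_all
  then have tc: "Comp C Y Y Y t c = t" by (intro complement_fix_right[OF c]) simp_all

  show ?thesis
    by (rule that[OF R' R'' R3 complementD(1,3)[OF r] complementD(1,3)[OF c] complementD(1,3)[OF t]
          rg g'r ch' p\<delta>'' c\<delta>'' h'g vh' u\<delta>'' x\<delta>'' tu vt vc ct tc])
qed

end

section \<open>The completion of an additive category\<close>

context additive_category
begin

context
  fixes A B A' B'
  assumes ob [simp]: "A \<in> Ob C" "B \<in> Ob C" "A' \<in> Ob C" "B' \<in> Ob C"
begin

lemma mor_sum_mor: "\<lbrakk>f \<in> Mor C A A'; g \<in> Mor C B B'\<rbrakk>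
    \<Longrightarrow> mor_sum C A B A' B' f g \<in> Mor C (DSum C A B) (DSum C A' B')"
  by (simp add: mor_sum_def Let_def additive_simps dsum_simps)

lemma mor_sum_In1: "\<lbrakk>f \<in> Mor C A A'; g \<in> Mor C B B'\<rbrakk>
    \<Longrightarrow> Comp C A (DSum C A B) (DSum C A' B') (mor_sum C A B A' B' f g) (In1 C A B)
      = Comp C A A' (DSum C A' B') (In1 C A' B') f"
  by (simp add: mor_sum_def Let_def additive_simps dsum_simps)

lemma mor_sum_In2: "\<lbrakk>f \<in> Mor C A A'; g \<in> Mor C B B'\<rbrakk>
    \<Longrightarrow> Comp C B (DSum C A B) (DSum C A' B') (mor_sum C A B A' B' f g) (In2 C A B)
      = Comp C B B' (DSum C A' B') (In2 C A' B') g"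
  by (simp add: mor_sum_def Let_def additive_simps dsum_simps)

lemma mor_sum_Pr1: "\<lbrakk>f \<in> Mor C A A'; g \<in> Mor C B B'\<rbrakk>
    \<Longrightarrow> Comp C (DSum C A B) (DSum C A' B') A' (Pr1 C A' B') (mor_sum C A B A' B' f g)
      = Comp C (DSum C A B) A A' f (Pr1 C A B)"
  by (simp add: mor_sum_def Let_def additive_simps dsum_simps)

lemma mor_sum_Pr2: "\<lbrakk>f \<in> Mor C A A'; g \<in> Mor C B B'\<rbrakk>
    \<Longrightarrow> Comp C (DSum C A B) (DSum C A' B') B' (Pr2 C A' B') (mor_sum C A B A' B' f g)
      = Comp C (DSum C A B) B B' g (Pr2 C A B)"
  by (simp add: mor_sum_def Let_def additive_simps dsum_simps)

lemma mor_sum_Comp: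
  assumes [simp]: "A'' \<in> Ob C" "B'' \<in> Ob C" "f \<in> Mor C A A'" "g \<in> Mor C B B'"
    "f' \<in> Mor C A' A''" "g' \<in> Mor C B' B''"
  shows "Comp C (DSum C A B) (DSum C A' B') (DSum C A'' B'')
        (mor_sum C A' B' A'' B'' f' g') (mor_sum C A B A' B' f g)
      = mor_sum C A B A'' B'' (Comp C A A' A'' f' f) (Comp C B B' B'' g' g)"
  by (simp add: mor_sum_def Let_def additive_simps dsum_simps)

end

end

lemma completion_Ob: "(A, p) \<in> Ob (idempotent_completion C) \<longleftrightarrow>
    A \<in> Ob C \<and> p \<in> Mor C A A \<and> Comp C A A A p p = p"
  by (simp add: idempotent_completion_def)

lemma completion_Mor: "f \<in> Mor (idempotent_completion C) (A, p) (B, q) \<longleftrightarrow>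
    f \<in> Mor C A B \<and> Comp C A A B f p = f \<and> Comp C A B B q f = f"
  by (simp add: idempotent_completion_def)

lemma completion_Hom:
  "\<one>\<^bsub>Hom (idempotent_completion C) (A, p) (B, q)\<^esub> = \<one>\<^bsub>Hom C A B\<^esub>"
  "f \<otimes>\<^bsub>Hom (idempotent_completion C) (A, p) (B, q)\<^esub> g = f \<otimes>\<^bsub>Hom C A B\<^esub> g"
  by (simp_all add: idempotent_completion_def)

lemma completion_Ident: "Ident (idempotent_completion C) (A, p) = p"
  by (simp add: idempotent_completion_def)

lemma completion_Comp: "Comp (idempotent_completion C) (X, p) (Y, q) (Z, r) = Comp C X Y Z"
  by (simp add: idempotent_completion_def)

lemma completion_DSum:
  "DSum (idempotent_completion C) (A, p) (B, q) = (DSum C A B, mor_sum C A B A B p q)"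
  "In1 (idempotent_completion C) (A, p) (B, q) = Comp C A A (DSum C A B) (In1 C A B) p"
  "In2 (idempotent_completion C) (A, p) (B, q) = Comp C B B (DSum C A B) (In2 C A B) q"
  "Pr1 (idempotent_completion C) (A, p) (B, q) = Comp C (DSum C A B) A A p (Pr1 C A B)"
  "Pr2 (idempotent_completion C) (A, p) (B, q) = Comp C (DSum C A B) B B q (Pr2 C A B)"
  by (simp_all add: idempotent_completion_def)

lemmas completion_simps =
  completion_Ob completion_Mor completion_Hom completion_Ident completion_Comp completion_DSum

context additive_category
begin

lemma completion_Hom_group:
  assumes "A \<in> Ob (idempotent_completion C)" "B \<in> Ob (idempotent_completion C)"
  shows "comm_group (Hom (idempotent_completion C) A B)"
proof -
  obtain A\<^sub>0 p B\<^sub>0 q where AB: "A = (A\<^sub>0, p)" "B = (B\<^sub>0, q)" by (cases A, cases B)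
  note [simp] = assms[unfolded AB completion_Ob] and additive_simps [simp]
  show ?thesis unfolding AB
  proof (rule comm_groupI)
    fix f assume f: "f \<in> Mor (idempotent_completion C) (A\<^sub>0, p) (B\<^sub>0, q)"
    then show "\<exists>g\<in>Mor (idempotent_completion C) (A\<^sub>0, p) (B\<^sub>0, q).
        g \<otimes>\<^bsub>Hom (idempotent_completion C) (A\<^sub>0, p) (B\<^sub>0, q)\<^esub> f
          = \<one>\<^bsub>Hom (idempotent_completion C) (A\<^sub>0, p) (B\<^sub>0, q)\<^esub>"
      by (intro bexI[where x = "inv\<^bsub>Hom C A\<^sub>0 B\<^sub>0\<^esub> f"])
        (auto simp: completion_simps Comp_neg_left Comp_neg_right add_neg
            add_comm[of _ _ "inv\<^bsub>Hom C A\<^sub>0 B\<^sub>0\<^esub> f" f])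
  qed (auto simp: completion_simps add_assoc intro: add_comm)
qed

lemma idempotent_Comp:
  "\<lbrakk>Comp C A A A p p = p; X \<in> Ob C; A \<in> Ob C; p \<in> Mor C A A; f \<in> Mor C X A\<rbrakk>
    \<Longrightarrow> Comp C X A A p (Comp C X A A p f) = Comp C X A A p f"
  by (rule Comp_extend)

theorem additive_completion: "additive_category (idempotent_completion C)"
proof -
  note simps = completion_simps additive_simps idempotent_Comp dsum_simps mor_sum_mor mor_sum_Comp
    mor_sum_In1 mor_sum_In2 mor_sum_Pr1 mor_sum_Pr2
    mor_sum_In1[THEN Comp_extend] mor_sum_In2[THEN Comp_extend] mor_sum_Pr1[THEN Comp_extend] mor_sum_Pr2[THEN Comp_extend]
  let ?I = "idempotent_completion C"
  have cat: "category ?I"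
  proof (unfold_locales, goal_cases)
    case (1 A) then show ?case by (cases A) (simp add: simps)
  next
    case (2 X Y Z f g) then show ?case
      by (cases X, cases Y, cases Z) (auto simp: simps, metis Comp_assoc)
  next
    case (3 X Y f) then show ?case by (cases X, cases Y) (simp add: simps)
  next
    case (4 X Y f) then show ?case by (cases X, cases Y) (simp add: simps)
  next
    case (5 W X Y Z f g h) then show ?case
      by (cases W, cases X, cases Y, cases Z) (simp add: simps)
  qed
  then interpret I: category ?I .
  obtain N where N: "zero_object C N" using zero_object_exists by blast
  then have [simp]: "N \<in> Ob C" by (simp add: zero_object_def)
  have "zero_object ?I (N, Ident C N)"
    unfolding zero_object_def
  proof (intro conjI ballI)
    fix A assume A: "A \<in> Ob ?I"
    obtain A\<^sub>0 p where Ap: "A = (A\<^sub>0, p)" by (cases A)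
    show "\<exists>!f. f \<in> Mor ?I (N, Ident C N) A"
      using A by (intro ex1I[where a = "\<one>\<^bsub>Hom C N A\<^sub>0\<^esub>"])
        (auto simp: Ap simps intro: zero_object_mor(1)[OF N])
    show "\<exists>!f. f \<in> Mor ?I A (N, Ident C N)"
      using A by (intro ex1I[where a = "\<one>\<^bsub>Hom C A\<^sub>0 N\<^esub>"])
        (auto simp: Ap simps intro: zero_object_mor(2)[OF N])
  qed (simp add: simps)
  then have zero: "\<exists>N. zero_object ?I N" ..
  show ?thesis
  proof (intro additive_category.intro[OF cat] additive_category_axioms.intro, goal_cases)
    case (1 A B) then show ?case by (rule completion_Hom_group)
  next
    case (2 X Y Z f g g') then show ?case by (cases X, cases Y, cases Z) (simp add: simps)
  next
    case (3 X Y Z f f' g) then show ?case by (cases X, cases Y, cases Z) (simp add: simps)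
  next
    case 4 show ?case by (rule zero)
  next
    \<comment> \<open>The identity of the direct sum is now \<open>p \<oplus> q\<close>, which is by
      definition the sum of the two composites once the repeated factors \<open>p\<close> and
      \<open>q\<close> are contracted.\<close>
    case (14 A B) then show ?case
      by (cases A, cases B) (simp add: simps mor_sum_def Let_def Comp_extend[where k = "snd A"] Comp_extend[where k = "snd B"])
  qed (auto simp: simps)
qed

end

section \<open>Retracts of realising sequences\<close>

text \<open>\<open>E(r, p)\<close> is an idempotent endomorphism of \<open>E(Z, A)\<close>, and its
  image consists of the extensions fixed by \<open>p\<close> and by \<open>r\<close> separately.
  Taking fixed points instead of a quotient lets the group operations and \<open>EMap\<close> be
  inherited unchanged.\<close>

definition ext_completion :: "('o, 'm) category_data \<Rightarrow> ('o, 'm, 'e) bifunctor_data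
    \<Rightarrow> ('o \<times> 'm, 'm, 'e) bifunctor_data" where
  "ext_completion C E =
    \<lparr> EGrp = (\<lambda>(Z, r) (A, p). (EGrp E Z A)
        \<lparr>carrier := {\<delta> \<in> Ext E Z A. push C E Z A A p \<delta> = \<delta> \<and> pull C E Z Z A r \<delta> = \<delta>}\<rparr>),
      EMap = (\<lambda>(Z, r) (A, p) (Z', r') (A', p'). EMap E Z A Z' A') \<rparr>"

lemma ext_completion_simps:
  "\<delta> \<in> Ext (ext_completion C E) (Z, r) (A, p) \<longleftrightarrow>
    \<delta> \<in> Ext E Z A \<and> push C E Z A A p \<delta> = \<delta> \<and> pull C E Z Z A r \<delta> = \<delta>"
  "\<one>\<^bsub>EGrp (ext_completion C E) (Z, r) (A, p)\<^esub> = \<one>\<^bsub>EGrp E Z A\<^esub>"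
  "\<delta> \<otimes>\<^bsub>EGrp (ext_completion C E) (Z, r) (A, p)\<^esub> \<eta> = \<delta> \<otimes>\<^bsub>EGrp E Z A\<^esub> \<eta>"
  "EMap (ext_completion C E) (Z, r) (A, p) (Z', r') (A', p') = EMap E Z A Z' A'"
  by (simp_all add: ext_completion_def)

context biadditive_functor
begin

lemma push_push:
  "\<lbrakk>Comp C A A' A'' a' a = k; Z \<in> Ob C; A \<in> Ob C; A' \<in> Ob C; A'' \<in> Ob C; a \<in> Mor C A A';
      a' \<in> Mor C A' A''; \<delta> \<in> Ext E Z A\<rbrakk>
    \<Longrightarrow> push C E Z A' A'' a' (push C E Z A A' a \<delta>) = push C E Z A A'' k \<delta>"
  using push_Comp by metis

lemma pull_pull:
  "\<lbrakk>Comp C Z'' Z' Z c c' = k; Z \<in> Ob C; A \<in> Ob C; Z' \<in> Ob C; Z'' \<in> Ob C; c \<in> Mor C Z' Z;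
      c' \<in> Mor C Z'' Z'; \<delta> \<in> Ext E Z A\<rbrakk>
    \<Longrightarrow> pull C E Z' Z'' A c' (pull C E Z Z' A c \<delta>) = pull C E Z Z'' A k \<delta>"
  using pull_Comp by metis

text \<open>The identity of \<open>(Z, r)\<close> is \<open>r\<close>, so \<open>push\<close> in the
  completion is \<open>EMap\<close> at \<open>r\<close> and \<open>a\<close>; the factor
  \<open>r\<close> disappears because \<open>\<delta>\<close> is fixed by it.\<close>

lemma completion_push:
  "\<lbrakk>Z \<in> Ob C; A \<in> Ob C; A' \<in> Ob C; r \<in> Mor C Z Z; a \<in> Mor C A A'; \<delta> \<in> Ext E Z A;
      pull C E Z Z A r \<delta> = \<delta>\<rbrakk>
    \<Longrightarrow> push (idempotent_completion C) (ext_completion C E) (Z, r) (A, p) (A', p') a \<delta>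
      = push C E Z A A' a \<delta>"
  by (simp add: push_def[of "idempotent_completion C"] completion_simps ext_completion_simps
      EMap_push_pull)

lemma completion_pull:
  "\<lbrakk>Z \<in> Ob C; A \<in> Ob C; Z' \<in> Ob C; p \<in> Mor C A A; c \<in> Mor C Z' Z; \<delta> \<in> Ext E Z A;
      push C E Z A A p \<delta> = \<delta>\<rbrakk>
    \<Longrightarrow> pull (idempotent_completion C) (ext_completion C E) (Z, r) (Z', r') (A, p) c \<delta>
      = pull C E Z Z' A c \<delta>"
  by (simp add: pull_def[of "idempotent_completion C"] completion_simps ext_completion_simps
      EMap_push_pull pull_push[symmetric])

lemma completion_EGrp_group:
  assumes "Z \<in> Ob (idempotent_completion C)" "A \<in> Ob (idempotent_completion C)"
  shows "comm_group (EGrp (ext_completion C E) Z A)"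
proof -
  obtain Z\<^sub>0 r A\<^sub>0 p where ZA: "Z = (Z\<^sub>0, r)" "A = (A\<^sub>0, p)" by (cases Z, cases A)
  note [simp] = assms[unfolded ZA completion_Ob]
  interpret G: comm_group "EGrp E Z\<^sub>0 A\<^sub>0" by (rule EGrp_group) simp_all
  interpret push: group_hom "EGrp E Z\<^sub>0 A\<^sub>0" "EGrp E Z\<^sub>0 A\<^sub>0" "push C E Z\<^sub>0 A\<^sub>0 A\<^sub>0 p"
    unfolding push_def by (rule EMap_group_hom) (simp_all add: Ident_mor)
  interpret pull: group_hom "EGrp E Z\<^sub>0 A\<^sub>0" "EGrp E Z\<^sub>0 A\<^sub>0" "pull C E Z\<^sub>0 Z\<^sub>0 A\<^sub>0 r"
    unfolding pull_def by (rule EMap_group_hom) (simp_all add: Ident_mor)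
  show ?thesis unfolding ZA
  proof (rule comm_groupI)
    fix \<delta> assume \<delta>: "\<delta> \<in> Ext (ext_completion C E) (Z\<^sub>0, r) (A\<^sub>0, p)"
    then show "\<exists>\<eta>\<in>Ext (ext_completion C E) (Z\<^sub>0, r) (A\<^sub>0, p).
        \<eta> \<otimes>\<^bsub>EGrp (ext_completion C E) (Z\<^sub>0, r) (A\<^sub>0, p)\<^esub> \<delta>
          = \<one>\<^bsub>EGrp (ext_completion C E) (Z\<^sub>0, r) (A\<^sub>0, p)\<^esub>"
      by (intro bexI[where x = "inv\<^bsub>EGrp E Z\<^sub>0 A\<^sub>0\<^esub> \<delta>"]) (auto simp: ext_completion_simps)
  qed (auto simp: ext_completion_simps G.m_assoc intro: G.m_comm)
qed

theorem biadditive_completion: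
  "biadditive_functor (idempotent_completion C) (ext_completion C E)"
proof -
  let ?I = "idempotent_completion C" and ?F = "ext_completion C E"
  interpret I: additive_category ?I by (rule additive_completion)
  note simps = completion_simps ext_completion_simps
  show ?thesis
  proof (intro biadditive_functor.intro[OF additive_completion] biadditive_functor_axioms.intro,
      goal_cases)
    case (1 Z A) then show ?case by (rule completion_EGrp_group)
  next
    case (2 Z Z' A A' c a)
    obtain Z\<^sub>0 r Z\<^sub>1 r' A\<^sub>0 p A\<^sub>1 p'
      where eq: "Z = (Z\<^sub>0, r)" "Z' = (Z\<^sub>1, r')" "A = (A\<^sub>0, p)" "A' = (A\<^sub>1, p')"
      by (cases Z, cases Z', cases A, cases A')
    note [simp] = 2[unfolded eq completion_simps]
    have "push C E Z\<^sub>1 A\<^sub>1 A\<^sub>1 p' (EMap E Z\<^sub>0 A\<^sub>0 Z\<^sub>1 A\<^sub>1 c a \<delta>) = EMap E Z\<^sub>0 A\<^sub>0 Z\<^sub>1 A\<^sub>1 c a \<delta>"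
      "pull C E Z\<^sub>1 Z\<^sub>1 A\<^sub>1 r' (EMap E Z\<^sub>0 A\<^sub>0 Z\<^sub>1 A\<^sub>1 c a \<delta>) = EMap E Z\<^sub>0 A\<^sub>0 Z\<^sub>1 A\<^sub>1 c a \<delta>"
      if "\<delta> \<in> Ext E Z\<^sub>0 A\<^sub>0" for \<delta>
      using that by (simp_all add: EMap_push_pull push_push[where k = a] pull_pull[where k = c]
          pull_push push_closed pull_closed)
    then show ?case
      by (auto simp: eq hom_def simps EMap_add EMap_closed)
  next
    case (3 Z A \<delta>) then show ?case by (cases Z, cases A) (auto simp: simps EMap_push_pull)
  next
    case (4 Z Z' Z'' A A' A'' c c' a a' \<delta>) then show ?case
      by (cases Z, cases Z', cases Z'', cases A, cases A', cases A'') (auto simp: simps EMap_Comp)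
  next
    case (5 Z A A' a b \<delta>) then show ?case
      by (cases Z, cases A, cases A') (auto simp: simps completion_push push_add add_closed)
  next
    case (6 Z Z' A c d \<delta>) then show ?case
      by (cases Z, cases Z', cases A) (auto simp: simps completion_pull pull_add add_closed)
  qed
qed

end

text \<open>
  A sequence in the completion realises \<open>\<delta>\<close> if it is a retract, through \<open>i\<close> and \<open>j\<close>, of a sequence
  \<open>A \<rightarrow> B\<^sub>0 \<rightarrow> Z\<close> that realises \<open>\<delta>\<close> in the original category. The conditions are
  invariant under reversal of all arrows, which exchanges \<open>i\<close> and \<open>j\<close>.
\<close>

definition retract_realises :: "('o, 'm) category_data \<Rightarrow> ('o, 'm, 'e) bifunctor_data \<Rightarrow>
    ('o \<Rightarrow> 'o \<Rightarrow> 'e \<Rightarrow> 'm \<Rightarrow> 'o \<Rightarrow> 'm \<Rightarrow> bool) \<Rightarrow>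
    'o \<times> 'm \<Rightarrow> 'o \<times> 'm \<Rightarrow> 'e \<Rightarrow> 'm \<Rightarrow> 'o \<times> 'm \<Rightarrow> 'm \<Rightarrow> bool" where
  "retract_realises C E R = (\<lambda>(Z, r) (A, p) \<delta> x (B, e) y.
     (Z, r) \<in> Ob (idempotent_completion C) \<and> (A, p) \<in> Ob (idempotent_completion C) \<and>
     (B, e) \<in> Ob (idempotent_completion C) \<and> \<delta> \<in> Ext (ext_completion C E) (Z, r) (A, p) \<and>
     (\<exists>x\<^sub>0 B\<^sub>0 y\<^sub>0 i j. R Z A \<delta> x\<^sub>0 B\<^sub>0 y\<^sub>0 \<and> i \<in> Mor C B B\<^sub>0 \<and> j \<in> Mor C B\<^sub>0 B \<and>
        Comp C B B B\<^sub>0 i e = i \<and> Comp C B\<^sub>0 B B e j = j \<and> Comp C B B\<^sub>0 B j i = e \<and>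
        Comp C A B\<^sub>0 B j x\<^sub>0 = x \<and> Comp C A B B\<^sub>0 i x = Comp C A A B\<^sub>0 x\<^sub>0 p \<and>
        Comp C B B\<^sub>0 Z y\<^sub>0 i = y \<and> Comp C B\<^sub>0 B Z y j = Comp C B\<^sub>0 Z Z r y\<^sub>0))"

lemma retract_realisesI:
  assumes "(Z, r) \<in> Ob (idempotent_completion C)" "(A, p) \<in> Ob (idempotent_completion C)"
    "(B, e) \<in> Ob (idempotent_completion C)" "\<delta> \<in> Ext (ext_completion C E) (Z, r) (A, p)"
    "R Z A \<delta> x\<^sub>0 B\<^sub>0 y\<^sub>0" "i \<in> Mor C B B\<^sub>0" "j \<in> Mor C B\<^sub>0 B"
    "Comp C B B B\<^sub>0 i e = i" "Comp C B\<^sub>0 B B e j = j" "Comp C B B\<^sub>0 B j i = e"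
    "Comp C A B\<^sub>0 B j x\<^sub>0 = x" "Comp C A B B\<^sub>0 i x = Comp C A A B\<^sub>0 x\<^sub>0 p"
    "Comp C B B\<^sub>0 Z y\<^sub>0 i = y" "Comp C B\<^sub>0 B Z y j = Comp C B\<^sub>0 Z Z r y\<^sub>0"
  shows "retract_realises C E R (Z, r) (A, p) \<delta> x (B, e) y"
  unfolding retract_realises_def split_conv by (intro conjI exI) (rule assms)+

section \<open>Existence, morphisms, uniqueness and octahedra of realising retracts\<close>

context octahedral_category
begin

abbreviation "IC \<equiv> idempotent_completion C"
abbreviation "FE \<equiv> ext_completion C E"
abbreviation "RR \<equiv> retract_realises C E R"

lemma retract_E:
  assumes "RR (Z, r) (A, p) \<delta> x (B, e) y"
  obtains x\<^sub>0 B\<^sub>0 y\<^sub>0 i j where "R Z A \<delta> x\<^sub>0 B\<^sub>0 y\<^sub>0"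
    "Z \<in> Ob C" "A \<in> Ob C" "\<delta> \<in> Ext E Z A" "B\<^sub>0 \<in> Ob C" "x\<^sub>0 \<in> Mor C A B\<^sub>0" "y\<^sub>0 \<in> Mor C B\<^sub>0 Z"
    "B \<in> Ob C" "p \<in> Mor C A A" "r \<in> Mor C Z Z" "e \<in> Mor C B B"
    "Comp C A A A p p = p" "Comp C Z Z Z r r = r" "Comp C B B B e e = e"
    "push C E Z A A p \<delta> = \<delta>" "pull C E Z Z A r \<delta> = \<delta>"
    "x \<in> Mor C A B" "y \<in> Mor C B Z"
    "Comp C A A B x p = x" "Comp C A B B e x = x" "Comp C B B Z y e = y" "Comp C B Z Z r y = y"
    "i \<in> Mor C B B\<^sub>0" "j \<in> Mor C B\<^sub>0 B"
    "Comp C B B B\<^sub>0 i e = i" "Comp C B\<^sub>0 B B e j = j" "Comp C B B\<^sub>0 B j i = e"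
    "Comp C A B\<^sub>0 B j x\<^sub>0 = x" "Comp C A B B\<^sub>0 i x = Comp C A A B\<^sub>0 x\<^sub>0 p"
    "Comp C B B\<^sub>0 Z y\<^sub>0 i = y" "Comp C B\<^sub>0 B Z y j = Comp C B\<^sub>0 Z Z r y\<^sub>0"
proof -
  obtain x\<^sub>0 B\<^sub>0 y\<^sub>0 i j where R: "R Z A \<delta> x\<^sub>0 B\<^sub>0 y\<^sub>0" and
    ob: "(Z, r) \<in> Ob IC" "(A, p) \<in> Ob IC" "(B, e) \<in> Ob IC" "\<delta> \<in> Ext FE (Z, r) (A, p)" and
    ij: "i \<in> Mor C B B\<^sub>0" "j \<in> Mor C B\<^sub>0 B"
    "Comp C B B B\<^sub>0 i e = i" "Comp C B\<^sub>0 B B e j = j" "Comp C B B\<^sub>0 B j i = e"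
    "Comp C A B\<^sub>0 B j x\<^sub>0 = x" "Comp C A B B\<^sub>0 i x = Comp C A A B\<^sub>0 x\<^sub>0 p"
    "Comp C B B\<^sub>0 Z y\<^sub>0 i = y" "Comp C B\<^sub>0 B Z y j = Comp C B\<^sub>0 Z Z r y\<^sub>0"
    using assms unfolding retract_realises_def by auto
  note cl = R_closed[OF R]
  have ob': "B \<in> Ob C" "p \<in> Mor C A A" "r \<in> Mor C Z Z" "e \<in> Mor C B B"
    "Comp C A A A p p = p" "Comp C Z Z Z r r = r" "Comp C B B B e e = e"
    "push C E Z A A p \<delta> = \<delta>" "pull C E Z Z A r \<delta> = \<delta>"
    using ob by (auto simp: completion_simps ext_completion_simps)
  have xy: "x \<in> Mor C A B" "y \<in> Mor C B Z" using cl ob' ij by (auto simp: Comp_mor)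
  have ex: "Comp C A B B e x = x"
    unfolding ij(6)[symmetric] using cl ob' ij by (intro Comp_extend) auto
  have ye: "Comp C B B Z y e = y"
    using cl ob' ij Comp_assoc[of B B B\<^sub>0 Z e i y\<^sub>0] by auto
  \<comment> \<open>Here \<open>x p = j x\<^sub>0 p = j i x\<close>, and \<open>j i = e\<close>
    fixes \<open>x\<close>; the argument for \<open>r y = y\<close> is dual.\<close>
  have "Comp C A A B x p = Comp C A B B (Comp C B B\<^sub>0 B j i) x"
    using cl ob' ij xy Comp_assoc[of A A B\<^sub>0 B p x\<^sub>0 j] Comp_assoc[of A B B\<^sub>0 B x i j] by auto
  then have xp: "Comp C A A B x p = x" using ex ij(5) by simp
  have "Comp C B Z Z r y = Comp C B B Z y (Comp C B B\<^sub>0 B j i)"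
    using cl ob' ij xy Comp_assoc[of B B\<^sub>0 Z Z i y\<^sub>0 r] Comp_assoc[of B B\<^sub>0 B Z i j y] by auto
  then have ry: "Comp C B Z Z r y = y" using ye ij(5) by simp
  show ?thesis
    using that[OF R _ _ _ _ _ _ ob' xy xp ex ye ry ij] cl by blast
qed

text \<open>The idempotent \<open>e\<close> serves both as the inclusion \<open>i\<close> and as the
  projection \<open>j\<close>.\<close>

lemma retract_standard:
  assumes R: "R Z A \<delta> x B y" and p: "p \<in> Mor C A A" "Comp C A A A p p = p" "push C E Z A A p \<delta> = \<delta>"
    and r: "r \<in> Mor C Z Z" "Comp C Z Z Z r r = r" "pull C E Z Z A r \<delta> = \<delta>"
    and e: "e \<in> Mor C B B" "Comp C B B B e e = e"
    and ex: "Comp C A B B e x = Comp C A A B x p" and ye: "Comp C B B Z y e = Comp C B Z Z r y"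
  shows "RR (Z, r) (A, p) \<delta> (Comp C A A B x p) (B, e) (Comp C B Z Z r y)"
proof -
  note [simp] = R_closed[OF R] p r e
  show ?thesis
    by (rule retract_realisesI[where R = R, OF _ _ _ _ R e(1) e(1)])
      (simp_all add: completion_simps ext_completion_simps additive_simps ex ye ex[THEN Comp_extend]
        idempotent_Comp)
qed

lemma retract_exists:
  assumes "(Z, r) \<in> Ob IC" "(A, p) \<in> Ob IC" "\<delta> \<in> Ext FE (Z, r) (A, p)"
  obtains x B e y where "RR (Z, r) (A, p) \<delta> x (B, e) y"
proof -
  have h: "Z \<in> Ob C" "A \<in> Ob C" "\<delta> \<in> Ext E Z A" "push C E Z A A p \<delta> = \<delta>" "pull C E Z Z A r \<delta> = \<delta>"
    and [simp]: "p \<in> Mor C A A" "Comp C A A A p p = p" "r \<in> Mor C Z Z" "Comp C Z Z Z r r = r"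
    using assms by (auto simp: completion_simps ext_completion_simps)
  note [simp] = h
  obtain x B y where R: "R Z A \<delta> x B y" using R_exists[of Z A \<delta>] by auto
  obtain p' where p': "complement A p p'" by (rule complement_exists[of A p]) simp_all
  obtain r' where r': "complement Z r r'" by (rule complement_exists[of Z r]) simp_all
  obtain e e' where e: "complement B e e'"
    "Comp C A B B e x = Comp C A A B x p" "Comp C B B Z y e = Comp C B Z Z r y"
    by (rule idempotent_realisation[OF h(1-3) p' h(4) r' h(5) R])
  show ?thesis
    by (rule that, rule retract_standard[OF R, of p r e]) (simp_all add: e complementD[OF e(1)])
qed

text \<open>The pair \<open>(a, c)\<close> is lifted to \<open>b\<^sub>0\<close> between the ambient
  sequences, and \<open>j' b\<^sub>0 i\<close> is its restriction to the retracts.\<close>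

lemma retract_morphism:
  assumes RR: "RR (Z, r) (A, p) \<delta> x (B, e) y" and RR': "RR (Z', r') (A', p') \<delta>' x' (B', e') y'"
    and a: "a \<in> Mor IC (A, p) (A', p')" and c: "c \<in> Mor IC (Z, r) (Z', r')"
    and eq: "push C E Z A A' a \<delta> = pull C E Z' Z A' c \<delta>'"
  obtains b where "b \<in> Mor IC (B, e) (B', e')"
    "Comp C A B B' b x = Comp C A A' B' x' a" "Comp C B B' Z' y' b = Comp C B Z Z' c y"
proof -
  obtain x\<^sub>0 B\<^sub>0 y\<^sub>0 i j where R: "R Z A \<delta> x\<^sub>0 B\<^sub>0 y\<^sub>0" and 1:
    "Z \<in> Ob C" "A \<in> Ob C" "\<delta> \<in> Ext E Z A" "B\<^sub>0 \<in> Ob C" "x\<^sub>0 \<in> Mor C A B\<^sub>0" "y\<^sub>0 \<in> Mor C B\<^sub>0 Z"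
    "B \<in> Ob C" "p \<in> Mor C A A" "r \<in> Mor C Z Z" "e \<in> Mor C B B"
    "x \<in> Mor C A B" "y \<in> Mor C B Z" "i \<in> Mor C B B\<^sub>0" "j \<in> Mor C B\<^sub>0 B" and 2:
    "Comp C B B B\<^sub>0 i e = i" "Comp C A B B\<^sub>0 i x = Comp C A A B\<^sub>0 x\<^sub>0 p" "Comp C B B\<^sub>0 Z y\<^sub>0 i = y"
    by (rule retract_E[OF RR])
  obtain x\<^sub>1 B\<^sub>1 y\<^sub>1 i' j' where R': "R Z' A' \<delta>' x\<^sub>1 B\<^sub>1 y\<^sub>1" and 3:
    "Z' \<in> Ob C" "A' \<in> Ob C" "\<delta>' \<in> Ext E Z' A'" "B\<^sub>1 \<in> Ob C" "x\<^sub>1 \<in> Mor C A' B\<^sub>1" "y\<^sub>1 \<in> Mor C B\<^sub>1 Z'"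
    "B' \<in> Ob C" "p' \<in> Mor C A' A'" "r' \<in> Mor C Z' Z'" "e' \<in> Mor C B' B'"
    "x' \<in> Mor C A' B'" "y' \<in> Mor C B' Z'" "i' \<in> Mor C B' B\<^sub>1" "j' \<in> Mor C B\<^sub>1 B'" and 4:
    "Comp C B\<^sub>1 B' B' e' j' = j'" "Comp C A' B\<^sub>1 B' j' x\<^sub>1 = x'"
    "Comp C B\<^sub>1 B' Z' y' j' = Comp C B\<^sub>1 Z' Z' r' y\<^sub>1"
    by (rule retract_E[OF RR'])
  note [simp] = 1 3 and ac = a[unfolded completion_simps] c[unfolded completion_simps]
  obtain b\<^sub>0 where b\<^sub>0 [simp]: "b\<^sub>0 \<in> Mor C B\<^sub>0 B\<^sub>1" and
    5: "Comp C A B\<^sub>0 B\<^sub>1 b\<^sub>0 x\<^sub>0 = Comp C A A' B\<^sub>1 x\<^sub>1 a" "Comp C B\<^sub>0 B\<^sub>1 Z' y\<^sub>1 b\<^sub>0 = Comp C B\<^sub>0 Z Z' c y\<^sub>0"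
    using R_morphism[OF R R' _ _ eq] ac by auto
  have c': "Comp C Z Z' Z' r' c = c" using ac by simp
  note eqs = additive_simps 2 2[THEN Comp_extend] 4 4[THEN Comp_extend] 5 5[THEN Comp_extend] ac
    c'[THEN Comp_extend]
  show ?thesis
    by (rule that[of "Comp C B B\<^sub>1 B' j' (Comp C B B\<^sub>0 B\<^sub>1 b\<^sub>0 i)"])
      (simp_all add: completion_simps eqs)
qed

text \<open>Here \<open>b\<close> is extended to \<open>i' b j\<close> between the ambient
  sequences, (ET3) is applied there, and the resulting \<open>c\<close> is cut down to
  \<open>r' c r\<close>. The cut preserves the equation of extensions because
  \<open>\<delta>\<close> is fixed by \<open>r\<close> and \<open>\<delta>'\<close> by
  \<open>r'\<close>.\<close>

lemma retract_ET3:
  assumes RR: "RR (Z, r) (A, p) \<delta> x (B, e) y" and RR': "RR (Z', r') (A', p') \<delta>' x' (B', e') y'"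
    and a: "a \<in> Mor IC (A, p) (A', p')" and b: "b \<in> Mor IC (B, e) (B', e')"
    and eq: "Comp C A B B' b x = Comp C A A' B' x' a"
  obtains c where "c \<in> Mor IC (Z, r) (Z', r')"
    "push C E Z A A' a \<delta> = pull C E Z' Z A' c \<delta>'" "Comp C B B' Z' y' b = Comp C B Z Z' c y"
proof -
  obtain x\<^sub>0 B\<^sub>0 y\<^sub>0 i j where R: "R Z A \<delta> x\<^sub>0 B\<^sub>0 y\<^sub>0" and 1:
    "Z \<in> Ob C" "A \<in> Ob C" "\<delta> \<in> Ext E Z A" "B\<^sub>0 \<in> Ob C" "x\<^sub>0 \<in> Mor C A B\<^sub>0" "y\<^sub>0 \<in> Mor C B\<^sub>0 Z"
    "B \<in> Ob C" "p \<in> Mor C A A" "r \<in> Mor C Z Z" "e \<in> Mor C B B"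
    "x \<in> Mor C A B" "y \<in> Mor C B Z" "i \<in> Mor C B B\<^sub>0" "j \<in> Mor C B\<^sub>0 B" and 2:
    "pull C E Z Z A r \<delta> = \<delta>" "Comp C Z Z Z r r = r"
    "Comp C B B\<^sub>0 B j i = e" "Comp C A B\<^sub>0 B j x\<^sub>0 = x" "Comp C B B\<^sub>0 Z y\<^sub>0 i = y" "Comp C B Z Z r y = y"
    by (rule retract_E[OF RR])
  obtain x\<^sub>1 B\<^sub>1 y\<^sub>1 i' j' where R': "R Z' A' \<delta>' x\<^sub>1 B\<^sub>1 y\<^sub>1" and 3:
    "Z' \<in> Ob C" "A' \<in> Ob C" "\<delta>' \<in> Ext E Z' A'" "B\<^sub>1 \<in> Ob C" "x\<^sub>1 \<in> Mor C A' B\<^sub>1" "y\<^sub>1 \<in> Mor C B\<^sub>1 Z'"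
    "B' \<in> Ob C" "p' \<in> Mor C A' A'" "r' \<in> Mor C Z' Z'" "e' \<in> Mor C B' B'"
    "x' \<in> Mor C A' B'" "y' \<in> Mor C B' Z'" "i' \<in> Mor C B' B\<^sub>1" "j' \<in> Mor C B\<^sub>1 B'" and 4:
    "pull C E Z' Z' A' r' \<delta>' = \<delta>'" "Comp C Z' Z' Z' r' r' = r'"
    "Comp C A' B' B\<^sub>1 i' x' = Comp C A' A' B\<^sub>1 x\<^sub>1 p'" "Comp C B' B\<^sub>1 Z' y\<^sub>1 i' = y'"
    "Comp C B' Z' Z' r' y' = y'"
    by (rule retract_E[OF RR'])
  note [simp] = 1 3 and ab = a[unfolded completion_simps] b[unfolded completion_simps]
  define b\<^sub>0 where "b\<^sub>0 = Comp C B\<^sub>0 B' B\<^sub>1 i' (Comp C B\<^sub>0 B B' b j)"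
  have b\<^sub>0 [simp]: "b\<^sub>0 \<in> Mor C B\<^sub>0 B\<^sub>1" using ab by (simp add: b\<^sub>0_def additive_simps)
  note eqs = additive_simps 2(3-) 2(3-)[THEN Comp_extend] 4(3-) 4(3-)[THEN Comp_extend] eq
    eq[THEN Comp_extend] ab
  have "Comp C A B\<^sub>0 B\<^sub>1 b\<^sub>0 x\<^sub>0 = Comp C A A' B\<^sub>1 x\<^sub>1 a"
    by (simp add: b\<^sub>0_def eqs)
  then obtain c where [simp]: "c \<in> Mor C Z Z'" and c: "push C E Z A A' a \<delta> = pull C E Z' Z A' c \<delta>'"
    and cy: "Comp C B\<^sub>0 B\<^sub>1 Z' y\<^sub>1 b\<^sub>0 = Comp C B\<^sub>0 Z Z' c y\<^sub>0"
    using R_ET3[OF R R' _ b\<^sub>0] ab by auto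
  have "Comp C B Z Z' c y = Comp C B B\<^sub>0 Z' (Comp C B\<^sub>0 Z Z' c y\<^sub>0) i" by (simp add: eqs)
  also have "\<dots> = Comp C B B' Z' y' b"
    unfolding cy[symmetric] by (simp add: b\<^sub>0_def eqs)
  finally have cy': "Comp C B Z Z' c y = Comp C B B' Z' y' b" .
  show ?thesis
  proof (rule that[of "Comp C Z Z' Z' r' (Comp C Z Z Z' c r)"])
    show "Comp C Z Z' Z' r' (Comp C Z Z Z' c r) \<in> Mor IC (Z, r) (Z', r')"
      by (simp add: completion_simps additive_simps 2 4 4(2)[THEN Comp_extend])
    show "push C E Z A A' a \<delta> = pull C E Z' Z A' (Comp C Z Z' Z' r' (Comp C Z Z Z' c r)) \<delta>'"
      using ab by (simp add: ext_simps 2 4 c[symmetric])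
    show "Comp C B B' Z' y' b = Comp C B Z Z' (Comp C Z Z' Z' r' (Comp C Z Z Z' c r)) y"
      using ab by (simp add: additive_simps 2 cy' 4(5)[THEN Comp_extend])
  qed
qed

text \<open>Write \<open>n = e + w\<close>. As \<open>w\<close> vanishes on \<open>x\<close>, it
  factors as \<open>w = z y\<close>; then \<open>y w = 0\<close> gives \<open>w w = 0\<close>, and
  \<open>e - w\<close> is the inverse.\<close>

lemma retract_automorphism:
  assumes RR: "RR (Z, r) (A, p) \<delta> x (B, e) y"
    and n: "n \<in> Mor IC (B, e) (B, e)" "Comp C A B B n x = x" "Comp C B B Z y n = y"
  obtains n' where "n' \<in> Mor IC (B, e) (B, e)" "Comp C B B B n' n = e" "Comp C B B B n n' = e"
proof -
  obtain x\<^sub>0 B\<^sub>0 y\<^sub>0 i j where R: "R Z A \<delta> x\<^sub>0 B\<^sub>0 y\<^sub>0" and 1: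
    "Z \<in> Ob C" "A \<in> Ob C" "\<delta> \<in> Ext E Z A" "B\<^sub>0 \<in> Ob C" "x\<^sub>0 \<in> Mor C A B\<^sub>0" "y\<^sub>0 \<in> Mor C B\<^sub>0 Z"
    "B \<in> Ob C" "e \<in> Mor C B B"
    "x \<in> Mor C A B" "y \<in> Mor C B Z" "i \<in> Mor C B B\<^sub>0" "j \<in> Mor C B\<^sub>0 B" and 2:
    "Comp C B B B e e = e" "Comp C A B B e x = x" "Comp C B B Z y e = y"
    "Comp C B B\<^sub>0 B j i = e" "Comp C A B\<^sub>0 B j x\<^sub>0 = x" "Comp C B B\<^sub>0 Z y\<^sub>0 i = y"
    by (rule retract_E[OF RR])
  note [simp] = 1 and n' = n[unfolded completion_simps]
  define w where "w = n \<otimes>\<^bsub>Hom C B B\<^esub> inv\<^bsub>Hom C B B\<^esub> e"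
  define w' where "w' = inv\<^bsub>Hom C B B\<^esub> w"
  note eqs = additive_simps Comp_neg_left Comp_neg_right add_neg neg_zero n' 2
  have [simp]: "w \<in> Mor C B B" "w' \<in> Mor C B B" using n' by (simp_all add: w_def w'_def additive_simps)
  have n_eq: "n = e \<otimes>\<^bsub>Hom C B B\<^esub> w" using n' by (simp add: w_def eqs add_lcomm[of B B e n])
  have we: "Comp C B B B w e = w" "Comp C B B B e w = w"
    and wx: "Comp C A B B w x = \<one>\<^bsub>Hom C A B\<^esub>" and yw: "Comp C B B Z y w = \<one>\<^bsub>Hom C B Z\<^esub>"
    by (simp_all add: w_def eqs)
  \<comment> \<open>The weak cokernel property belongs to the ambient sequence, so it is applied to
    \<open>w j\<close>; composing with \<open>i\<close> recovers \<open>w = w j i\<close>.\<close>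
  have "Comp C A B\<^sub>0 B (Comp C B\<^sub>0 B B w j) x\<^sub>0 = \<one>\<^bsub>Hom C A B\<^esub>"
    by (simp add: additive_simps 2 wx)
  then obtain z where [simp]: "z \<in> Mor C Z B" and z: "Comp C B\<^sub>0 B B w j = Comp C B\<^sub>0 Z B z y\<^sub>0"
    using R_weak_cokernel[OF R, of B "Comp C B\<^sub>0 B B w j"] by (auto simp: additive_simps)
  have "w = Comp C B B\<^sub>0 B (Comp C B\<^sub>0 B B w j) i" by (simp add: additive_simps 2 we)
  also have "\<dots> = Comp C B Z B z y" unfolding z by (simp add: additive_simps 2)
  finally have "Comp C B B B w w = Comp C B B B (Comp C B Z B z y) w" by simp
  then have ww: "Comp C B B B w w = \<one>\<^bsub>Hom C B B\<^esub>" by (simp add: additive_simps yw)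
  have w': "Comp C B B B w' e = w'" "Comp C B B B e w' = w'" "w \<otimes>\<^bsub>Hom C B B\<^esub> w' = \<one>\<^bsub>Hom C B B\<^esub>"
    "w' \<otimes>\<^bsub>Hom C B B\<^esub> w = \<one>\<^bsub>Hom C B B\<^esub>"
    "Comp C B B B w w' = \<one>\<^bsub>Hom C B B\<^esub>" "Comp C B B B w' w = \<one>\<^bsub>Hom C B B\<^esub>"
    by (simp_all add: w'_def Comp_neg_left Comp_neg_right we ww neg_zero add_neg neg_closed
        add_comm[of B B "inv\<^bsub>Hom C B B\<^esub> w" w])
  show ?thesis
    by (rule that[of "e \<otimes>\<^bsub>Hom C B B\<^esub> w'"])
      (simp_all add: completion_simps n_eq additive_simps we w' ww 2 add_assoc)
qed

text \<open>
  Lifting an isomorphism of extensions and its inverse to the middle terms gives two morphisms whose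
  composites are automorphisms of the previous kind.
\<close>

lemma retract_isomorphism:
  assumes RR: "RR (Z, r) (A, p) \<delta> x (B, e) y" and RR': "RR (Z', r') (A', p') \<delta>' x' (B', e') y'"
    and a: "a \<in> Mor IC (A, p) (A', p')" "a' \<in> Mor IC (A', p') (A, p)"
      "Comp C A A' A a' a = p" "Comp C A' A A' a a' = p'"
    and c: "c \<in> Mor IC (Z, r) (Z', r')" "c' \<in> Mor IC (Z', r') (Z, r)"
      "Comp C Z Z' Z c' c = r" "Comp C Z' Z Z' c c' = r'"
    and eq: "push C E Z A A' a \<delta> = pull C E Z' Z A' c \<delta>'"
  obtains b b' where "b \<in> Mor IC (B, e) (B', e')" "b' \<in> Mor IC (B', e') (B, e)"
    "Comp C B B' B b' b = e" "Comp C B' B B' b b' = e'"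
    "Comp C A B B' b x = Comp C A A' B' x' a" "Comp C B B' Z' y' b = Comp C B Z Z' c y"
proof -
  obtain x\<^sub>0 B\<^sub>0 y\<^sub>0 i j where 1:
    "Z \<in> Ob C" "A \<in> Ob C" "\<delta> \<in> Ext E Z A" "B \<in> Ob C" "p \<in> Mor C A A" "r \<in> Mor C Z Z"
    "e \<in> Mor C B B" "x \<in> Mor C A B" "y \<in> Mor C B Z" and 2:
    "push C E Z A A p \<delta> = \<delta>" "pull C E Z Z A r \<delta> = \<delta>" "Comp C A A B x p = x" "Comp C B Z Z r y = y"
    by (rule retract_E[OF RR])
  obtain x\<^sub>1 B\<^sub>1 y\<^sub>1 i' j' where 3:
    "Z' \<in> Ob C" "A' \<in> Ob C" "\<delta>' \<in> Ext E Z' A'" "B' \<in> Ob C" "p' \<in> Mor C A' A'" "r' \<in> Mor C Z' Z'"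
    "e' \<in> Mor C B' B'" "x' \<in> Mor C A' B'" "y' \<in> Mor C B' Z'" and 4:
    "push C E Z' A' A' p' \<delta>' = \<delta>'" "pull C E Z' Z' A' r' \<delta>' = \<delta>'" "Comp C A' A' B' x' p' = x'"
    "Comp C B' Z' Z' r' y' = y'"
    by (rule retract_E[OF RR'])
  note [simp] = 1 3
  have ac [simp]: "a \<in> Mor C A A'" "a' \<in> Mor C A' A" "c \<in> Mor C Z Z'" "c' \<in> Mor C Z' Z"
    using a c by (auto simp: completion_simps)
  \<comment> \<open>Inserting \<open>c c' = r'\<close> and cancelling \<open>a' a = p\<close> shows
    that \<open>a'\<close> and \<open>c'\<close> form a morphism from \<open>\<delta>'\<close> back
    to \<open>\<delta>\<close>.\<close>
  have "push C E Z' A' A a' \<delta>' = push C E Z' A' A a' (pull C E Z' Z' A' (Comp C Z' Z Z' c c') \<delta>')"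
    by (simp add: c 4)
  also have "\<dots> = pull C E Z Z' A c' (push C E Z A' A a' (push C E Z A A' a \<delta>))"
    by (simp add: eq ext_simps)
  also have "\<dots> = pull C E Z Z' A c' \<delta>" by (simp add: push_push[OF a(3)] 2)
  finally have eq': "push C E Z' A' A a' \<delta>' = pull C E Z Z' A c' \<delta>" .
  obtain b where b: "b \<in> Mor IC (B, e) (B', e')"
    "Comp C A B B' b x = Comp C A A' B' x' a" "Comp C B B' Z' y' b = Comp C B Z Z' c y"
    by (rule retract_morphism[OF RR RR' a(1) c(1) eq])
  obtain b' where b': "b' \<in> Mor IC (B', e') (B, e)"
    "Comp C A' B' B b' x' = Comp C A' A B x a'" "Comp C B' B Z y b' = Comp C B' Z' Z c' y'"
    by (rule retract_morphism[OF RR' RR a(2) c(2) eq'])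
  note [simp] = b(1)[unfolded completion_simps] b'(1)[unfolded completion_simps]
  interpret I: additive_category IC by (rule additive_completion)
  have Ob: "(B, e) \<in> Ob IC" "(B', e') \<in> Ob IC" using RR RR' by (auto simp: retract_realises_def)
  have bb: "Comp C B B' B b' b \<in> Mor IC (B, e) (B, e)" "Comp C B' B B' b b' \<in> Mor IC (B', e') (B', e')"
    using I.Comp_mor[OF Ob(1) Ob(2) Ob(1) b(1) b'(1)] I.Comp_mor[OF Ob(2) Ob(1) Ob(2) b'(1) b(1)]
    by (simp_all only: completion_Comp)
  obtain n where n: "n \<in> Mor IC (B, e) (B, e)" "Comp C B B B n (Comp C B B' B b' b) = e"
    by (rule retract_automorphism[OF RR bb(1)])
      (simp_all add: additive_simps b b' b(3)[THEN Comp_extend] b'(2,3)[THEN Comp_extend] a c 2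
        c(3)[THEN Comp_extend])
  obtain m where m: "m \<in> Mor IC (B', e') (B', e')" "Comp C B' B' B' (Comp C B' B B' b b') m = e'"
    by (rule retract_automorphism[OF RR' bb(2)])
      (simp_all add: additive_simps b b' b(2,3)[THEN Comp_extend] b'(3)[THEN Comp_extend] a c 4
        c(4)[THEN Comp_extend])
  note [simp] = n(1)[unfolded completion_simps] m(1)[unfolded completion_simps]
  have eb': "Comp C B' B B e b' = b'" and en: "Comp C B B B e n = n" by simp_all
  have bm: "Comp C B' B B' b (Comp C B' B' B b' m) = e'" using m(2) by (simp add: additive_simps)
  have nb: "Comp C B B' B (Comp C B' B B n b') b = e" using n(2) by (simp add: additive_simps)
  \<comment> \<open>\<open>b\<close> has the left inverse \<open>n b'\<close> and the right inverse
    \<open>b' m\<close>; the usual comparison identifies the two.\<close>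
  have "Comp C B' B B n b' = Comp C B' B' B (Comp C B' B B n b') (Comp C B' B B' b (Comp C B' B' B b' m))"
    by (simp add: bm) (simp add: additive_simps)
  also have "\<dots> = Comp C B' B B (Comp C B B' B (Comp C B' B B n b') b) (Comp C B' B' B b' m)"
    by (simp add: additive_simps)
  also have "\<dots> = Comp C B' B' B b' m" by (simp add: nb) (simp add: additive_simps eb'[THEN Comp_extend])
  finally have "Comp C B' B B' b (Comp C B' B B n b') = e'" using bm by simp
  then show ?thesis
    using that[of b "Comp C B' B B n b'"] b nb
    by (simp add: completion_simps additive_simps en[THEN Comp_extend])
qed

text \<open>The octahedron is formed in \<open>C\<close> on the ambient middle term
  \<open>B\<^sub>0\<close> of the first sequence. The given \<open>(X, \<xi>)\<close> is matched
  with the retract of the octahedron's own middle term \<open>X\<^sub>0\<close> by uniqueness of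
  realising retracts.\<close>

lemma retract_ET4:
  assumes RR: "RR (D, d) (A, p) \<delta> f (B, q) f'" and RR': "RR (F, s) (B, q) \<delta>' g (X, \<xi>) g'"
  obtains Y c h' u v \<delta>'' where "(Y, c) \<in> Ob IC"
    "h' \<in> Mor IC (X, \<xi>) (Y, c)" "u \<in> Mor IC (D, d) (Y, c)" "v \<in> Mor IC (Y, c) (F, s)"
    "\<delta>'' \<in> Ext FE (Y, c) (A, p)"
    "Comp C B X Y h' g = Comp C B D Y u f'" "Comp C X Y F v h' = g'"
    "RR (Y, c) (A, p) \<delta>'' (Comp C A B X g f) (X, \<xi>) h'"
    "RR (F, s) (D, d) (push C E F B D f' \<delta>') u (Y, c) v"
    "pull C E Y D A u \<delta>'' = \<delta>" "push C E Y A B f \<delta>'' = pull C E F Y B v \<delta>'"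
proof -
  have ob: "(D, d) \<in> Ob IC" "(A, p) \<in> Ob IC" "(F, s) \<in> Ob IC" "(B, q) \<in> Ob IC" "(X, \<xi>) \<in> Ob IC"
    using RR RR' by (auto simp: retract_realises_def)
  obtain x\<^sub>0 B\<^sub>0 y\<^sub>0 i j where R: "R D A \<delta> x\<^sub>0 B\<^sub>0 y\<^sub>0" and 1:
    "D \<in> Ob C" "A \<in> Ob C" "\<delta> \<in> Ext E D A" "B\<^sub>0 \<in> Ob C" "x\<^sub>0 \<in> Mor C A B\<^sub>0" "y\<^sub>0 \<in> Mor C B\<^sub>0 D"
    "B \<in> Ob C" "p \<in> Mor C A A" "d \<in> Mor C D D" "q \<in> Mor C B B" and
    pd: "Comp C A A A p p = p" "Comp C D D D d d = d" and qq: "Comp C B B B q q = q" and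
    \<delta>: "push C E D A A p \<delta> = \<delta>" "pull C E D D A d \<delta> = \<delta>" and 2:
    "f \<in> Mor C A B" "f' \<in> Mor C B D" and 3:
    "Comp C A A B f p = f" "Comp C A B B q f = f" "Comp C B B D f' q = f'" "Comp C B D D d f' = f'"
    and [simp]: "i \<in> Mor C B B\<^sub>0" "j \<in> Mor C B\<^sub>0 B" and ij:
    "Comp C B B B\<^sub>0 i q = i" "Comp C B\<^sub>0 B B q j = j" "Comp C B B\<^sub>0 B j i = q"
    "Comp C A B\<^sub>0 B j x\<^sub>0 = f" "Comp C A B B\<^sub>0 i f = Comp C A A B\<^sub>0 x\<^sub>0 p"
    "Comp C B B\<^sub>0 D y\<^sub>0 i = f'" "Comp C B\<^sub>0 B D f' j = Comp C B\<^sub>0 D D d y\<^sub>0"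
    by (rule retract_E[OF RR])
  obtain x\<^sub>1 B\<^sub>1 y\<^sub>1 i' j' where 4:
    "F \<in> Ob C" "B \<in> Ob C" "\<delta>' \<in> Ext E F B" "X \<in> Ob C" "s \<in> Mor C F F" "\<xi> \<in> Mor C X X" and
    s: "Comp C F F F s s = s" and \<xi>: "Comp C X X X \<xi> \<xi> = \<xi>" and
    \<delta>': "push C E F B B q \<delta>' = \<delta>'" "pull C E F F B s \<delta>' = \<delta>'" and 5:
    "g \<in> Mor C B X" "g' \<in> Mor C X F" and 6:
    "Comp C B B X g q = g" "Comp C B X X \<xi> g = g" "Comp C X X F g' \<xi> = g'" "Comp C X F F s g' = g'"
    by (rule retract_E[OF RR'])
  note [simp] = 1 2 4 5
  note eqs = additive_simps pd pd[THEN Comp_extend] qq qq[THEN Comp_extend] 3 3[THEN Comp_extend]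
    ij ij[THEN Comp_extend] s s[THEN Comp_extend] 6 6[THEN Comp_extend]

  \<comment> \<open>\<open>i\<close> and \<open>j\<close> are inverse isomorphisms between
    \<open>(B, q)\<close> and \<open>(B\<^sub>0, e)\<close>; \<open>\<delta>\<^sub>0\<close> is
    \<open>\<delta>'\<close> carried along \<open>i\<close>, so that both extensions meet in one
    object of \<open>C\<close>.\<close>
  define e where "e = Comp C B\<^sub>0 B B\<^sub>0 i j"
  define \<delta>\<^sub>0 where "\<delta>\<^sub>0 = push C E F B B\<^sub>0 i \<delta>'"
  have [simp]: "e \<in> Mor C B\<^sub>0 B\<^sub>0" "\<delta>\<^sub>0 \<in> Ext E F B\<^sub>0" by (simp_all add: e_def \<delta>\<^sub>0_def ext_simps)
  have ee: "Comp C B\<^sub>0 B\<^sub>0 B\<^sub>0 e e = e" and ex: "Comp C A B\<^sub>0 B\<^sub>0 e x\<^sub>0 = Comp C A A B\<^sub>0 x\<^sub>0 p"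
    and ye: "Comp C B\<^sub>0 B\<^sub>0 D y\<^sub>0 e = Comp C B\<^sub>0 D D d y\<^sub>0"
    by (simp_all add: e_def eqs)
  have j\<delta>\<^sub>0: "push C E F B\<^sub>0 B j \<delta>\<^sub>0 = \<delta>'"
    by (simp add: \<delta>\<^sub>0_def push_push[OF ij(3)] \<delta>')
  have e\<delta>\<^sub>0: "push C E F B\<^sub>0 B\<^sub>0 e \<delta>\<^sub>0 = \<delta>\<^sub>0"
    unfolding e_def by (simp add: push_Comp j\<delta>\<^sub>0 flip: \<delta>\<^sub>0_def)
  have s\<delta>\<^sub>0: "pull C E F F B\<^sub>0 s \<delta>\<^sub>0 = \<delta>\<^sub>0"
    by (simp add: \<delta>\<^sub>0_def pull_push \<delta>')

  obtain X\<^sub>0 g\<^sub>0 g\<^sub>0' r Y h' u v c t \<delta>'' where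
    R': "R F B\<^sub>0 \<delta>\<^sub>0 g\<^sub>0 X\<^sub>0 g\<^sub>0'" and R'': "R Y A \<delta>'' (Comp C A B\<^sub>0 X\<^sub>0 g\<^sub>0 x\<^sub>0) X\<^sub>0 h'"
    and R3: "R F D (push C E F B\<^sub>0 D y\<^sub>0 \<delta>\<^sub>0) u Y v"
    and r: "r \<in> Mor C X\<^sub>0 X\<^sub>0" "Comp C X\<^sub>0 X\<^sub>0 X\<^sub>0 r r = r" and c: "c \<in> Mor C Y Y" "Comp C Y Y Y c c = c"
    and t: "t \<in> Mor C Y Y" "Comp C Y Y Y t t = t"
    and rg: "Comp C B\<^sub>0 X\<^sub>0 X\<^sub>0 r g\<^sub>0 = Comp C B\<^sub>0 B\<^sub>0 X\<^sub>0 g\<^sub>0 e"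
    and g'r: "Comp C X\<^sub>0 X\<^sub>0 F g\<^sub>0' r = Comp C X\<^sub>0 F F s g\<^sub>0'"
    and ch': "Comp C X\<^sub>0 Y Y c h' = Comp C X\<^sub>0 X\<^sub>0 Y h' r"
    and \<delta>'': "push C E Y A A p \<delta>'' = \<delta>''" "pull C E Y Y A c \<delta>'' = \<delta>''"
    and oct: "Comp C B\<^sub>0 X\<^sub>0 Y h' g\<^sub>0 = Comp C B\<^sub>0 D Y u y\<^sub>0" "Comp C X\<^sub>0 Y F v h' = g\<^sub>0'"
    and oct': "pull C E Y D A u \<delta>'' = \<delta>" "push C E Y A B\<^sub>0 x\<^sub>0 \<delta>'' = pull C E F Y B\<^sub>0 v \<delta>\<^sub>0"
    and tu: "Comp C D Y Y t u = Comp C D D Y u d" and vt: "Comp C Y Y F v t = Comp C Y F F s v"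
    and vc: "Comp C Y Y F v c = Comp C Y F F s v"
    and ct: "Comp C Y Y Y c t = c" "Comp C Y Y Y t c = t"
    by (rule octahedron_idempotents[OF R \<open>F \<in> Ob C\<close> \<open>\<delta>\<^sub>0 \<in> Ext E F B\<^sub>0\<close> \<open>p \<in> Mor C A A\<close> pd(1) \<delta>(1)
          \<open>d \<in> Mor C D D\<close> pd(2) \<delta>(2) \<open>e \<in> Mor C B\<^sub>0 B\<^sub>0\<close> ee e\<delta>\<^sub>0 \<open>s \<in> Mor C F F\<close> s s\<delta>\<^sub>0 ex ye])
  have [simp]: "X\<^sub>0 \<in> Ob C" "g\<^sub>0 \<in> Mor C B\<^sub>0 X\<^sub>0" "g\<^sub>0' \<in> Mor C X\<^sub>0 F" "Y \<in> Ob C" "h' \<in> Mor C X\<^sub>0 Y"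
    "\<delta>'' \<in> Ext E Y A" "u \<in> Mor C D Y" "v \<in> Mor C Y F"
    using R_closed[OF R'] R_closed[OF R''] R_closed[OF R3] by auto
  note [simp] = r(1) c(1) t(1)
  have RR0: "RR (F, s) (B\<^sub>0, e) \<delta>\<^sub>0 (Comp C B\<^sub>0 B\<^sub>0 X\<^sub>0 g\<^sub>0 e) (X\<^sub>0, r) (Comp C X\<^sub>0 F F s g\<^sub>0')"
    by (rule retract_standard[OF R' _ ee e\<delta>\<^sub>0 _ s s\<delta>\<^sub>0 r rg g'r]) simp_all
  \<comment> \<open>The two retracts realise \<open>\<delta>\<^sub>0\<close> and
    \<open>\<delta>'\<close>, which correspond under the isomorphism \<open>j\<close> of the first
    ends and the identity \<open>s\<close> of \<open>(F, s)\<close>.\<close>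
  obtain k k' where k: "k \<in> Mor IC (X\<^sub>0, r) (X, \<xi>)" and k': "k' \<in> Mor IC (X, \<xi>) (X\<^sub>0, r)"
    and kk: "Comp C X\<^sub>0 X X\<^sub>0 k' k = r" "Comp C X X\<^sub>0 X k k' = \<xi>"
    and kg: "Comp C B\<^sub>0 X\<^sub>0 X k (Comp C B\<^sub>0 B\<^sub>0 X\<^sub>0 g\<^sub>0 e) = Comp C B\<^sub>0 B X g j"
    and g'k: "Comp C X\<^sub>0 X F g' k = Comp C X\<^sub>0 F F s (Comp C X\<^sub>0 F F s g\<^sub>0')"
    by (rule retract_isomorphism[OF RR0 RR', of j i s s])
      (simp_all add: completion_simps eqs e_def j\<delta>\<^sub>0 \<delta>')
  note [simp] = k[unfolded completion_simps] k'[unfolded completion_simps]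
  have rk': "Comp C X X\<^sub>0 X\<^sub>0 r k' = k'" by simp
  have kr: "Comp C X\<^sub>0 X\<^sub>0 X k r = k" by simp
  have kg\<^sub>0: "Comp C B\<^sub>0 X\<^sub>0 X k g\<^sub>0 = Comp C B\<^sub>0 B X g j"
  proof -
    have "Comp C B\<^sub>0 X\<^sub>0 X k g\<^sub>0 = Comp C B\<^sub>0 X\<^sub>0 X k (Comp C B\<^sub>0 X\<^sub>0 X\<^sub>0 r g\<^sub>0)"
      by (subst Comp_extend[OF kr]) simp_all
    then show ?thesis using kg rg by simp
  qed
  have k'g: "Comp C B X X\<^sub>0 k' g = Comp C B B\<^sub>0 X\<^sub>0 g\<^sub>0 i"
  proof -
    have "Comp C B X X\<^sub>0 k' g = Comp C B X X\<^sub>0 k' (Comp C B B\<^sub>0 X (Comp C B\<^sub>0 X\<^sub>0 X k g\<^sub>0) i)"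
      by (simp add: kg\<^sub>0 eqs)
    also have "\<dots> = Comp C B B\<^sub>0 X\<^sub>0 (Comp C B\<^sub>0 X\<^sub>0 X\<^sub>0 r g\<^sub>0) i"
      by (simp add: additive_simps kk(1)[THEN Comp_extend])
    also have "\<dots> = Comp C B B\<^sub>0 X\<^sub>0 g\<^sub>0 i" by (simp add: rg e_def eqs)
    finally show ?thesis .
  qed
  have g'k': "Comp C X X\<^sub>0 F g\<^sub>0' k' = g'"
  proof -
    have "Comp C X X\<^sub>0 F g\<^sub>0' k' = Comp C X X\<^sub>0 F (Comp C X\<^sub>0 X\<^sub>0 F g\<^sub>0' r) k'"
      by (simp add: additive_simps)
    also have "\<dots> = Comp C X X\<^sub>0 F (Comp C X\<^sub>0 X F g' k) k'"
      by (simp add: g'k g'r eqs)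
    also have "\<dots> = g'" by (simp add: additive_simps kk(2) 6)
    finally show ?thesis .
  qed

  define hh where "hh = Comp C X X\<^sub>0 Y h' k'"
  define uu where "uu = Comp C D Y Y c (Comp C D D Y u d)"
  define vv where "vv = Comp C Y F F s v"
  have [simp]: "hh \<in> Mor C X Y" "uu \<in> Mor C D Y" "vv \<in> Mor C Y F"
    by (simp_all add: hh_def uu_def vv_def additive_simps)
  note eqs' = eqs c(2) c(2)[THEN Comp_extend] t(2) t(2)[THEN Comp_extend] ch' ch'[THEN Comp_extend]
    tu tu[THEN Comp_extend] vt vt[THEN Comp_extend] vc vc[THEN Comp_extend] ct ct[THEN Comp_extend]
    g'k' k'g k'g[THEN Comp_extend] kg\<^sub>0[THEN Comp_extend] kg\<^sub>0 kk kk[THEN Comp_extend]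
    rk' rk'[THEN Comp_extend] oct(2) oct(2)[THEN Comp_extend]
  \<comment> \<open>The relation \<open>c = c t\<close> replaces a direct compatibility of
    \<open>c\<close> with \<open>u\<close>: it gives \<open>c u = c t u = c u d\<close>.\<close>
  have cu: "Comp C D Y Y c u = uu"
  proof -
    have "Comp C D Y Y c u = Comp C D Y Y (Comp C Y Y Y c t) u" by (simp only: ct)
    also have "\<dots> = uu" unfolding uu_def by (subst Comp_assoc) (simp_all add: tu)
    finally show ?thesis .
  qed
  show ?thesis
  proof (rule that[of Y c hh uu vv \<delta>''])
    show Yc: "(Y, c) \<in> Ob IC" by (simp add: completion_simps c)
    show "hh \<in> Mor IC (X, \<xi>) (Y, c)"
      by (simp add: completion_simps hh_def eqs')
    show "uu \<in> Mor IC (D, d) (Y, c)"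
      by (simp add: completion_simps uu_def eqs')
    show "vv \<in> Mor IC (Y, c) (F, s)"
      by (simp add: completion_simps vv_def eqs')
    show \<delta>''_Ext: "\<delta>'' \<in> Ext FE (Y, c) (A, p)"
      by (simp add: ext_completion_simps \<delta>'')
    show "Comp C B X Y hh g = Comp C B D Y uu f'"
    proof -
      have "Comp C B X Y hh g = Comp C B B\<^sub>0 Y (Comp C B\<^sub>0 X\<^sub>0 Y h' g\<^sub>0) i"
        by (simp add: hh_def additive_simps k'g)
      also have "\<dots> = Comp C B D Y u f'" unfolding oct by (simp add: additive_simps ij)
      finally have 1: "Comp C B X Y hh g = Comp C B D Y u f'" .
      have "Comp C B D Y uu f' = Comp C B Y Y c (Comp C B D Y u f')"
        unfolding cu[symmetric] by (simp add: additive_simps)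
      also have "\<dots> = Comp C B X Y (Comp C X Y Y c hh) g" unfolding 1[symmetric] by (simp add: additive_simps)
      also have "\<dots> = Comp C B X Y hh g" by (simp add: hh_def eqs')
      finally show ?thesis by simp
    qed
    show "Comp C X Y F vv hh = g'"
      by (simp add: vv_def hh_def eqs')
    \<comment> \<open>The comparison isomorphisms \<open>k'\<close> and \<open>k\<close> serve as
      inclusion and projection.\<close>
    show "RR (Y, c) (A, p) \<delta>'' (Comp C A B X g f) (X, \<xi>) hh"
      by (rule retract_realisesI[where R = R, OF Yc ob(2,5) \<delta>''_Ext R'', of k' k])
        (simp_all add: hh_def eqs')
    have "push C E F B D f' \<delta>' = push C E F B\<^sub>0 D y\<^sub>0 \<delta>\<^sub>0"
      by (simp add: \<delta>\<^sub>0_def push_push[OF ij(6)])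
    moreover have "push C E F B D f' \<delta>' \<in> Ext FE (F, s) (D, d)"
      by (simp add: ext_completion_simps push_closed push_push[OF 3(4)] pull_push \<delta>')
    \<comment> \<open>The inclusion is \<open>t\<close> and the projection is \<open>c\<close>:
      \<open>t c = t\<close> and \<open>c t = c\<close> are the retract conditions, while
      \<open>t u = u d\<close> and \<open>v t = s v\<close> fit \<open>t\<close> to the pushout
      sequence.\<close>
    ultimately show "RR (F, s) (D, d) (push C E F B D f' \<delta>') uu (Y, c) vv"
      by (intro retract_realisesI[where R = R, OF ob(3,1) Yc _ _ t(1) c(1)])
       (use R3 cu in \<open>simp_all add: uu_def vv_def eqs'\<close>)
    show "pull C E Y D A uu \<delta>'' = \<delta>"
      by (simp add: uu_def pull_Comp additive_simps \<delta>'' oct' \<delta>)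
    have "push C E Y A B f \<delta>'' = push C E Y B\<^sub>0 B j (push C E Y A B\<^sub>0 x\<^sub>0 \<delta>'')"
      by (simp add: push_push[OF ij(4)])
    also have "\<dots> = pull C E F Y B v \<delta>'" by (simp add: oct' pull_push[symmetric] j\<delta>\<^sub>0)
    also have "\<dots> = pull C E F Y B vv \<delta>'" by (simp add: vv_def pull_Comp \<delta>')
    finally show "push C E Y A B f \<delta>'' = pull C E F Y B vv \<delta>'" .
  qed
qed

end

section \<open>Opposite categories\<close>

definition opposite :: "('o, 'm) category_data \<Rightarrow> ('o, 'm) category_data" where
  "opposite C =
    \<lparr> Ob = Ob C, Hom = (\<lambda>A B. Hom C B A), Ident = Ident C,
      Comp = (\<lambda>X Y Z g f. Comp C Z Y X f g), DSum = DSum C,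
      In1 = Pr1 C, In2 = Pr2 C, Pr1 = In1 C, Pr2 = In2 C \<rparr>"

definition opposite_ext :: "('o, 'm, 'e) bifunctor_data \<Rightarrow> ('o, 'm, 'e) bifunctor_data" where
  "opposite_ext E =
    \<lparr> EGrp = (\<lambda>Z A. EGrp E A Z), EMap = (\<lambda>Z A Z' A' c a. EMap E A Z A' Z' a c) \<rparr>"

lemma opposite_simps:
  "Ob (opposite C) = Ob C" "Hom (opposite C) A B = Hom C B A" "Ident (opposite C) = Ident C"
  "Comp (opposite C) X Y Z g f = Comp C Z Y X f g" "DSum (opposite C) = DSum C"
  "In1 (opposite C) = Pr1 C" "In2 (opposite C) = Pr2 C"
  "Pr1 (opposite C) = In1 C" "Pr2 (opposite C) = In2 C"
  "EGrp (opposite_ext E) Z A = EGrp E A Z"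
  "EMap (opposite_ext E) Z A Z' A' c a = EMap E A Z A' Z' a c"
  "push (opposite C) (opposite_ext E) Z A A' a = pull C E A A' Z a"
  "pull (opposite C) (opposite_ext E) Z Z' A c = push C E A Z Z' c"
  by (simp_all add: opposite_def opposite_ext_def push_def pull_def fun_eq_iff)

lemma opposite_completion_simps:
  "(A, p) \<in> Ob (idempotent_completion (opposite C)) \<longleftrightarrow> (A, p) \<in> Ob (idempotent_completion C)"
  "f \<in> Mor (idempotent_completion (opposite C)) (A, p) (B, q)
    \<longleftrightarrow> f \<in> Mor (idempotent_completion C) (B, q) (A, p)"
  "\<delta> \<in> Ext (ext_completion (opposite C) (opposite_ext E)) (Z, r) (A, p)
    \<longleftrightarrow> \<delta> \<in> Ext (ext_completion C E) (A, p) (Z, r)"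
  by (auto simp: completion_simps ext_completion_simps opposite_simps)

lemma retract_realises_opposite:
  "retract_realises (opposite C) (opposite_ext E) (\<lambda>Z A \<delta> x B y. R A Z \<delta> y B x)
      (Z, r) (A, p) \<delta> x (B, e) y
    \<longleftrightarrow> retract_realises C E R (A, p) (Z, r) \<delta> y (B, e) x"
  unfolding retract_realises_def split_conv opposite_completion_simps opposite_simps by blast

lemma (in additive_category) additive_opposite: "additive_category (opposite C)"
proof -
  have "category (opposite C)"
    by unfold_locales (simp_all add: opposite_simps cat_simps)
  moreover obtain N where "zero_object C N" using zero_object_exists by blast
  then have "zero_object (opposite C) N" by (simp add: zero_object_def opposite_simps)
  then have "\<exists>N. zero_object (opposite C) N" ..
  ultimately show ?thesis
    by (intro additive_category.intro additive_category_axioms.intro)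
      (simp_all add: opposite_simps Hom_group additive_simps dsum_simps In_Pr_add)
qed

lemma (in biadditive_functor) biadditive_opposite:
  "biadditive_functor (opposite C) (opposite_ext E)"
  by (intro biadditive_functor.intro additive_opposite biadditive_functor_axioms.intro)
    (simp_all add: opposite_simps EGrp_group EMap_hom EMap_Ident EMap_Comp push_add pull_add)

text \<open>The locale axioms other than \<open>R_ET3\<close> and \<open>R_ET4\<close> are self-dual
  or come in dual pairs, so only the duals of these two are left as hypotheses.\<close>

lemma (in octahedral_category) octahedral_opposite:
  assumes ET3_op: "\<And>Z A \<delta> x B y Z' A' \<delta>' x' B' y' b c. \<lbrakk>R Z A \<delta> x B y; R Z' A' \<delta>' x' B' y';
        b \<in> Mor C B B'; c \<in> Mor C Z Z'; Comp C B Z Z' c y = Comp C B B' Z' y' b\<rbrakk>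
      \<Longrightarrow> \<exists>a\<in>Mor C A A'. push C E Z A A' a \<delta> = pull C E Z' Z A' c \<delta>' \<and>
            Comp C A B B' b x = Comp C A A' B' x' a"
    and ET4_op: "\<And>B D \<delta> f' A f X F \<delta>' g' g. \<lbrakk>R B D \<delta> f' A f; R X F \<delta>' g' B g\<rbrakk>
      \<Longrightarrow> \<exists>Y h' d e \<delta>''. Y \<in> Ob C \<and> h' \<in> Mor C Y A \<and> d \<in> Mor C D Y \<and> e \<in> Mor C Y F \<and>
            \<delta>'' \<in> Ext E X Y \<and>
            Comp C D Y A h' d = f' \<and> Comp C Y A B f h' = Comp C Y F B g' e \<and>
            R X Y \<delta>'' h' A (Comp C A B X g f) \<and> R F D (pull C E B F D g' \<delta>) d Y e \<and>
            push C E X Y F e \<delta>'' = \<delta>' \<and> push C E B D Y d \<delta> = pull C E X B Y g \<delta>''"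
  shows "octahedral_category (opposite C) (opposite_ext E) (\<lambda>Z A \<delta> x B y. R A Z \<delta> y B x)"
proof (intro octahedral_category.intro biadditive_opposite octahedral_category_axioms.intro, goal_cases)
  case (1 Z A \<delta> x B y) then show ?case using R_closed by (auto simp: opposite_simps)
next
  case (2 Z A \<delta>) then show ?case using R_exists[of A Z \<delta>] by (auto simp: opposite_simps)
next
  case (3 Z A \<delta> x B y) then show ?case by (simp add: opposite_simps R_Comp)
next
  case (4 Z A \<delta> x B y) then show ?case by (simp add: opposite_simps R_pull)
next
  case (5 Z A \<delta> x B y) then show ?case by (simp add: opposite_simps R_push)
next
  case (6 Z A \<delta> x B y W w) then show ?case
    using R_weak_kernel[of A Z \<delta> y B x W w] by (simp add: opposite_simps)
next
  case (7 Z A \<delta> x B y W w) then show ?case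
    using R_weak_cokernel[of A Z \<delta> y B x W w] by (simp add: opposite_simps)
next
  case (8 Z A \<delta> x B y W w) then show ?case
    using R_pull_zero[of A Z \<delta> y B x W w] by (simp add: opposite_simps)
next
  case (9 Z A \<delta> x B y W w) then show ?case
    using R_push_zero[of A Z \<delta> y B x W w] by (simp add: opposite_simps)
next
  case (10 Z A \<delta> x B y Z' A' \<delta>' x' B' y' a c)
  then obtain b where "b \<in> Mor C B' B"
    "Comp C Z' B' B b y' = Comp C Z' Z B y c" "Comp C B' B A x b = Comp C B' A' A a x'"
    using R_morphism[of A' Z' \<delta>' y' B' x' A Z \<delta> y B x c a] by (auto simp: opposite_simps)
  then show ?case by (auto simp: opposite_simps)
next
  case (11 Z A \<delta> x B y Z' A' \<delta>' x' B' y' a b)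
  then obtain c where "c \<in> Mor C Z' Z" "push C E A' Z' Z c \<delta>' = pull C E A A' Z a \<delta>"
    "Comp C Z' B' B b y' = Comp C Z' Z B y c"
    using ET3_op[of A' Z' \<delta>' y' B' x' A Z \<delta> y B x b a] by (auto simp: opposite_simps)
  then show ?case by (intro bexI[of _ c]) (simp_all add: opposite_simps)
next
  case (12 D A \<delta> f B f' F \<delta>' g X g')
  obtain Y h' d e \<delta>'' where "Y \<in> Ob C \<and> h' \<in> Mor C Y X \<and> d \<in> Mor C F Y \<and> e \<in> Mor C Y D \<and>
      \<delta>'' \<in> Ext E A Y \<and> Comp C F Y X h' d = g' \<and> Comp C Y X B g h' = Comp C Y D B f' e \<and>
      R A Y \<delta>'' h' X (Comp C X B A f g) \<and> R D F (pull C E B D F f' \<delta>') d Y e \<and>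
      push C E A Y D e \<delta>'' = \<delta> \<and> push C E B F Y d \<delta>' = pull C E A B Y f \<delta>''"
    using ET4_op[OF 12(2) 12(1)] by blast
  then show ?case
    by (intro exI[of _ Y] exI[of _ h'] exI[of _ d] exI[of _ e] exI[of _ \<delta>''])
      (simp add: opposite_simps)
qed

section \<open>Exactness of realising sequences\<close>

context category
begin

lemma isomorphism_Ident: "A \<in> Ob C \<Longrightarrow> isomorphism C A A (Ident C A)"
  unfolding isomorphism_def using cat_simps by metis

lemma seq_class_self:
  assumes "A \<in> Ob C" "Z \<in> Ob C" "(x, B, y) \<in> seqs C A Z"
  shows "(x, B, y) \<in> seq_class C A Z x B y"
  using assms isomorphism_Ident
  by (auto simp: seq_class_def seq_equiv_def seqs_def cat_simps intro!: exI[of _ "Ident C B"])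

end

context extriangulated_category
begin

text \<open>\<open>realises\<close> does not say that \<open>Z\<close> and \<open>A\<close> are
  objects or that \<open>\<delta>\<close> is an extension; bundling this makes
  \<open>R_closed\<close> hold.\<close>

definition realises_ext where
  "realises_ext Z A \<delta> x B y \<longleftrightarrow>
    Z \<in> Ob C \<and> A \<in> Ob C \<and> \<delta> \<in> Ext E Z A \<and> realises C \<ss> Z A \<delta> x B y"

lemma realises_extD:
  assumes "realises_ext Z A \<delta> x B y"
  shows "Z \<in> Ob C" "A \<in> Ob C" "\<delta> \<in> Ext E Z A" "realises C \<ss> Z A \<delta> x B y"
    "B \<in> Ob C" "x \<in> Mor C A B" "y \<in> Mor C B Z"
  using assms by (auto simp: realises_ext_def realises_def seqs_def)

lemma realises_ext_zero:
  "\<lbrakk>Z \<in> Ob C; A \<in> Ob C\<rbrakk> \<Longrightarrow>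
    realises_ext Z A \<one>\<^bsub>EGrp E Z A\<^esub> (In1 C A Z) (DSum C A Z) (Pr2 C A Z)"
  by (simp add: realises_ext_def realises_def seqs_def realisation_zero ext_zero_closed dsum_simps)

lemma realises_ext_exists:
  assumes "Z \<in> Ob C" "A \<in> Ob C" "\<delta> \<in> Ext E Z A"
  shows "\<exists>x B y. realises_ext Z A \<delta> x B y"
proof -
  obtain x B y where "(x, B, y) \<in> seqs C A Z" "\<ss> Z A \<delta> = seq_class C A Z x B y"
    using realisation_class[OF assms] by (auto simp: quotient_def seq_class_def)
  then show ?thesis using assms by (auto simp: realises_ext_def realises_def)
qed

lemma realises_ext_morphism:
  assumes R: "realises_ext Z A \<delta> x B y" "realises_ext Z' A' \<delta>' x' B' y'"
    and "a \<in> Mor C A A'" "c \<in> Mor C Z Z'" "push C E Z A A' a \<delta> = pull C E Z' Z A' c \<delta>'"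
  shows "\<exists>b\<in>Mor C B B'. Comp C A B B' b x = Comp C A A' B' x' a \<and>
    Comp C B B' Z' y' b = Comp C B Z Z' c y"
  using realisation_morphism[OF realises_extD(1,2)[OF R(1)] realises_extD(1,2)[OF R(2)]
      realises_extD(3)[OF R(1)] realises_extD(3)[OF R(2)] realises_extD(4)[OF R(1)]
      realises_extD(4)[OF R(2)], of a c] assms(3-)
  by (auto simp: ext_morphism_def realises_morphism_def)

lemma realises_ext_ET3:
  assumes R: "realises_ext Z A \<delta> x B y" "realises_ext Z' A' \<delta>' x' B' y'"
    and "a \<in> Mor C A A'" "b \<in> Mor C B B'" "Comp C A B B' b x = Comp C A A' B' x' a"
  shows "\<exists>c\<in>Mor C Z Z'. push C E Z A A' a \<delta> = pull C E Z' Z A' c \<delta>' \<and>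
    Comp C B B' Z' y' b = Comp C B Z Z' c y"
  using ET3[OF realises_extD(1,2)[OF R(1)] realises_extD(1,2)[OF R(2)]
      realises_extD(3)[OF R(1)] realises_extD(3)[OF R(2)] realises_extD(4)[OF R(1)]
      realises_extD(4)[OF R(2)] assms(3-)]
  by (auto simp: ext_morphism_def realises_morphism_def)

lemma realises_ext_ET3_op:
  assumes R: "realises_ext Z A \<delta> x B y" "realises_ext Z' A' \<delta>' x' B' y'"
    and "b \<in> Mor C B B'" "c \<in> Mor C Z Z'" "Comp C B Z Z' c y = Comp C B B' Z' y' b"
  shows "\<exists>a\<in>Mor C A A'. push C E Z A A' a \<delta> = pull C E Z' Z A' c \<delta>' \<and>
    Comp C A B B' b x = Comp C A A' B' x' a"
  using ET3_op[OF realises_extD(1,2)[OF R(1)] realises_extD(1,2)[OF R(2)]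
      realises_extD(3)[OF R(1)] realises_extD(3)[OF R(2)] realises_extD(4)[OF R(1)]
      realises_extD(4)[OF R(2)] assms(3-)]
  by (auto simp: ext_morphism_def realises_morphism_def)

text \<open>
  The exactness properties are instances of the morphism axioms for the zero extensions in \<open>E(N, W)\<close>
  and \<open>E(W, N)\<close> with \<open>N\<close> a zero object.
\<close>

lemma octahedral: "octahedral_category C E realises_ext"
proof -
  obtain N where "zero_object C N" using zero_object_exists by blast
  then have N [simp]: "N \<in> Ob C" by (simp add: zero_object_def)
  note simps = ext_simps dsum_simps
  show ?thesis
  proof (intro octahedral_category.intro biadditive_functor_axioms octahedral_category_axioms.intro,
      goal_cases)
    case (1 Z A \<delta> x B y) then show ?case using realises_extD[OF 1] by blast
  next
    case (2 Z A \<delta>) then show ?case by (rule realises_ext_exists)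
  next
    \<comment> \<open>The pair \<open>(1, 0)\<close> is a morphism from the zero extension in
      \<open>E(N, A)\<close> to \<open>\<delta>\<close>. Its lift \<open>b\<close> factors
      \<open>x\<close> through the inclusion of \<open>A\<close>, and
      \<open>y b = 0\<close>.\<close>
    case (3 Z A \<delta> x B y)
    note [simp] = realises_extD[OF 3]
    obtain b where [simp]: "b \<in> Mor C (DSum C A N) B"
      and b: "Comp C A (DSum C A N) B b (In1 C A N) = x" "Comp C (DSum C A N) B Z y b = \<one>\<^bsub>Hom C (DSum C A N) Z\<^esub>"
      using realises_ext_morphism[OF realises_ext_zero[of N A] 3, of "Ident C A" "\<one>\<^bsub>Hom C N Z\<^esub>"]
      by (auto simp: simps)
    show ?case unfolding b(1)[symmetric] by (simp add: simps b(2)[THEN Comp_extend])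
  next
    case (4 Z A \<delta> x B y)
    note [simp] = realises_extD[OF 4]
    show ?case
      using realises_ext_ET3[OF 4 realises_ext_zero[of N B], of x "In1 C B N"] by (auto simp: simps)
  next
    case (5 Z A \<delta> x B y)
    note [simp] = realises_extD[OF 5]
    show ?case
      using realises_ext_ET3_op[OF realises_ext_zero[of B N] 5, of "Pr2 C N B" y] by (auto simp: simps)
  next
    \<comment> \<open>As \<open>w x = 0\<close>, \<open>w\<close> followed by the inclusion of
      \<open>W\<close> commutes with the zero morphism from \<open>A\<close> to \<open>N\<close>;
      (ET3) towards the split sequence on \<open>N\<close> and \<open>W\<close> yields the factor
      through \<open>y\<close>.\<close>
    case (6 Z A \<delta> x B y W w)
    note [simp] = realises_extD[OF 6(1)] 6(2-4)
    obtain c where "c \<in> Mor C Z W"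
      "Comp C B (DSum C N W) W (Pr2 C N W) (Comp C B W (DSum C N W) (In2 C N W) w) = Comp C B Z W c y"
      using realises_ext_ET3[OF 6(1) realises_ext_zero[of W N], of "\<one>\<^bsub>Hom C A N\<^esub>"
          "Comp C B W (DSum C N W) (In2 C N W) w"] by (auto simp: simps)
    then show ?case by (auto simp: simps)
  next
    case (7 Z A \<delta> x B y W w)
    note [simp] = realises_extD[OF 7(1)] 7(2-4)
    obtain a where "a \<in> Mor C W A"
      "Comp C W (DSum C W N) B (Comp C (DSum C W N) W B w (Pr1 C W N)) (In1 C W N) = Comp C W A B x a"
      using realises_ext_ET3_op[OF realises_ext_zero[of N W] 7(1),
          of "Comp C (DSum C W N) W B w (Pr1 C W N)" "\<one>\<^bsub>Hom C N Z\<^esub>"]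
      by (auto simp: simps 7(4)[THEN Comp_extend])
    then show ?case by (auto simp: simps)
  next
    \<comment> \<open>The lift of \<open>(a, 0)\<close> into the split sequence on \<open>W\<close>
      and \<open>N\<close> is projected back to \<open>W\<close>.\<close>
    case (8 Z A \<delta> x B y W a)
    note [simp] = realises_extD[OF 8(1)] 8(2-4)
    obtain b where [simp]: "b \<in> Mor C B (DSum C W N)"
      and b: "Comp C A B (DSum C W N) b x = Comp C A W (DSum C W N) (In1 C W N) a"
      using realises_ext_morphism[OF 8(1) realises_ext_zero[of N W], of a "\<one>\<^bsub>Hom C Z N\<^esub>"]
      by (auto simp: simps)
    show ?case
      by (rule bexI[of _ "Comp C B (DSum C W N) W (Pr1 C W N) b"]) (simp_all add: simps b)
  next
    case (9 Z A \<delta> x B y W c)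
    note [simp] = realises_extD[OF 9(1)] 9(2-4)
    obtain b where [simp]: "b \<in> Mor C (DSum C N W) B"
      and b: "Comp C (DSum C N W) B Z y b = Comp C (DSum C N W) W Z c (Pr2 C N W)"
      using realises_ext_morphism[OF realises_ext_zero[of W N] 9(1), of "\<one>\<^bsub>Hom C N A\<^esub>" c]
      by (auto simp: simps)
    show ?case
      by (rule bexI[of _ "Comp C W (DSum C N W) B b (In2 C N W)"])
        (simp_all add: simps b[THEN Comp_extend])
  next
    case (10 Z A \<delta> x B y Z' A' \<delta>' x' B' y' a c) then show ?case by (rule realises_ext_morphism)
  next
    case (11 Z A \<delta> x B y Z' A' \<delta>' x' B' y' a b) then show ?case by (rule realises_ext_ET3)
  next
    case (12 D A \<delta> f B f' F \<delta>' g X g')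
    note h = realises_extD[OF 12(1)] realises_extD[OF 12(2)]
    obtain Y h' d e \<delta>'' where "Y \<in> Ob C" "h' \<in> Mor C X Y" "d \<in> Mor C D Y" "e \<in> Mor C Y F"
      "Comp C B X Y h' g = Comp C B D Y d f'" "Comp C X Y F e h' = g'" "\<delta>'' \<in> Ext E Y A"
      "realises C \<ss> Y A \<delta>'' (Comp C A B X g f) X h'"
      "realises C \<ss> F D (push C E F B D f' \<delta>') d Y e" "pull C E Y D A d \<delta>'' = \<delta>"
      "push C E Y A B f \<delta>'' = pull C E F Y B e \<delta>'"
      using ET4[OF h(2,5,1) h(8,3,10,4,11)] by blast
    then show ?case
      using h by (intro exI[of _ Y] exI[of _ h'] exI[of _ d] exI[of _ e] exI[of _ \<delta>''])
        (simp add: realises_ext_def push_closed)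
  qed
qed

lemma octahedral_op:
  "octahedral_category (opposite C) (opposite_ext E) (\<lambda>Z A \<delta> x B y. realises_ext A Z \<delta> y B x)"
proof (rule octahedral_category.octahedral_opposite[OF octahedral realises_ext_ET3_op], assumption+)
  fix B D \<delta> f' A f X F \<delta>' g' g
  assume R: "realises_ext B D \<delta> f' A f" "realises_ext X F \<delta>' g' B g"
  note h = realises_extD[OF R(1)] realises_extD[OF R(2)]
  show "\<exists>Y h' d e \<delta>''. Y \<in> Ob C \<and> h' \<in> Mor C Y A \<and> d \<in> Mor C D Y \<and> e \<in> Mor C Y F \<and>
            \<delta>'' \<in> Ext E X Y \<and>
            Comp C D Y A h' d = f' \<and> Comp C Y A B f h' = Comp C Y F B g' e \<and>
            realises_ext X Y \<delta>'' h' A (Comp C A B X g f) \<and>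
            realises_ext F D (pull C E B F D g' \<delta>) d Y e \<and>
            push C E X Y F e \<delta>'' = \<delta>' \<and> push C E B D Y d \<delta> = pull C E X B Y g \<delta>''"
  proof -
    obtain Y d e h' \<delta>'' where "Y \<in> Ob C" "d \<in> Mor C D Y" "e \<in> Mor C Y F" "h' \<in> Mor C Y A"
      "Comp C D Y A h' d = f'" "Comp C Y A B f h' = Comp C Y F B g' e" "\<delta>'' \<in> Ext E X Y"
      "realises C \<ss> X Y \<delta>'' h' A (Comp C A B X g f)"
      "realises C \<ss> F D (pull C E B F D g' \<delta>) d Y e" "push C E X Y F e \<delta>'' = \<delta>'"
      "push C E B D Y d \<delta> = pull C E X B Y g \<delta>''"
      using ET4_op[OF h(1,2,9,8,3,10,4,11)] by blast
    then show ?thesis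
      using h by (intro exI[of _ Y] exI[of _ h'] exI[of _ d] exI[of _ e] exI[of _ \<delta>''])
        (simp add: realises_ext_def pull_closed)
  qed
qed

end

section \<open>The extriangulated structure of the completion\<close>

context biadditive_functor
begin

lemma EMap_EMap:
  "\<lbrakk>Comp C Z'' Z' Z c c' = k; Comp C A A' A'' a' a = m; Z \<in> Ob C; Z' \<in> Ob C; Z'' \<in> Ob C; A \<in> Ob C;
      A' \<in> Ob C; A'' \<in> Ob C; c \<in> Mor C Z' Z; c' \<in> Mor C Z'' Z'; a \<in> Mor C A A'; a' \<in> Mor C A' A'';
      \<delta> \<in> Ext E Z A\<rbrakk>
    \<Longrightarrow> EMap E Z' A' Z'' A'' c' a' (EMap E Z A Z' A' c a \<delta>) = EMap E Z A Z'' A'' k m \<delta>"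
  using EMap_Comp by metis

context
  fixes Z Z' A A'
  assumes ob [simp]: "Z \<in> Ob C" "Z' \<in> Ob C" "A \<in> Ob C" "A' \<in> Ob C"
begin

lemma EMap_add_right: "\<lbrakk>c \<in> Mor C Z' Z; a \<in> Mor C A A'; b \<in> Mor C A A'; \<delta> \<in> Ext E Z A\<rbrakk>
    \<Longrightarrow> EMap E Z A Z' A' c (a \<otimes>\<^bsub>Hom C A A'\<^esub> b) \<delta>
      = EMap E Z A Z' A' c a \<delta> \<otimes>\<^bsub>EGrp E Z' A'\<^esub> EMap E Z A Z' A' c b \<delta>"
  by (simp add: EMap_push_pull ext_simps)

lemma EMap_add_left: "\<lbrakk>c \<in> Mor C Z' Z; d \<in> Mor C Z' Z; a \<in> Mor C A A'; \<delta> \<in> Ext E Z A\<rbrakk>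
    \<Longrightarrow> EMap E Z A Z' A' (c \<otimes>\<^bsub>Hom C Z' Z\<^esub> d) a \<delta>
      = EMap E Z A Z' A' c a \<delta> \<otimes>\<^bsub>EGrp E Z' A'\<^esub> EMap E Z A Z' A' d a \<delta>"
  by (simp add: EMap_push_pull ext_simps) (simp add: push_def EMap_add pull_closed Ident_mor)

lemma EMap_zero_left: "\<lbrakk>a \<in> Mor C A A'; \<delta> \<in> Ext E Z A\<rbrakk>
    \<Longrightarrow> EMap E Z A Z' A' \<one>\<^bsub>Hom C Z' Z\<^esub> a \<delta> = \<one>\<^bsub>EGrp E Z' A'\<^esub>"
  by (simp add: EMap_push_pull ext_simps)

lemma EMap_zero_right: "\<lbrakk>c \<in> Mor C Z' Z; \<delta> \<in> Ext E Z A\<rbrakk>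
    \<Longrightarrow> EMap E Z A Z' A' c \<one>\<^bsub>Hom C A A'\<^esub> \<delta> = \<one>\<^bsub>EGrp E Z' A'\<^esub>"
  by (simp add: EMap_push_pull ext_simps)

end

text \<open>Replaces the definite description by a formula, in which direct sums in the completion
  can be compared with those in \<open>C\<close>.\<close>

lemma ext_sum_eq:
  fixes Z Z' A A' \<delta> \<delta>'
  defines "S \<equiv> DSum C Z Z'" and "T \<equiv> DSum C A A'"
  defines "\<eta> \<equiv> EMap E Z A S T (Pr1 C Z Z') (In1 C A A') \<delta>
    \<otimes>\<^bsub>EGrp E S T\<^esub> EMap E Z' A' S T (Pr2 C Z Z') (In2 C A A') \<delta>'"
  assumes ob [simp]: "Z \<in> Ob C" "Z' \<in> Ob C" "A \<in> Ob C" "A' \<in> Ob C"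
    and \<delta> [simp]: "\<delta> \<in> Ext E Z A" "\<delta>' \<in> Ext E Z' A'"
  shows "ext_sum C E Z A \<delta> Z' A' \<delta>' = \<eta>" and "\<eta> \<in> Ext E S T"
proof -
  note [simp] = dsum_simps and defs = S_def T_def \<eta>_def
  show \<eta> [simp]: "\<eta> \<in> Ext E S T" by (simp add: defs ext_add_closed EMap_closed)
  note e = EMap_add EMap_add_left EMap_add_right EMap_closed EMap_zero EMap_zero_left EMap_zero_right EMap_Ident Ident_mor
    ext_zero_left ext_zero_right ext_zero_closed zero_closed add_closed Comp_mor
  show "ext_sum C E Z A \<delta> Z' A' \<delta>' = \<eta>"
    unfolding ext_sum_def Let_def
  proof (rule the_equality, goal_cases)
    case 1 show ?case
      using \<eta> by (simp add: defs e EMap_EMap[OF refl refl])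
  next
    case (2 \<theta>)
    then have [simp]: "\<theta> \<in> Ext E (DSum C Z Z') (DSum C A A')" by simp
    \<comment> \<open>Expanding both identities into inclusion-projection composites writes a
      candidate \<open>\<theta>\<close> as a sum of four terms; the mixed ones vanish by
      hypothesis.\<close>
    have "\<theta> = EMap E (DSum C Z Z') (DSum C A A') (DSum C Z Z') (DSum C A A')
        (Ident C (DSum C Z Z')) (Ident C (DSum C A A')) \<theta>"
      by (simp add: EMap_Ident)
    also have "\<dots> = \<eta>"
      unfolding In_Pr_add[OF ob(1,2), symmetric] In_Pr_add[OF ob(3,4), symmetric]
      using 2 by (simp add: defs e EMap_Comp)
    finally show ?case .
  qed
qed

end

section \<open>Realising retracts as an equivalence class of sequences\<close>

context octahedral_category
begin

lemma retract_Ob: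
  assumes "RR (Z, r) (A, p) \<delta> x (B, e) y"
  shows "(Z, r) \<in> Ob IC" "(A, p) \<in> Ob IC" "(B, e) \<in> Ob IC" "\<delta> \<in> Ext FE (Z, r) (A, p)"
    "x \<in> Mor IC (A, p) (B, e)" "y \<in> Mor IC (B, e) (Z, r)"
proof -
  show "(Z, r) \<in> Ob IC" "(A, p) \<in> Ob IC" "(B, e) \<in> Ob IC" "\<delta> \<in> Ext FE (Z, r) (A, p)"
    using assms by (auto simp: retract_realises_def)
  show "x \<in> Mor IC (A, p) (B, e)" "y \<in> Mor IC (B, e) (Z, r)"
    by (rule retract_E[OF assms], simp add: completion_simps)+
qed

text \<open>The inclusion and the projection become \<open>i b'\<close> and \<open>b j\<close>.
  Hence realising retracts are closed under equivalence of sequences.\<close>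

lemma retract_transport:
  assumes RR: "RR (Z, r) (A, p) \<delta> x (B, e) y" and ob: "(B', e') \<in> Ob IC"
    and b: "b \<in> Mor IC (B, e) (B', e')" "b' \<in> Mor IC (B', e') (B, e)"
      "Comp C B B' B b' b = e" "Comp C B' B B' b b' = e'"
    and y': "y' \<in> Mor IC (B', e') (Z, r)" "Comp C B B' Z y' b = y"
  shows "RR (Z, r) (A, p) \<delta> (Comp C A B B' b x) (B', e') y'"
proof -
  obtain x\<^sub>0 B\<^sub>0 y\<^sub>0 i j where R: "R Z A \<delta> x\<^sub>0 B\<^sub>0 y\<^sub>0" and 1:
    "Z \<in> Ob C" "A \<in> Ob C" "\<delta> \<in> Ext E Z A" "B\<^sub>0 \<in> Ob C" "x\<^sub>0 \<in> Mor C A B\<^sub>0" "y\<^sub>0 \<in> Mor C B\<^sub>0 Z"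
    "B \<in> Ob C" "p \<in> Mor C A A" "r \<in> Mor C Z Z" "e \<in> Mor C B B"
    "x \<in> Mor C A B" "y \<in> Mor C B Z" "i \<in> Mor C B B\<^sub>0" "j \<in> Mor C B\<^sub>0 B" and 2:
    "Comp C A B B e x = x" "Comp C B B Z y e = y"
    "Comp C B B B\<^sub>0 i e = i" "Comp C B\<^sub>0 B B e j = j" "Comp C B B\<^sub>0 B j i = e"
    "Comp C A B\<^sub>0 B j x\<^sub>0 = x" "Comp C A B B\<^sub>0 i x = Comp C A A B\<^sub>0 x\<^sub>0 p"
    "Comp C B B\<^sub>0 Z y\<^sub>0 i = y" "Comp C B\<^sub>0 B Z y j = Comp C B\<^sub>0 Z Z r y\<^sub>0"
    by (rule retract_E[OF RR])
  note [simp] = 1 b(1,2)[unfolded completion_simps] y'(1)[unfolded completion_simps]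
    ob[unfolded completion_simps]
  have eb: "Comp C B' B B e b' = b'" "Comp C B B' B' e' b = b" by simp_all
  have yb': "Comp C B' B Z y b' = y'"
    unfolding y'(2)[symmetric] by (simp add: additive_simps b)
  note eqs = additive_simps 2 2[THEN Comp_extend] b(3,4) b(3,4)[THEN Comp_extend] y'(2)
    y'(2)[THEN Comp_extend] eb eb[THEN Comp_extend] yb'
  show ?thesis
    by (rule retract_realisesI[where R = R, OF retract_Ob(1,2)[OF RR] ob retract_Ob(4)[OF RR] R,
          of "Comp C B' B B\<^sub>0 i b'" "Comp C B\<^sub>0 B B' b j"])
      (simp_all add: eqs)
qed

end

context extriangulated_category
begin

sublocale octahedral_category C E realises_ext by (rule octahedral)

text \<open>An instance of \<open>retract_ET3\<close> in the opposite category; reversal exchanges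
  source and target, so the two sequences enter in the other order.\<close>

lemma retract_ET3_op:
  assumes RR: "RR (Z, r) (A, p) \<delta> x (B, e) y" and RR': "RR (Z', r') (A', p') \<delta>' x' (B', e') y'"
    and b: "b \<in> Mor IC (B, e) (B', e')" and c: "c \<in> Mor IC (Z, r) (Z', r')"
    and eq: "Comp C B Z Z' c y = Comp C B B' Z' y' b"
  obtains a where "a \<in> Mor IC (A, p) (A', p')"
    "push C E Z A A' a \<delta> = pull C E Z' Z A' c \<delta>'" "Comp C A B B' b x = Comp C A A' B' x' a"
proof -
  obtain a where "a \<in> Mor IC (A, p) (A', p')" "pull C E Z' Z A' c \<delta>' = push C E Z A A' a \<delta>"
    "Comp C A B B' b x = Comp C A A' B' x' a"
    by (rule octahedral_category.retract_ET3[OF octahedral_op, unfolded opposite_simps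
          opposite_completion_simps retract_realises_opposite, OF RR' RR c b eq[symmetric]])
  then show ?thesis using that by simp
qed

lemma retract_ET4_op:
  assumes RR: "RR (B, q) (D, d) \<delta> f' (A, p) f" and RR': "RR (X, \<xi>) (F, s) \<delta>' g' (B, q) g"
  obtains Y c h' u v \<delta>'' where "(Y, c) \<in> Ob IC"
    "h' \<in> Mor IC (Y, c) (A, p)" "u \<in> Mor IC (Y, c) (F, s)" "v \<in> Mor IC (D, d) (Y, c)"
    "\<delta>'' \<in> Ext FE (X, \<xi>) (Y, c)"
    "Comp C Y A B f h' = Comp C Y F B g' u" "Comp C D Y A h' v = f'"
    "RR (X, \<xi>) (Y, c) \<delta>'' h' (A, p) (Comp C A B X g f)"
    "RR (F, s) (D, d) (pull C E B F D g' \<delta>) v (Y, c) u"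
    "push C E X Y F u \<delta>'' = \<delta>'" "pull C E X B Y g \<delta>'' = push C E B D Y v \<delta>"
  by (rule octahedral_category.retract_ET4[OF octahedral_op, unfolded opposite_simps
        opposite_completion_simps retract_realises_opposite, OF RR' RR])

text \<open>Collecting all realising retracts avoids choosing a representative; that they form a
  single class is left to be proved.\<close>

definition completion_realisation where
  "completion_realisation Z A \<delta> = {(x, B, y). RR Z A \<delta> x B y}"

text \<open>Uniqueness over the identities \<open>p\<close> and \<open>r\<close> of the ends puts
  every realising retract into the class, and transport along isomorphisms fills the class.\<close>

lemma completion_realisation_class:
  assumes RR: "RR (Z, r) (A, p) \<delta> x (B, e) y"
  shows "completion_realisation (Z, r) (A, p) \<delta> = seq_class IC (A, p) (Z, r) x (B, e) y"
proof (rule Set.set_eqI)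
  fix t :: "'m \<times> ('o \<times> 'm) \<times> 'm"
  obtain x' B' e' y' where t: "t = (x', (B', e'), y')" by (metis prod.exhaust)
  note ob = retract_Ob[OF RR]
  note [simp] = ob(5,6)[unfolded completion_simps] ob(1-3)[unfolded completion_simps]
  show "t \<in> completion_realisation (Z, r) (A, p) \<delta> \<longleftrightarrow> t \<in> seq_class IC (A, p) (Z, r) x (B, e) y"
  proof
    assume "t \<in> completion_realisation (Z, r) (A, p) \<delta>"
    then have RR': "RR (Z, r) (A, p) \<delta> x' (B', e') y'" by (simp add: completion_realisation_def t)
    note ob' = retract_Ob[OF RR']
    note [simp] = ob'(4-6)[unfolded completion_simps ext_completion_simps]
    obtain b b' where b: "b \<in> Mor IC (B, e) (B', e')" "b' \<in> Mor IC (B', e') (B, e)"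
      "Comp C B B' B b' b = e" "Comp C B' B B' b b' = e'"
      "Comp C A B B' b x = Comp C A A B' x' p" "Comp C B B' Z y' b = Comp C B Z Z r y"
      by (rule retract_isomorphism[OF RR RR', of p p r r]) (simp_all add: completion_simps)
    have "isomorphism IC (B, e) (B', e') b"
      unfolding isomorphism_def completion_Comp completion_Ident using b(1-4) by blast
    moreover have "Comp C A B B' b x = x'" "Comp C B B' Z y' b = y" by (simp_all add: b)
    ultimately have "((x, (B, e), y), (x', (B', e'), y')) \<in> seq_equiv IC (A, p) (Z, r)"
      unfolding seq_equiv_def mem_Collect_eq split_conv completion_Comp
      using ob(3,5,6) ob'(3,5,6) by (intro conjI) (auto simp only: seqs_def mem_Collect_eq split_conv)
    then show "t \<in> seq_class IC (A, p) (Z, r) x (B, e) y" by (simp add: t seq_class_def)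
  next
    assume "t \<in> seq_class IC (A, p) (Z, r) x (B, e) y"
    then obtain b b' where b: "b \<in> Mor IC (B, e) (B', e')" "b' \<in> Mor IC (B', e') (B, e)"
      "Comp C B B' B b' b = e" "Comp C B' B B' b b' = e'"
      and x': "x' = Comp C A B B' b x" and y': "Comp C B B' Z y' b = y"
      and ob': "(B', e') \<in> Ob IC" "y' \<in> Mor IC (B', e') (Z, r)"
      unfolding t seq_class_def Image_singleton_iff seq_equiv_def mem_Collect_eq split_conv seqs_def
        isomorphism_def completion_Comp completion_Ident by blast
    have "RR (Z, r) (A, p) \<delta> x' (B', e') y'"
      unfolding x' by (rule retract_transport[OF RR ob'(1) b ob'(2) y'])
    then show "t \<in> completion_realisation (Z, r) (A, p) \<delta>"
      by (simp add: completion_realisation_def t)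
  qed
qed

lemma realises_completion_iff:
  assumes "(Z, r) \<in> Ob IC" "(A, p) \<in> Ob IC"
  shows "realises IC completion_realisation (Z, r) (A, p) \<delta> x (B, e) y
    \<longleftrightarrow> RR (Z, r) (A, p) \<delta> x (B, e) y"
proof
  interpret I: additive_category IC by (rule additive_completion)
  assume "realises IC completion_realisation (Z, r) (A, p) \<delta> x (B, e) y"
  then have "(x, (B, e), y) \<in> completion_realisation (Z, r) (A, p) \<delta>"
    using I.seq_class_self[OF assms(2,1)] by (simp add: realises_def)
  then show "RR (Z, r) (A, p) \<delta> x (B, e) y" by (simp add: completion_realisation_def)
next
  assume "RR (Z, r) (A, p) \<delta> x (B, e) y"
  then show "realises IC completion_realisation (Z, r) (A, p) \<delta> x (B, e) y"
    using retract_Ob by (auto simp: realises_def seqs_def completion_realisation_class)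
qed

end

section \<open>Direct sums and the axioms in the completion\<close>

context additive_category
begin

text \<open>The idempotents in the completed inclusions and projections are absorbed by
  \<open>f\<close> and \<open>f'\<close>.\<close>

lemma mor_sum_completion:
  assumes "(A, p) \<in> Ob (idempotent_completion C)" "(A', p') \<in> Ob (idempotent_completion C)"
    "(B, q) \<in> Ob (idempotent_completion C)" "(B', q') \<in> Ob (idempotent_completion C)"
    "f \<in> Mor (idempotent_completion C) (A, p) (B, q)"
    "f' \<in> Mor (idempotent_completion C) (A', p') (B', q')"
  shows "mor_sum (idempotent_completion C) (A, p) (A', p') (B, q) (B', q') f f'
    = mor_sum C A A' B B' f f'"
proof -
  note h = assms[unfolded completion_simps]
  have "Comp C X B B q (Comp C X A B f (Comp C X A A p z)) = Comp C X A B f z"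
    if "A \<in> Ob C" "B \<in> Ob C" "p \<in> Mor C A A" "q \<in> Mor C B B" "f \<in> Mor C A B"
      "Comp C A A B f p = f" "Comp C A B B q f = f" "X \<in> Ob C" "z \<in> Mor C X A" for A B p q f X z
    using that Comp_extend[of A A B f p f X z] Comp_extend[of A B B q f f X z] by simp
  then show ?thesis
    using h by (simp add: mor_sum_def Let_def completion_simps additive_simps dsum_simps)
qed

end

context extriangulated_category
begin

text \<open>Both sums have the form given by \<open>ext_sum_eq\<close>. The extra idempotents in the
  completed inclusions and projections act on \<open>\<delta>\<close> as \<open>E(r, p)\<close>,
  which fixes it, and likewise on \<open>\<delta>'\<close>.\<close>

lemma ext_sum_completion:
  assumes "(Z, r) \<in> Ob IC" "(Z', r') \<in> Ob IC" "(A, p) \<in> Ob IC" "(A', p') \<in> Ob IC"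
    "\<delta> \<in> Ext FE (Z, r) (A, p)" "\<delta>' \<in> Ext FE (Z', r') (A', p')"
  shows "ext_sum IC FE (Z, r) (A, p) \<delta> (Z', r') (A', p') \<delta>' = ext_sum C E Z A \<delta> Z' A' \<delta>'"
    and "ext_sum C E Z A \<delta> Z' A' \<delta>' \<in>
      Ext FE (DSum IC (Z, r) (Z', r')) (DSum IC (A, p) (A', p'))"
proof -
  interpret I: biadditive_functor IC FE by (rule biadditive_completion)
  note h = assms[unfolded completion_simps ext_completion_simps]
  have \<delta>: "EMap E Z A Z A r p \<delta> = \<delta>" "EMap E Z' A' Z' A' r' p' \<delta>' = \<delta>'"
    using h by (simp_all add: EMap_push_pull)
  show eq: "ext_sum IC FE (Z, r) (A, p) \<delta> (Z', r') (A', p') \<delta>' = ext_sum C E Z A \<delta> Z' A' \<delta>'"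
    unfolding I.ext_sum_eq(1)[OF assms]
    using h by (simp add: ext_sum_eq completion_simps ext_completion_simps EMap_Comp dsum_simps \<delta>)
  show "ext_sum C E Z A \<delta> Z' A' \<delta>' \<in> Ext FE (DSum IC (Z, r) (Z', r')) (DSum IC (A, p) (A', p'))"
    using I.ext_sum_eq[OF assms] eq by simp
qed

text \<open>The sum of the ambient sequences realises the sum of the extensions by additivity in
  \<open>C\<close>, and \<open>i \<oplus> i'\<close>, \<open>j \<oplus> j'\<close> exhibit the
  required retract of it.\<close>

lemma retract_sum:
  assumes RR: "RR (Z, r) (A, p) \<delta> x (B, e) y" and RR': "RR (Z', r') (A', p') \<delta>' x' (B', e') y'"
  shows "RR (DSum IC (Z, r) (Z', r')) (DSum IC (A, p) (A', p'))
    (ext_sum IC FE (Z, r) (A, p) \<delta> (Z', r') (A', p') \<delta>')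
    (mor_sum IC (A, p) (A', p') (B, e) (B', e') x x') (DSum IC (B, e) (B', e'))
    (mor_sum IC (B, e) (B', e') (Z, r) (Z', r') y y')"
proof -
  interpret I: additive_category IC by (rule additive_completion)
  note ob = retract_Ob[OF RR] and ob' = retract_Ob[OF RR']
  obtain x\<^sub>0 B\<^sub>0 y\<^sub>0 i j where R: "realises_ext Z A \<delta> x\<^sub>0 B\<^sub>0 y\<^sub>0" and 1:
    "Z \<in> Ob C" "A \<in> Ob C" "\<delta> \<in> Ext E Z A" "B\<^sub>0 \<in> Ob C" "x\<^sub>0 \<in> Mor C A B\<^sub>0" "y\<^sub>0 \<in> Mor C B\<^sub>0 Z"
    "B \<in> Ob C" "p \<in> Mor C A A" "r \<in> Mor C Z Z" "e \<in> Mor C B B"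
    "x \<in> Mor C A B" "y \<in> Mor C B Z" "i \<in> Mor C B B\<^sub>0" "j \<in> Mor C B\<^sub>0 B" and 2:
    "Comp C B B B\<^sub>0 i e = i" "Comp C B\<^sub>0 B B e j = j" "Comp C B B\<^sub>0 B j i = e"
    "Comp C A B\<^sub>0 B j x\<^sub>0 = x" "Comp C A B B\<^sub>0 i x = Comp C A A B\<^sub>0 x\<^sub>0 p"
    "Comp C B B\<^sub>0 Z y\<^sub>0 i = y" "Comp C B\<^sub>0 B Z y j = Comp C B\<^sub>0 Z Z r y\<^sub>0"
    by (rule retract_E[OF RR])
  obtain x\<^sub>1 B\<^sub>1 y\<^sub>1 i' j' where R': "realises_ext Z' A' \<delta>' x\<^sub>1 B\<^sub>1 y\<^sub>1" and 3:
    "Z' \<in> Ob C" "A' \<in> Ob C" "\<delta>' \<in> Ext E Z' A'" "B\<^sub>1 \<in> Ob C" "x\<^sub>1 \<in> Mor C A' B\<^sub>1" "y\<^sub>1 \<in> Mor C B\<^sub>1 Z'"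
    "B' \<in> Ob C" "p' \<in> Mor C A' A'" "r' \<in> Mor C Z' Z'" "e' \<in> Mor C B' B'"
    "x' \<in> Mor C A' B'" "y' \<in> Mor C B' Z'" "i' \<in> Mor C B' B\<^sub>1" "j' \<in> Mor C B\<^sub>1 B'" and 4:
    "Comp C B' B' B\<^sub>1 i' e' = i'" "Comp C B\<^sub>1 B' B' e' j' = j'" "Comp C B' B\<^sub>1 B' j' i' = e'"
    "Comp C A' B\<^sub>1 B' j' x\<^sub>1 = x'" "Comp C A' B' B\<^sub>1 i' x' = Comp C A' A' B\<^sub>1 x\<^sub>1 p'"
    "Comp C B' B\<^sub>1 Z' y\<^sub>1 i' = y'" "Comp C B\<^sub>1 B' Z' y' j' = Comp C B\<^sub>1 Z' Z' r' y\<^sub>1"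
    by (rule retract_E[OF RR'])
  note [simp] = 1 3
  have "realises_ext (DSum C Z Z') (DSum C A A') (ext_sum C E Z A \<delta> Z' A' \<delta>')
      (mor_sum C A A' B\<^sub>0 B\<^sub>1 x\<^sub>0 x\<^sub>1) (DSum C B\<^sub>0 B\<^sub>1) (mor_sum C B\<^sub>0 B\<^sub>1 Z Z' y\<^sub>0 y\<^sub>1)"
    using realisation_sum[OF 1(1,2) 3(1,2) 1(3) 3(3) realises_extD(4)[OF R] realises_extD(4)[OF R']]
    by (simp add: realises_ext_def realises_def seqs_def DSum_ob mor_sum_mor ext_sum_eq)
  note I = retract_realisesI[where R = realises_ext and i = "mor_sum C B B' B\<^sub>0 B\<^sub>1 i i'"
      and j = "mor_sum C B\<^sub>0 B\<^sub>1 B B' j j'", OF _ _ _ _ this]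
  have eq: "mor_sum IC (A, p) (A', p') (B, e) (B', e') x x' = mor_sum C A A' B B' x x'"
    "mor_sum IC (B, e) (B', e') (Z, r) (Z', r') y y' = mor_sum C B B' Z Z' y y'"
    by (rule mor_sum_completion; fact)+
  note ext = ext_sum_completion[OF ob(1) ob'(1) ob(2) ob'(2) ob(4) ob'(4), unfolded completion_DSum]
  note dsum = I.DSum_ob[OF ob(1) ob'(1), unfolded completion_DSum]
    I.DSum_ob[OF ob(2) ob'(2), unfolded completion_DSum]
    I.DSum_ob[OF ob(3) ob'(3), unfolded completion_DSum]
  show ?thesis
    unfolding completion_DSum eq ext(1)
    by (rule I) (simp_all add: dsum ext(2) mor_sum_mor mor_sum_Comp 2 4)
qed

theorem extriangulated_completion:
  "extriangulated_category IC FE completion_realisation"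
proof -
  interpret I: biadditive_functor IC FE by (rule biadditive_completion)
  have realisesD: "RR Z A \<delta> x B y"
    if "realises IC completion_realisation Z A \<delta> x B y" "Z \<in> Ob IC" "A \<in> Ob IC" for Z A \<delta> x B y
  proof -
    obtain Z\<^sub>0 r A\<^sub>0 p B\<^sub>0 e where [simp]: "Z = (Z\<^sub>0, r)" "A = (A\<^sub>0, p)" "B = (B\<^sub>0, e)"
      by (cases Z, cases A, cases B)
    show ?thesis using that by (simp add: realises_completion_iff)
  qed
  have realisesI: "realises IC completion_realisation Z A \<delta> x B y" if "RR Z A \<delta> x B y" for Z A \<delta> x B y
  proof -
    obtain Z\<^sub>0 r A\<^sub>0 p B\<^sub>0 e where [simp]: "Z = (Z\<^sub>0, r)" "A = (A\<^sub>0, p)" "B = (B\<^sub>0, e)"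
      by (cases Z, cases A, cases B)
    show ?thesis using that retract_Ob(1,2) by (simp add: realises_completion_iff)
  qed
  have "additive_realisation IC FE completion_realisation"
  proof (intro additive_realisation.intro biadditive_completion additive_realisation_axioms.intro,
      goal_cases)
    case (1 Z A \<delta>)
    obtain Z\<^sub>0 r A\<^sub>0 p where [simp]: "Z = (Z\<^sub>0, r)" "A = (A\<^sub>0, p)" by (cases Z, cases A)
    obtain x B e y where RR: "RR (Z\<^sub>0, r) (A\<^sub>0, p) \<delta> x (B, e) y" by (rule retract_exists[of Z\<^sub>0 r A\<^sub>0 p \<delta>]) (use 1 in simp_all)
    show ?case
      using retract_Ob[OF RR] unfolding \<open>Z = _\<close> \<open>A = _\<close> completion_realisation_class[OF RR] seq_class_def
      by (intro quotientI) (simp add: seqs_def)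
  next
    case (2 Z A Z' A' \<delta> \<delta>' x B y x' B' y' a c)
    obtain Z\<^sub>0 r A\<^sub>0 p Z\<^sub>1 r' A\<^sub>1 p' where [simp]: "Z = (Z\<^sub>0, r)" "A = (A\<^sub>0, p)" "Z' = (Z\<^sub>1, r')" "A' = (A\<^sub>1, p')"
      by (cases Z, cases A, cases Z', cases A')
    obtain B\<^sub>0 e B\<^sub>1 e' where [simp]: "B = (B\<^sub>0, e)" "B' = (B\<^sub>1, e')"
      by (cases B, cases B')
    have RR: "RR (Z\<^sub>0, r) (A\<^sub>0, p) \<delta> x (B\<^sub>0, e) y" "RR (Z\<^sub>1, r') (A\<^sub>1, p') \<delta>' x' (B\<^sub>1, e') y'"
      using realisesD[OF 2(7,1,2)] realisesD[OF 2(8,3,4)] by simp_all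
    have a: "a \<in> Mor IC (A\<^sub>0, p) (A\<^sub>1, p')" "c \<in> Mor IC (Z\<^sub>0, r) (Z\<^sub>1, r')"
      "push IC FE Z A A' a \<delta> = pull IC FE Z' Z A' c \<delta>'"
      using 2(9) by (simp_all add: ext_morphism_def)
    then have "push C E Z\<^sub>0 A\<^sub>0 A\<^sub>1 a \<delta> = pull C E Z\<^sub>1 Z\<^sub>0 A\<^sub>1 c \<delta>'"
      using 2(1-6) by (simp add: completion_push completion_pull completion_simps ext_completion_simps)
    from retract_morphism[OF RR a(1,2) this] show ?case
      by (auto simp: realises_morphism_def completion_Comp)
  next
    \<comment> \<open>The split sequence of \<open>C\<close> on \<open>A\<^sub>0\<close> and
      \<open>Z\<^sub>0\<close> is cut down by \<open>p \<oplus> r\<close>, the identity of the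
      direct sum in the completion.\<close>
    case (3 Z A)
    obtain Z\<^sub>0 r A\<^sub>0 p where [simp]: "Z = (Z\<^sub>0, r)" "A = (A\<^sub>0, p)" by (cases Z, cases A)
    note [simp] = 3[simplified, unfolded completion_simps]
    have "RR (Z\<^sub>0, r) (A\<^sub>0, p) \<one>\<^bsub>EGrp E Z\<^sub>0 A\<^sub>0\<^esub> (Comp C A\<^sub>0 A\<^sub>0 (DSum C A\<^sub>0 Z\<^sub>0) (In1 C A\<^sub>0 Z\<^sub>0) p)
        (DSum C A\<^sub>0 Z\<^sub>0, mor_sum C A\<^sub>0 Z\<^sub>0 A\<^sub>0 Z\<^sub>0 p r) (Comp C (DSum C A\<^sub>0 Z\<^sub>0) Z\<^sub>0 Z\<^sub>0 r (Pr2 C A\<^sub>0 Z\<^sub>0))"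
      by (rule retract_standard[OF realises_ext_zero])
        (simp_all add: ext_simps mor_sum_mor mor_sum_Comp mor_sum_In1 mor_sum_Pr2)
    then show ?case
      using completion_realisation_class by (simp add: completion_simps ext_completion_simps)
  next
    case (4 Z A Z' A' \<delta> \<delta>' x B y x' B' y')
    obtain Z\<^sub>0 r A\<^sub>0 p Z\<^sub>1 r' A\<^sub>1 p' where [simp]: "Z = (Z\<^sub>0, r)" "A = (A\<^sub>0, p)" "Z' = (Z\<^sub>1, r')" "A' = (A\<^sub>1, p')"
      by (cases Z, cases A, cases Z', cases A')
    obtain B\<^sub>0 e B\<^sub>1 e' where [simp]: "B = (B\<^sub>0, e)" "B' = (B\<^sub>1, e')"
      by (cases B, cases B')
    have RR: "RR (Z\<^sub>0, r) (A\<^sub>0, p) \<delta> x (B\<^sub>0, e) y" "RR (Z\<^sub>1, r') (A\<^sub>1, p') \<delta>' x' (B\<^sub>1, e') y'"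
      using realisesD[OF 4(7,1,2)] realisesD[OF 4(8,3,4)] by simp_all
    from realisesI[OF retract_sum[OF RR]] show ?case by (simp add: realises_def)
  qed
  then show ?thesis
  proof (intro extriangulated_category.intro extriangulated_category_axioms.intro, goal_cases)
    case (2 Z A Z' A' \<delta> \<delta>' x B y x' B' y' a b)
    obtain Z\<^sub>0 r A\<^sub>0 p Z\<^sub>1 r' A\<^sub>1 p' where [simp]: "Z = (Z\<^sub>0, r)" "A = (A\<^sub>0, p)" "Z' = (Z\<^sub>1, r')" "A' = (A\<^sub>1, p')"
      by (cases Z, cases A, cases Z', cases A')
    obtain B\<^sub>0 e B\<^sub>1 e' where [simp]: "B = (B\<^sub>0, e)" "B' = (B\<^sub>1, e')"
      by (cases B, cases B')
    have RR: "RR (Z\<^sub>0, r) (A\<^sub>0, p) \<delta> x (B\<^sub>0, e) y" "RR (Z\<^sub>1, r') (A\<^sub>1, p') \<delta>' x' (B\<^sub>1, e') y'"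
      using realisesD[OF 2(8,2,3)] realisesD[OF 2(9,4,5)] by simp_all
    obtain c where c: "c \<in> Mor IC (Z\<^sub>0, r) (Z\<^sub>1, r')" "push C E Z\<^sub>0 A\<^sub>0 A\<^sub>1 a \<delta> = pull C E Z\<^sub>1 Z\<^sub>0 A\<^sub>1 c \<delta>'"
      "Comp C B\<^sub>0 B\<^sub>1 Z\<^sub>1 y' b = Comp C B\<^sub>0 Z\<^sub>0 Z\<^sub>1 c y"
      by (rule retract_ET3[OF RR, of a b]) (use 2 in \<open>simp_all add: completion_Comp\<close>)
    then show ?case
      using 2 by (intro exI[of _ c]) (auto simp: ext_morphism_def realises_morphism_def
          completion_push completion_pull completion_simps ext_completion_simps)
  next
    case (3 Z A Z' A' \<delta> \<delta>' x B y x' B' y' b c)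
    obtain Z\<^sub>0 r A\<^sub>0 p Z\<^sub>1 r' A\<^sub>1 p' where [simp]: "Z = (Z\<^sub>0, r)" "A = (A\<^sub>0, p)" "Z' = (Z\<^sub>1, r')" "A' = (A\<^sub>1, p')"
      by (cases Z, cases A, cases Z', cases A')
    obtain B\<^sub>0 e B\<^sub>1 e' where [simp]: "B = (B\<^sub>0, e)" "B' = (B\<^sub>1, e')"
      by (cases B, cases B')
    have RR: "RR (Z\<^sub>0, r) (A\<^sub>0, p) \<delta> x (B\<^sub>0, e) y" "RR (Z\<^sub>1, r') (A\<^sub>1, p') \<delta>' x' (B\<^sub>1, e') y'"
      using realisesD[OF 3(8,2,3)] realisesD[OF 3(9,4,5)] by simp_all
    obtain a where a: "a \<in> Mor IC (A\<^sub>0, p) (A\<^sub>1, p')" "push C E Z\<^sub>0 A\<^sub>0 A\<^sub>1 a \<delta> = pull C E Z\<^sub>1 Z\<^sub>0 A\<^sub>1 c \<delta>'"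
      "Comp C A\<^sub>0 B\<^sub>0 B\<^sub>1 b x = Comp C A\<^sub>0 A\<^sub>1 B\<^sub>1 x' a"
      by (rule retract_ET3_op[OF RR, of b c]) (use 3 in \<open>simp_all add: completion_Comp\<close>)
    then show ?case
      using 3 by (intro exI[of _ a]) (auto simp: ext_morphism_def realises_morphism_def
          completion_push completion_pull completion_simps ext_completion_simps)
  next
    case (4 A B D F \<delta> \<delta>' f f' g X g')
    obtain A\<^sub>0 p B\<^sub>0 q D\<^sub>0 d F\<^sub>0 s where [simp]: "A = (A\<^sub>0, p)" "B = (B\<^sub>0, q)" "D = (D\<^sub>0, d)" "F = (F\<^sub>0, s)"
      by (cases A, cases B, cases D, cases F)
    obtain X\<^sub>0 e where [simp]: "X = (X\<^sub>0, e)" by (cases X)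
    have RR: "RR (D\<^sub>0, d) (A\<^sub>0, p) \<delta> f (B\<^sub>0, q) f'" "RR (F\<^sub>0, s) (B\<^sub>0, q) \<delta>' g (X\<^sub>0, e) g'"
      using realisesD[OF 4(8,4,2)] realisesD[OF 4(9,5,3)] by simp_all
    note ob = retract_Ob[OF RR(1)] retract_Ob[OF RR(2)]
    obtain Y c h' u v \<delta>'' where *: "(Y, c) \<in> Ob IC"
      "h' \<in> Mor IC (X\<^sub>0, e) (Y, c)" "u \<in> Mor IC (D\<^sub>0, d) (Y, c)" "v \<in> Mor IC (Y, c) (F\<^sub>0, s)"
      "\<delta>'' \<in> Ext FE (Y, c) (A\<^sub>0, p)"
      "Comp C B\<^sub>0 X\<^sub>0 Y h' g = Comp C B\<^sub>0 D\<^sub>0 Y u f'" "Comp C X\<^sub>0 Y F\<^sub>0 v h' = g'"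
      and RR': "RR (Y, c) (A\<^sub>0, p) \<delta>'' (Comp C A\<^sub>0 B\<^sub>0 X\<^sub>0 g f) (X\<^sub>0, e) h'"
      "RR (F\<^sub>0, s) (D\<^sub>0, d) (push C E F\<^sub>0 B\<^sub>0 D\<^sub>0 f' \<delta>') u (Y, c) v"
      and ext: "pull C E Y D\<^sub>0 A\<^sub>0 u \<delta>'' = \<delta>" "push C E Y A\<^sub>0 B\<^sub>0 f \<delta>'' = pull C E F\<^sub>0 Y B\<^sub>0 v \<delta>'"
      by (rule retract_ET4[OF RR])
    \<comment> \<open>The extensions involved are fixed by the idempotents of their ends, so the
      operations of the completion reduce to those of \<open>C\<close>.\<close>
    have "push IC FE F B D f' \<delta>' = push C E F\<^sub>0 B\<^sub>0 D\<^sub>0 f' \<delta>'"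
      "pull IC FE (Y, c) D A u \<delta>'' = \<delta>" "push IC FE (Y, c) A B f \<delta>'' = pull IC FE F (Y, c) B v \<delta>'"
      using ob * ext by (simp_all add: completion_push completion_pull completion_simps ext_completion_simps)
    moreover have "Comp C A\<^sub>0 B\<^sub>0 X\<^sub>0 g f \<in> Mor IC (A\<^sub>0, p) (X\<^sub>0, e)" using retract_Ob(5)[OF RR'(1)] .
    ultimately show ?case
      using * realisesI[OF RR'(1)] realisesI[OF RR'(2)]
      by (intro exI[of _ "(Y, c)"] exI[of _ "Comp C A\<^sub>0 B\<^sub>0 X\<^sub>0 g f"] exI[of _ h'] exI[of _ u] exI[of _ v]
          exI[of _ \<delta>'']) (simp add: completion_Comp)
  next
    case (5 B D F X \<delta> \<delta>' f' A f g' g)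
    obtain X\<^sub>0 e B\<^sub>0 q D\<^sub>0 d F\<^sub>0 s where [simp]: "X = (X\<^sub>0, e)" "B = (B\<^sub>0, q)" "D = (D\<^sub>0, d)" "F = (F\<^sub>0, s)"
      by (cases X, cases B, cases D, cases F)
    obtain A\<^sub>0 p where [simp]: "A = (A\<^sub>0, p)" by (cases A)
    have RR: "RR (B\<^sub>0, q) (D\<^sub>0, d) \<delta> f' (A\<^sub>0, p) f" "RR (X\<^sub>0, e) (F\<^sub>0, s) \<delta>' g' (B\<^sub>0, q) g"
      using realisesD[OF 5(8,2,3)] realisesD[OF 5(9,5,4)] by simp_all
    note ob = retract_Ob[OF RR(1)] retract_Ob[OF RR(2)]
    obtain Y c h' u v \<delta>'' where *: "(Y, c) \<in> Ob IC"
      "h' \<in> Mor IC (Y, c) (A\<^sub>0, p)" "u \<in> Mor IC (Y, c) (F\<^sub>0, s)" "v \<in> Mor IC (D\<^sub>0, d) (Y, c)"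
      "\<delta>'' \<in> Ext FE (X\<^sub>0, e) (Y, c)"
      "Comp C Y A\<^sub>0 B\<^sub>0 f h' = Comp C Y F\<^sub>0 B\<^sub>0 g' u" "Comp C D\<^sub>0 Y A\<^sub>0 h' v = f'"
      and RR': "RR (X\<^sub>0, e) (Y, c) \<delta>'' h' (A\<^sub>0, p) (Comp C A\<^sub>0 B\<^sub>0 X\<^sub>0 g f)"
      "RR (F\<^sub>0, s) (D\<^sub>0, d) (pull C E B\<^sub>0 F\<^sub>0 D\<^sub>0 g' \<delta>) v (Y, c) u"
      and ext: "push C E X\<^sub>0 Y F\<^sub>0 u \<delta>'' = \<delta>'" "pull C E X\<^sub>0 B\<^sub>0 Y g \<delta>'' = push C E B\<^sub>0 D\<^sub>0 Y v \<delta>"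
      by (rule retract_ET4_op[OF RR])
    have "pull IC FE B F D g' \<delta> = pull C E B\<^sub>0 F\<^sub>0 D\<^sub>0 g' \<delta>"
      "push IC FE X (Y, c) F u \<delta>'' = \<delta>'" "push IC FE B D (Y, c) v \<delta> = pull IC FE X B (Y, c) g \<delta>''"
      using ob * ext by (simp_all add: completion_push completion_pull completion_simps ext_completion_simps)
    moreover have "Comp C A\<^sub>0 B\<^sub>0 X\<^sub>0 g f \<in> Mor IC (A\<^sub>0, p) (X\<^sub>0, e)" using retract_Ob(6)[OF RR'(1)] .
    ultimately show ?case
      using * realisesI[OF RR'(1)] realisesI[OF RR'(2)]
      by (intro exI[of _ "(Y, c)"] exI[of _ v] exI[of _ u] exI[of _ h'] exI[of _ "Comp C A\<^sub>0 B\<^sub>0 X\<^sub>0 g f"]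
          exI[of _ \<delta>'']) (simp add: completion_Comp)
  qed
qed

text \<open>Over identity idempotents every extension is fixed, so the natural transformation
  consists of identity maps, and a realising sequence of \<open>C\<close> is a retract of
  itself.\<close>

theorem extriangulated_embedding:
  "extriangulated_functor C E \<ss> IC FE completion_realisation (\<lambda>A. (A, Ident C A)) (\<lambda>A B f. f)"
proof -
  have "additive_functor C IC (\<lambda>A. (A, Ident C A)) (\<lambda>A B f. f)"
    by (intro additive_functor.intro additive_functor_axioms.intro additive_category_axioms
        additive_completion) (auto simp: completion_simps cat_simps hom_def)
  moreover have "ext_natural_transformation C E FE (\<lambda>A. (A, Ident C A)) (\<lambda>A B f. f) (\<lambda>Z A \<delta>. \<delta>)"
    by (auto simp: ext_natural_transformation_def ext_completion_simps hom_def push_Ident pull_Ident)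
  moreover have "realises IC completion_realisation (Z, Ident C Z) (X, Ident C X) \<delta> x (Y, Ident C Y) y"
    if "Z \<in> Ob C" "X \<in> Ob C" "\<delta> \<in> Ext E Z X" "realises C \<ss> Z X \<delta> x Y y" for Z X \<delta> x Y y
  proof -
    have R: "realises_ext Z X \<delta> x Y y" using that by (simp add: realises_ext_def)
    note [simp] = realises_extD[OF R]
    have "RR (Z, Ident C Z) (X, Ident C X) \<delta> (Comp C X X Y x (Ident C X)) (Y, Ident C Y)
        (Comp C Y Z Z (Ident C Z) y)"
      by (rule retract_standard[OF R]) (simp_all add: ext_simps)
    then show ?thesis by (simp add: realises_completion_iff completion_simps cat_simps)
  qed
  ultimately show ?thesis
    by (intro extriangulated_functor.intro extriangulated_functor_axioms.intro
        extriangulated_category_axioms extriangulated_completion exI[of _ "\<lambda>Z A \<delta>. \<delta>"]) auto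
qed

end

theorem theorem3p1:
  fixes C :: "('o, 'm) category_data"
    and E :: "('o, 'm, 'e) bifunctor_data"
    and \<ss> :: "('o, 'm, 'e) correspondence"
  assumes "extriangulated_category C E \<ss>"
  shows "\<exists>(F :: ('o \<times> 'm, 'm, 'e) bifunctor_data) (\<rr> :: ('o \<times> 'm, 'm, 'e) correspondence).
    extriangulated_category (idempotent_completion C) F \<rr> \<and>
    extriangulated_functor C E \<ss> (idempotent_completion C) F \<rr>
      (\<lambda>A. (A, Ident C A)) (\<lambda>A B f. f)"
  using extriangulated_category.extriangulated_completion[OF assms]
    extriangulated_category.extriangulated_embedding[OF assms] by blast

end
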